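(* Let $f$ be a real-valued, nonvanishing, continuously differentiable function of $\xi\ge 0$ with $f(0)=1$, and consider the hyperbolic Vekua equation $$\partial_{\overline{z}}W-\frac{f'(\xi)}{2f(\xi)}\overline{W}=0,\qquad \partial_{\overline{z}}=\tfrac12(\partial_\xi-j\partial_t),$$ for a bicomplex-valued function $W(\xi,t)$. Let $W_0(t)$, $t\in[\alpha,\beta]$, be a given continuously differentiable bicomplex-valued function. Then the unique solution of this equation satisfying $W(0,t)=W_0(t)$ is given (for $\xi>0$ and $t$ with $t\pm\xi\in[\alpha,\beta]$) by $$\begin{aligned} W(\xi,t)&=\tfrac12\bigl(W_0^+(t+\xi)+W_0^-(t-\xi)\bigr)+\tfrac12\sum_{n=0}^\infty\frac{a_n(\xi)}{\xi}\int_{-\xi}^{\xi}P_n\!\left(\frac{\tau}{\xi}\right)\bigl(W_0^+(t+\tau)+W_0^-(t-\tau)\bigr)\,d\tau\\ &\quad+\tfrac{j}{2}\bigl(W_0^+(t+\xi)-W_0^-(t-\xi)\bigr)+\tfrac{j}{2}\sum_{n=0}^\infty\frac{b_n(\xi)}{\xi}\int_{-\xi}^{\xi}P_n\!\left(\frac{\tau}{\xi}\right)\bigl(W_0^+(t+\tau)-W_0^-(t-\tau)\bigr)\,d\tau\\ &=P^+W_0^+(t+\xi)+P^-W_0^-(t-\xi)+\frac{1}{2\xi}\sum_{n=0}^\infty\bigl(a_n(\xi)+jb_n(\xi)\bigr)\int_{-\xi}^{\xi}P_n\!\left(\frac{\tau}{\xi}\right)W_0^+(t+\tau)\,d\tau\\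 &\quad+\frac{1}{2\xi}\sum_{n=0}^\infty\bigl(a_n(\xi)-jb_n(\xi)\bigr)\int_{-\xi}^{\xi}P_n\!\left(\frac{\tau}{\xi}\right)W_0^-(t-\tau)\,d\tau . \end{aligned}$$ Consequently, for the 1+1 Maxwell system $\varepsilon(x)\partial_t\mathcal{E}=i\partial_x\mathcal{H}$, $i\partial_x\mathcal{E}=-\mu\partial_t\mathcal{H}$ with $\mathcal{E}(0,t)=\mathcal{E}_0(t)$, $\mathcal{H}(0,t)=\mathcal{H}_0(t)$ ($t\in[\alpha,\beta]$, $\mathcal{E}_0,\mathcal{H}_0$ continuously differentiable), with $f$, $W_0$ related to $\varepsilon,\mu,\mathcal{E}_0,\mathcal{H}_0$ as in the context, the unique solution is obtained from this $W$ via $\widetilde{\mathcal{E}}(\xi,t)=\frac{1}{\sqrt{\widetilde c(\xi)\widetilde\varepsilon(\xi)}}\mathcal{R}(W(\xi,t))$, $\widetilde{\mathcal{H}}(\xi,t)=-\frac{i}{\sqrt{\widetilde c(\xi)\mu}}\mathcal{I}(W(\xi,t))$ and the inverse change of variable $\xi\mapsto x$.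
   Context: Bicomplex numbers: $w=u+vj$ with $u,v\in\mathbb{C}$ (complex unit $i$), where $j$ is a hyperbolic imaginary unit, $j^2=1$, commuting with $i$. Conjugation with respect to $j$: $\overline{w}=u-vj$. Notation: $\mathcal{R}(w)=u$, $\mathcal{I}(w)=v$, $w^{\pm}=\mathcal{R}(w)\pm\mathcal{I}(w)$ (complex-valued), $P^{\pm}=\tfrac12(1\pm j)$. $P_n$ is the Legendre polynomial of degree $n$, $P_n(x)=\sum_{k=0}^n l_{k,n}x^k$. Recursive integrals: $X^{(0)}\equiv1$, $X^{(n)}(\xi)=n\int_0^\xi X^{(n-1)}(s)\,(f^2(s))^{(-1)^n}ds$; $\widetilde X^{(0)}\equiv1$, $\widetilde X^{(n)}(\xi)=n\int_0^\xi\widetilde X^{(n-1)}(s)\,(f^2(s))^{(-1)^{n-1}}ds$. Define $\varphi_k=fX^{(k)}$ for $k$ odd, $\varphi_k=f\widetilde X^{(k)}$ for $k$ even; $\psi_k=\widetilde X^{(k)}/f$ for $k$ odd, $\psi_k=X^{(k)}/f$ for $k$ even. Then $a_n(\xi)=\frac{2n+1}{2}\Bigl(\sum_{k=0}^n\frac{l_{k,n}\varphi_k(\xi)}{\xi^k}-1\Bigr)$, $b_n(\xi)=\frac{2n+1}{2}\Bigl(\sum_{k=0}^n\frac{l_{k,n}\psi_k(\xi)}{\xi^k}-1\Bigr)$. Maxwell setting: $\varepsilon(x)>0$ real-valued, $\mu>0$ constant, $c(x)=1/\sqrt{\varepsilon(x)\mu}$; $\mathcal{E}=E_2+iE_3$,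 $\mathcal{H}=H_2+iH_3$; new variable $\xi(x)=\sqrt{\mu}\int_0^x\sqrt{\varepsilon(s)}ds$; a tilde denotes a function of $x$ rewritten as a function of $\xi$, e.g. $\widetilde c(\xi(x))=c(x)$; $f(\xi)=\sqrt{\widetilde c(0)}/\sqrt{\widetilde c(\xi)}$; $W(\xi,t)=\sqrt{\widetilde c(\xi)}\bigl(\sqrt{\widetilde\varepsilon(\xi)}\,\widetilde{\mathcal{E}}(\xi,t)+ij\sqrt{\mu}\,\widetilde{\mathcal{H}}(\xi,t)\bigr)$ and $W_0=\sqrt{c(0)\varepsilon(0)}\,\mathcal{E}_0+ij\sqrt{c(0)\mu}\,\mathcal{H}_0$. *)

theory Defs
  imports "HOL-Analysis.Analysis" "HOL-Computational_Algebra.Polynomial"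
begin

text \<open>A bicomplex number w = u + v j (u, v complex, j hyperbolic unit, j^2 = 1,
  commuting with i) is represented by the pair (u, v).  Addition and real scaling
  are the componentwise (product vector space) operations.\<close>

type_synonym bicomplex = "complex \<times> complex"

definition bc_of_complex :: "complex \<Rightarrow> bicomplex" where
  "bc_of_complex u = (u, 0)"

definition bc_j :: bicomplex where
  "bc_j = (0, 1)"

definition bc_mult :: "bicomplex \<Rightarrow> bicomplex \<Rightarrow> bicomplex" where
  "bc_mult w z = (fst w * fst z + snd w * snd z, fst w * snd z + snd w * fst z)"

definition bc_conj :: "bicomplex \<Rightarrow> bicomplex" where
  "bc_conj w = (fst w, - snd w)"

definition bc_R :: "bicomplex \<Rightarrow> complex" where
  "bc_R w = fst w"

definition bc_I :: "bicomplex \<Rightarrow> complex" where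
  "bc_I w = snd w"

definition bc_plus :: "bicomplex \<Rightarrow> complex" where
  "bc_plus w = bc_R w + bc_I w"

definition bc_minus :: "bicomplex \<Rightarrow> complex" where
  "bc_minus w = bc_R w - bc_I w"

definition bc_Pp :: bicomplex where
  "bc_Pp = (1/2) *\<^sub>R (bc_of_complex 1 + bc_j)"

definition bc_Pm :: bicomplex where
  "bc_Pm = (1/2) *\<^sub>R (bc_of_complex 1 - bc_j)"

definition C1_on :: "real set \<Rightarrow> (real \<Rightarrow> 'a::real_normed_vector) \<Rightarrow> bool" where
  "C1_on S g \<longleftrightarrow> (\<exists>g'. continuous_on S g' \<and>
      (\<forall>x\<in>S. (g has_vector_derivative g' x) (at x within S)))"

text \<open>Defined by P_0 = 1, P_1 = x and Bonnet's recursion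
  (n+1) P_(n+1) = (2n+1) x P_n - n P_(n-1).  The coefficient l_(k,n) is
  coeff (legendre n) k.\<close>

fun legendre :: "nat \<Rightarrow> real poly" where
  "legendre 0 = 1"
| "legendre (Suc 0) = [:0, 1:]"
| "legendre (Suc (Suc n)) =
     smult (1 / real (n + 2))
       (smult (real (2 * n + 3)) ([:0, 1:] * legendre (Suc n)) - smult (real (n + 1)) (legendre n))"

primrec Xrec :: "(real \<Rightarrow> real) \<Rightarrow> nat \<Rightarrow> real \<Rightarrow> real" where
  "Xrec f 0 = (\<lambda>\<xi>. 1)"
| "Xrec f (Suc n) = (\<lambda>\<xi>. real (Suc n) *
     integral {0..\<xi>} (\<lambda>s. Xrec f n s * (if even (Suc n) then (f s)\<^sup>2 else 1 / (f s)\<^sup>2)))"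

primrec Xtil :: "(real \<Rightarrow> real) \<Rightarrow> nat \<Rightarrow> real \<Rightarrow> real" where
  "Xtil f 0 = (\<lambda>\<xi>. 1)"
| "Xtil f (Suc n) = (\<lambda>\<xi>. real (Suc n) *
     integral {0..\<xi>} (\<lambda>s. Xtil f n s * (if even n then (f s)\<^sup>2 else 1 / (f s)\<^sup>2)))"

definition phi :: "(real \<Rightarrow> real) \<Rightarrow> nat \<Rightarrow> real \<Rightarrow> real" where
  "phi f k \<xi> = (if odd k then f \<xi> * Xrec f k \<xi> else f \<xi> * Xtil f k \<xi>)"

definition psi :: "(real \<Rightarrow> real) \<Rightarrow> nat \<Rightarrow> real \<Rightarrow> real" where
  "psi f k \<xi> = (if odd k then Xtil f k \<xi> / f \<xi> else Xrec f k \<xi> / f \<xi>)"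

definition acoef :: "(real \<Rightarrow> real) \<Rightarrow> nat \<Rightarrow> real \<Rightarrow> real" where
  "acoef f n \<xi> = (2 * real n + 1) / 2 *
     ((\<Sum>k\<le>n. coeff (legendre n) k * phi f k \<xi> / \<xi> ^ k) - 1)"

definition bcoef :: "(real \<Rightarrow> real) \<Rightarrow> nat \<Rightarrow> real \<Rightarrow> real" where
  "bcoef f n \<xi> = (2 * real n + 1) / 2 *
     ((\<Sum>k\<le>n. coeff (legendre n) k * psi f k \<xi> / \<xi> ^ k) - 1)"

definition termA1 :: "(real \<Rightarrow> real) \<Rightarrow> (real \<Rightarrow> bicomplex) \<Rightarrow> real \<Rightarrow> real \<Rightarrow> nat \<Rightarrow> complex" where
  "termA1 f W0 \<xi> t n = complex_of_real (acoef f n \<xi> / \<xi>) *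
     integral {-\<xi>..\<xi>} (\<lambda>\<tau>. complex_of_real (poly (legendre n) (\<tau> / \<xi>)) *
        (bc_plus (W0 (t + \<tau>)) + bc_minus (W0 (t - \<tau>))))"

definition termB1 :: "(real \<Rightarrow> real) \<Rightarrow> (real \<Rightarrow> bicomplex) \<Rightarrow> real \<Rightarrow> real \<Rightarrow> nat \<Rightarrow> complex" where
  "termB1 f W0 \<xi> t n = complex_of_real (bcoef f n \<xi> / \<xi>) *
     integral {-\<xi>..\<xi>} (\<lambda>\<tau>. complex_of_real (poly (legendre n) (\<tau> / \<xi>)) *
        (bc_plus (W0 (t + \<tau>)) - bc_minus (W0 (t - \<tau>))))"

definition vekua_formula1 :: "(real \<Rightarrow> real) \<Rightarrow> (real \<Rightarrow> bicomplex) \<Rightarrow> real \<Rightarrow> real \<Rightarrow> bicomplex" where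
  "vekua_formula1 f W0 \<xi> t =
     bc_of_complex ((1/2) * (bc_plus (W0 (t + \<xi>)) + bc_minus (W0 (t - \<xi>)))
                    + (1/2) * (\<Sum>n. termA1 f W0 \<xi> t n))
   + bc_mult bc_j (bc_of_complex ((1/2) * (bc_plus (W0 (t + \<xi>)) - bc_minus (W0 (t - \<xi>)))
                    + (1/2) * (\<Sum>n. termB1 f W0 \<xi> t n)))"

definition termA2 :: "(real \<Rightarrow> real) \<Rightarrow> (real \<Rightarrow> bicomplex) \<Rightarrow> real \<Rightarrow> real \<Rightarrow> nat \<Rightarrow> bicomplex" where
  "termA2 f W0 \<xi> t n =
     bc_mult (bc_of_complex (complex_of_real (acoef f n \<xi>))
              + bc_mult bc_j (bc_of_complex (complex_of_real (bcoef f n \<xi>))))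
       (bc_of_complex (integral {-\<xi>..\<xi>}
          (\<lambda>\<tau>. complex_of_real (poly (legendre n) (\<tau> / \<xi>)) * bc_plus (W0 (t + \<tau>)))))"

definition termB2 :: "(real \<Rightarrow> real) \<Rightarrow> (real \<Rightarrow> bicomplex) \<Rightarrow> real \<Rightarrow> real \<Rightarrow> nat \<Rightarrow> bicomplex" where
  "termB2 f W0 \<xi> t n =
     bc_mult (bc_of_complex (complex_of_real (acoef f n \<xi>))
              - bc_mult bc_j (bc_of_complex (complex_of_real (bcoef f n \<xi>))))
       (bc_of_complex (integral {-\<xi>..\<xi>}
          (\<lambda>\<tau>. complex_of_real (poly (legendre n) (\<tau> / \<xi>)) * bc_minus (W0 (t - \<tau>)))))"

definition vekua_formula2 :: "(real \<Rightarrow> real) \<Rightarrow> (real \<Rightarrow> bicomplex) \<Rightarrow> real \<Rightarrow> real \<Rightarrow> bicomplex" where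
  "vekua_formula2 f W0 \<xi> t =
     bc_mult bc_Pp (bc_of_complex (bc_plus (W0 (t + \<xi>))))
   + bc_mult bc_Pm (bc_of_complex (bc_minus (W0 (t - \<xi>))))
   + (1 / (2 * \<xi>)) *\<^sub>R (\<Sum>n. termA2 f W0 \<xi> t n)
   + (1 / (2 * \<xi>)) *\<^sub>R (\<Sum>n. termB2 f W0 \<xi> t n)"

definition char_triangle :: "real \<Rightarrow> real \<Rightarrow> (real \<times> real) set" where
  "char_triangle \<alpha> \<beta> = {(\<xi>, t). 0 \<le> \<xi> \<and> \<alpha> \<le> t - \<xi> \<and> t + \<xi> \<le> \<beta>}"

definition char_triangle_int :: "real \<Rightarrow> real \<Rightarrow> (real \<times> real) set" where
  "char_triangle_int \<alpha> \<beta> = {(\<xi>, t). 0 < \<xi> \<and> \<alpha> < t - \<xi> \<and> t + \<xi> < \<beta>}"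

definition vekua_solution ::
  "(real \<Rightarrow> real) \<Rightarrow> real \<Rightarrow> real \<Rightarrow> (real \<Rightarrow> bicomplex) \<Rightarrow> (real \<Rightarrow> real \<Rightarrow> bicomplex) \<Rightarrow> bool" where
  "vekua_solution f \<alpha> \<beta> W0 W \<longleftrightarrow>
     continuous_on (char_triangle \<alpha> \<beta>) (\<lambda>(\<xi>, t). W \<xi> t) \<and>
     (\<forall>t\<in>{\<alpha>..\<beta>}. W 0 t = W0 t) \<and>
     (\<exists>W\<xi> Wt.
        continuous_on (char_triangle_int \<alpha> \<beta>) (\<lambda>(\<xi>, t). W\<xi> \<xi> t) \<and>
        continuous_on (char_triangle_int \<alpha> \<beta>) (\<lambda>(\<xi>, t). Wt \<xi> t) \<and>
        (\<forall>\<xi> t. (\<xi>, t) \<in> char_triangle_int \<alpha> \<beta> \<longrightarrow>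
           ((\<lambda>s. W s t) has_vector_derivative W\<xi> \<xi> t) (at \<xi>) \<and>
           ((\<lambda>s. W \<xi> s) has_vector_derivative Wt \<xi> t) (at t) \<and>
           (1/2) *\<^sub>R (W\<xi> \<xi> t - bc_mult bc_j (Wt \<xi> t))
             - (deriv f \<xi> / (2 * f \<xi>)) *\<^sub>R bc_conj (W \<xi> t) = 0))"

definition c_of :: "(real \<Rightarrow> real) \<Rightarrow> real \<Rightarrow> real \<Rightarrow> real" where
  "c_of \<epsilon> \<mu> x = 1 / sqrt (\<epsilon> x * \<mu>)"

definition xi_of :: "(real \<Rightarrow> real) \<Rightarrow> real \<Rightarrow> real \<Rightarrow> real" where
  "xi_of \<epsilon> \<mu> x = sqrt \<mu> * integral {0..x} (\<lambda>s. sqrt (\<epsilon> s))"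

definition x_of :: "(real \<Rightarrow> real) \<Rightarrow> real \<Rightarrow> real \<Rightarrow> real" where
  "x_of \<epsilon> \<mu> \<xi> = (THE x. 0 \<le> x \<and> xi_of \<epsilon> \<mu> x = \<xi>)"

definition f_of :: "(real \<Rightarrow> real) \<Rightarrow> real \<Rightarrow> real \<Rightarrow> real" where
  "f_of \<epsilon> \<mu> \<xi> = sqrt (c_of \<epsilon> \<mu> 0) / sqrt (c_of \<epsilon> \<mu> (x_of \<epsilon> \<mu> \<xi>))"

definition W0_of :: "(real \<Rightarrow> real) \<Rightarrow> real \<Rightarrow> (real \<Rightarrow> complex) \<Rightarrow> (real \<Rightarrow> complex) \<Rightarrow> real \<Rightarrow> bicomplex" where
  "W0_of \<epsilon> \<mu> E0 H0 t =
     bc_of_complex (complex_of_real (sqrt (c_of \<epsilon> \<mu> 0 * \<epsilon> 0)) * E0 t)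
   + bc_mult bc_j (bc_of_complex (\<i> * complex_of_real (sqrt (c_of \<epsilon> \<mu> 0 * \<mu>)) * H0 t))"

definition maxwell_domain :: "(real \<Rightarrow> real) \<Rightarrow> real \<Rightarrow> real \<Rightarrow> real \<Rightarrow> (real \<times> real) set" where
  "maxwell_domain \<epsilon> \<mu> \<alpha> \<beta> =
     {(x, t). 0 \<le> x \<and> \<alpha> \<le> t - xi_of \<epsilon> \<mu> x \<and> t + xi_of \<epsilon> \<mu> x \<le> \<beta>}"

definition maxwell_domain_int :: "(real \<Rightarrow> real) \<Rightarrow> real \<Rightarrow> real \<Rightarrow> real \<Rightarrow> (real \<times> real) set" where
  "maxwell_domain_int \<epsilon> \<mu> \<alpha> \<beta> =
     {(x, t). 0 < x \<and> \<alpha> < t - xi_of \<epsilon> \<mu> x \<and> t + xi_of \<epsilon> \<mu> x < \<beta>}"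

definition maxwell_solution ::
  "(real \<Rightarrow> real) \<Rightarrow> real \<Rightarrow> real \<Rightarrow> real \<Rightarrow> (real \<Rightarrow> complex) \<Rightarrow> (real \<Rightarrow> complex)
   \<Rightarrow> (real \<Rightarrow> real \<Rightarrow> complex) \<Rightarrow> (real \<Rightarrow> real \<Rightarrow> complex) \<Rightarrow> bool" where
  "maxwell_solution \<epsilon> \<mu> \<alpha> \<beta> E0 H0 E H \<longleftrightarrow>
     continuous_on (maxwell_domain \<epsilon> \<mu> \<alpha> \<beta>) (\<lambda>(x, t). E x t) \<and>
     continuous_on (maxwell_domain \<epsilon> \<mu> \<alpha> \<beta>) (\<lambda>(x, t). H x t) \<and>
     (\<forall>t\<in>{\<alpha>..\<beta>}. E 0 t = E0 t \<and> H 0 t = H0 t) \<and>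
     (\<exists>Ex Et Hx Ht.
        continuous_on (maxwell_domain_int \<epsilon> \<mu> \<alpha> \<beta>) (\<lambda>(x, t). Ex x t) \<and>
        continuous_on (maxwell_domain_int \<epsilon> \<mu> \<alpha> \<beta>) (\<lambda>(x, t). Et x t) \<and>
        continuous_on (maxwell_domain_int \<epsilon> \<mu> \<alpha> \<beta>) (\<lambda>(x, t). Hx x t) \<and>
        continuous_on (maxwell_domain_int \<epsilon> \<mu> \<alpha> \<beta>) (\<lambda>(x, t). Ht x t) \<and>
        (\<forall>x t. (x, t) \<in> maxwell_domain_int \<epsilon> \<mu> \<alpha> \<beta> \<longrightarrow>
           ((\<lambda>s. E s t) has_vector_derivative Ex x t) (at x) \<and>
           ((\<lambda>s. E x s) has_vector_derivative Et x t) (at t) \<and>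
           ((\<lambda>s. H s t) has_vector_derivative Hx x t) (at x) \<and>
           ((\<lambda>s. H x s) has_vector_derivative Ht x t) (at t) \<and>
           complex_of_real (\<epsilon> x) * Et x t = \<i> * Hx x t \<and>
           \<i> * Ex x t = - complex_of_real \<mu> * Ht x t))"

end

theory Submission
  imports Defs
begin

text \<open>In the characteristic components \<open>p = W\<^sup>+\<close>, \<open>m = W\<^sup>-\<close> the Vekua equation reads
  \<open>p\<^sub>\<xi> - p\<^sub>t = q m\<close>, \<open>m\<^sub>\<xi> + m\<^sub>t = q p\<close> with \<open>q = f'/f\<close>.  Integrating along characteristics gives
  an a priori bound of \<open>p(\<xi>,t) - p\<^sub>0(t+\<xi>)\<close> and \<open>m(\<xi>,t) - m\<^sub>0(t-\<xi>)\<close> by the \<^emph>\<open>L1\<close> norm of the data on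
  \<open>[t-\<xi>, t+\<xi>]\<close>; uniqueness is a special case.  For a polynomial \<open>G\<close>, the data \<open>p\<^sub>0 = G\<close>, \<open>m\<^sub>0 = 0\<close>
  have the explicit solution \<open>u = 1/2 \<Sum>\<^sub>j \<phi>\<^sub>j(\<xi>) G\<^sup>(\<^sup>j\<^sup>)(t) / j!\<close>, \<open>v = 1/2 \<Sum>\<^sub>j \<psi>\<^sub>j(\<xi>) G\<^sup>(\<^sup>j\<^sup>)(t) / j!\<close>.
  Approximating data by polynomials in the C1 norm, the a priori bound yields existence.  Approximating
  by partial sums of the Legendre series, which converge in L2 and hence in L1, it yields the series
  formula when \<open>m\<^sub>0 = 0\<close>; no transmutation kernel is needed.  The general case follows from the
  symmetry \<open>W(\<xi>,t) \<mapsto> conj W(\<xi>,-t)\<close>, which exchanges \<open>p\<close> and \<open>m\<close>.  The Maxwell system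
  becomes the Vekua equation under the change of variable \<open>x \<mapsto> \<xi>(x)\<close>.\<close>

section \<open>Legendre polynomials\<close>

text \<open>An L1 bound is available because, along a characteristic of \<open>p\<close>, the source
  \<open>q m\<close> samples the data of \<open>m\<close> at an argument moving with speed 2, so
  that the integral over the characteristic turns into an integral of the data. This is what the
  series needs, since the partial sums of the Legendre series are controlled here only in the mean.
  Their values at the endpoint do occur, but the bound concerns \<open>p\<close> minus its
  transported data, so their convergence at the endpoint never enters. This explains the -1 in a_n
  and b_n: as P_n(1) = 1, it subtracts the endpoint value of the n-th Legendre term. The factor
  (2n+1)/2 is the inverse squared norm of P_n on [-1,1]. A further obstacle is regularity: the
  equation holds in the open triangle only and W is merely continuous up to the sides, so estimates
  are made inside and extended by continuity. Constants depend on a bound for q = f'/f, which is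
  available on compact parts [0,\<eta>] of the half-open interval where f lives; hence uniform
  convergence is local in \<xi>.\<close>

abbreviation Leg :: "nat \<Rightarrow> real \<Rightarrow> real" where
  "Leg n \<equiv> poly (legendre n)"

abbreviation dLeg :: "nat \<Rightarrow> real \<Rightarrow> real" where
  "dLeg n \<equiv> poly (pderiv (legendre n))"

section \<open>Recursions, Legendre's equation and orthogonality\<close>

lemma legendre_bonnet:
  "(real n + 2) * Leg (Suc (Suc n)) x = (2 * real n + 3) * x * Leg (Suc n) x - (real n + 1) * Leg n x"
  by (simp add: field_simps)

lemma pderiv_legendre_bonnet:
  "(real n + 2) * dLeg (Suc (Suc n)) x =
     (2 * real n + 3) * (Leg (Suc n) x + x * dLeg (Suc n) x) - (real n + 1) * dLeg n x"
proof -
  have "dLeg (Suc (Suc n)) x = 1 / (real n + 2) *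
     ((2 * real n + 3) * (Leg (Suc n) x + x * dLeg (Suc n) x) - (real n + 1) * dLeg n x)"
    by (simp add: pderiv_smult pderiv_diff pderiv_mult pderiv_pCons) (simp add: field_simps)
  then show ?thesis by (simp add: field_simps)
qed

lemma legendre_one [simp]: "Leg n 1 = 1"
proof (induction n rule: legendre.induct)
  case (3 n)
  then show ?case using legendre_bonnet[of n 1] by simp
qed auto

text \<open>Neither identity is inductive alone: the differentiated Bonnet recursion combined with
  the second one gives the first at the next index, and Bonnet's recursion combined with both gives
  the second.\<close>

lemma legendre_derivative_identities:
  "dLeg (Suc n) x - x * dLeg n x = (real n + 1) * Leg n x \<and>
   x * dLeg (Suc n) x - dLeg n x = (real n + 1) * Leg (Suc n) x"
proof (induction n)
  case 0
  then show ?case by (simp add: pderiv_pCons)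
next
  case (Suc n)
  let ?k = "real n"
  let ?L0 = "Leg n x" and ?L1 = "Leg (Suc n) x" and ?L2 = "Leg (Suc (Suc n)) x"
  let ?D0 = "dLeg n x" and ?D1 = "dLeg (Suc n) x" and ?D2 = "dLeg (Suc (Suc n)) x"
  have a: "?D1 - x * ?D0 = (?k + 1) * ?L0" and b: "x * ?D1 - ?D0 = (?k + 1) * ?L1"
    using Suc by auto
  have "(?k + 2) * (?D2 - x * ?D1) = (?k + 2) * ((?k + 2) * ?L1)"
    using pderiv_legendre_bonnet[of n x] b by algebra
  then have c: "?D2 - x * ?D1 = (?k + 2) * ?L1"
    by (simp del: legendre.simps)
  have "x * ?D2 - ?D1 = (?k + 2) * ?L2"
    using legendre_bonnet[of n x] a b c by algebra
  with c show ?case by (simp add: add.commute del: legendre.simps)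
qed

text \<open>Legendre's equation in self-adjoint form; orthogonality follows because \<open>x\<^sup>2 - 1\<close> vanishes at \<open>\<plusminus>1\<close>.\<close>

lemma legendre_ode:
  "((\<lambda>x. (x\<^sup>2 - 1) * dLeg n x) has_real_derivative real n * (real n + 1) * Leg n x) (at x)"
proof (cases n)
  case 0
  then show ?thesis by simp
next
  case (Suc m)
  \<comment> \<open>Eliminating the derivative of P_m from the two identities leaves an expression
    free of derivatives, so that differentiating it needs no second derivative.\<close>
  have *: "(y\<^sup>2 - 1) * dLeg n y = real n * (y * Leg n y - Leg m y)" for y
    using legendre_derivative_identities[of m y] unfolding Suc of_nat_Suc by algebra
  have "((\<lambda>x. real n * (x * Leg n x - Leg m x)) has_real_derivative
      real n * (Leg n x + x * dLeg n x - dLeg m x)) (at x)"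
    by (auto intro!: derivative_eq_intros poly_DERIV)
  moreover have "Leg n x + x * dLeg n x - dLeg m x = (real n + 1) * Leg n x"
    using legendre_derivative_identities[of m x] unfolding Suc of_nat_Suc by algebra
  ultimately show ?thesis unfolding * by (simp only: mult.assoc)
qed

lemma legendre_orthogonal:
  assumes "n \<noteq> m"
  shows "integral {-1..1} (\<lambda>x. Leg n x * Leg m x) = 0"
proof -
  define F where "F k x = (x\<^sup>2 - 1) * dLeg k x" for k x
  \<comment> \<open>A Lagrange identity: the products of two first derivatives cancel, leaving the
    difference of the eigenvalues n(n+1) and m(m+1) as a factor.\<close>
  have "((\<lambda>x. F n x * Leg m x - F m x * Leg n x) has_real_derivative
      (real n * (real n + 1) - real m * (real m + 1)) * (Leg n x * Leg m x)) (at x)" for x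
    unfolding F_def
    by (rule derivative_eq_intros legendre_ode poly_DERIV refl | simp)+ (simp add: algebra_simps)
  then have "((\<lambda>x. (real n * (real n + 1) - real m * (real m + 1)) * (Leg n x * Leg m x))
      has_integral (F n 1 * Leg m 1 - F m 1 * Leg n 1) - (F n (-1) * Leg m (-1) - F m (-1) * Leg n (-1))) {-1..1}"
    by (intro fundamental_theorem_of_calculus)
       (auto simp: has_real_derivative_iff_has_vector_derivative[symmetric] has_field_derivative_at_within)
  then have "((\<lambda>x. (real n * (real n + 1) - real m * (real m + 1)) * (Leg n x * Leg m x)) has_integral 0) {-1..1}"
    by (simp add: F_def)
  then have "integral {-1..1} (\<lambda>x. (real n * (real n + 1) - real m * (real m + 1)) * (Leg n x * Leg m x)) = 0"
    by (rule integral_unique)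
  moreover have "real n * (real n + 1) - real m * (real m + 1) \<noteq> 0"
  proof -
    have "real n * (real n + 1) - real m * (real m + 1) = (real n - real m) * (real n + real m + 1)"
      by (simp add: algebra_simps)
    then show ?thesis using assms by simp
  qed
  ultimately show ?thesis by simp
qed

text \<open>Pairing Bonnet's recursion with P_n, and the recursion one index lower with P_(n+1),
  leaves the same integral of x P_(n+1) P_n on the right, all other products being orthogonal.
  Comparing the two gives the ratio (2n+1)/(2n+3) of consecutive squared norms.\<close>

lemma legendre_norm: "integral {-1..1} (\<lambda>x. (Leg n x)\<^sup>2) = 2 / (2 * real n + 1)"
proof (induction n)
  case 0
  then show ?case by simp
next
  case (Suc n)
  let ?I = "\<lambda>j k. integral {-1..1} (\<lambda>x. Leg j x * Leg k x)"
  have int: "(\<lambda>x. c * (Leg j x * Leg k x)) integrable_on {-1..1}" for j k c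
    by (intro integrable_continuous_real continuous_intros)
  have "(real n + 2) * ?I (Suc (Suc n)) n + (real n + 1) * ?I n n =
      integral {-1..1} (\<lambda>x. (real n + 2) * (Leg (Suc (Suc n)) x * Leg n x) + (real n + 1) * (Leg n x * Leg n x))"
    by (subst Henstock_Kurzweil_Integration.integral_add[OF int int]) (simp del: legendre.simps)
  also have "\<dots> = integral {-1..1} (\<lambda>x. (2 * real n + 3) * (x * Leg (Suc n) x * Leg n x))"
  proof (rule arg_cong2[where f = integral, OF refl], rule ext)
    fix x
    show "(real n + 2) * (Leg (Suc (Suc n)) x * Leg n x) + (real n + 1) * (Leg n x * Leg n x)
       = (2 * real n + 3) * (x * Leg (Suc n) x * Leg n x)"
      using legendre_bonnet[of n x] by algebra
  qed
  finally have 1: "(real n + 1) * ?I n n = (2 * real n + 3) * integral {-1..1} (\<lambda>x. x * Leg (Suc n) x * Leg n x)"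
    using legendre_orthogonal[of "Suc (Suc n)" n] by (simp del: legendre.simps)
  have 2: "(real n + 1) * ?I (Suc n) (Suc n) = (2 * real n + 1) * integral {-1..1} (\<lambda>x. x * Leg (Suc n) x * Leg n x)"
  proof (cases n)
    case 0
    then show ?thesis by simp
  next
    case (Suc m)
    have "(real m + 2) * ?I (Suc (Suc m)) (Suc (Suc m)) + (real m + 1) * ?I m (Suc (Suc m)) =
      integral {-1..1} (\<lambda>x. (real m + 2) * (Leg (Suc (Suc m)) x * Leg (Suc (Suc m)) x) + (real m + 1) * (Leg m x * Leg (Suc (Suc m)) x))"
      by (subst Henstock_Kurzweil_Integration.integral_add[OF int int]) (simp del: legendre.simps)
    also have "\<dots> = integral {-1..1} (\<lambda>x. (2 * real m + 3) * (x * Leg (Suc (Suc m)) x * Leg (Suc m) x))"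
    proof (rule arg_cong2[where f = integral, OF refl], rule ext)
      fix x
      show "(real m + 2) * (Leg (Suc (Suc m)) x * Leg (Suc (Suc m)) x) + (real m + 1) * (Leg m x * Leg (Suc (Suc m)) x)
         = (2 * real m + 3) * (x * Leg (Suc (Suc m)) x * Leg (Suc m) x)"
        using legendre_bonnet[of m x] by algebra
    qed
    finally have "(real m + 2) * ?I (Suc (Suc m)) (Suc (Suc m)) =
        (2 * real m + 3) * integral {-1..1} (\<lambda>x. x * Leg (Suc (Suc m)) x * Leg (Suc m) x)"
      using legendre_orthogonal[of m "Suc (Suc m)"] by (simp del: legendre.simps)
    moreover have "real n + 1 = real m + 2" "2 * real n + 1 = 2 * real m + 3"
      using Suc by simp_all
    ultimately show ?thesis
      by (simp only: Suc)
  qed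
  have "(2 * real n + 3) * ?I (Suc n) (Suc n) = (2 * real n + 1) * ?I n n"
  proof -
    have "(real n + 1) * ((2 * real n + 3) * ?I (Suc n) (Suc n)) = (real n + 1) * ((2 * real n + 1) * ?I n n)"
      using 1 2 by algebra
    then show ?thesis by (simp del: legendre.simps)
  qed
  then show ?case using Suc by (simp add: power2_eq_square field_simps del: legendre.simps)
qed

text \<open>Together the two facts make the family triangular with respect to monomials:
  \<open>poly_legendre_expansion\<close> divides by the top coefficient.\<close>

lemma legendre_degree: "degree (legendre n) \<le> n \<and> coeff (legendre n) n > 0"
proof (induction n rule: legendre.induct)
  case (3 n)
  have "degree (legendre n) < Suc (Suc n)" using 3 by simp
  then have "coeff (legendre n) (Suc (Suc n)) = 0" by (rule coeff_eq_0)
  moreover have "coeff ([:0, 1:] * legendre (Suc n)) (Suc (Suc n)) = coeff (legendre (Suc n)) (Suc n)"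
    by (simp add: coeff_pCons)
  moreover have "degree ([:0, 1:] * legendre (Suc n)) \<le> Suc (Suc n)"
    using 3 degree_mult_le[of "[:0, 1:]" "legendre (Suc n)"] by simp
  ultimately show ?case using 3
    by (auto simp del: mult_pCons_left intro!: order.trans[OF degree_smult_le] degree_diff_le)
qed auto

lemma poly_legendre_expansion:
  fixes Q :: "real poly"
  assumes "degree Q < N"
  shows "\<exists>d. \<forall>x. poly Q x = (\<Sum>n<N. d n * Leg n x)"
  using assms
proof (induction N arbitrary: Q)
  case 0
  then show ?case by simp
next
  case (Suc N)
  define c where "c = coeff Q N / coeff (legendre N) N"
  define R where "R = Q - smult c (legendre N)"
  have "degree R \<le> N"
    unfolding R_def using Suc.prems legendre_degree[of N]
    by (intro degree_diff_le) (auto intro: order.trans[OF degree_smult_le])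
  moreover have "coeff R N = 0"
    using legendre_degree[of N] by (simp add: R_def c_def)
  \<comment> \<open>The alternative \<open>R = 0\<close> covers N = 0, where no degree lies below
    N.\<close>
  ultimately have "R = 0 \<or> degree R < N"
    by (metis le_neq_implies_less leading_coeff_0_iff)
  then have "\<exists>d. \<forall>x. poly R x = (\<Sum>n<N. d n * Leg n x)"
    using Suc.IH[of R] by (elim disjE) (auto intro: exI[of _ "\<lambda>_. 0"])
  then obtain d where d: "\<And>x. poly R x = (\<Sum>n<N. d n * Leg n x)" by blast
  have "poly Q x = (\<Sum>n<Suc N. (d(N := c)) n * Leg n x)" for x
  proof -
    have "poly Q x = poly R x + c * Leg N x" by (simp add: R_def)
    then show ?thesis by (simp add: d)
  qed
  then show ?case by blast
qed

section \<open>Legendre series: best approximation in L2 and convergence in L1\<close>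

text \<open>The prefactor is the inverse of the squared norm in \<open>legendre_norm\<close>, which
  makes these the coefficients of the L2 projection.\<close>

definition legendre_coeff :: "(real \<Rightarrow> real) \<Rightarrow> nat \<Rightarrow> real" where
  "legendre_coeff g n = (2 * real n + 1) / 2 * integral {-1..1} (\<lambda>x. Leg n x * g x)"

text \<open>Completing the square in each coefficient separately, which orthogonality permits. With
  \<open>d\<close> left arbitrary, the optimality of \<open>legendre_coeff\<close> can be read off
  from the right-hand side.\<close>

lemma legendre_L2_error:
  assumes g: "continuous_on {-1..1} g"
  shows "integral {-1..1} (\<lambda>x. (g x - (\<Sum>n<N. d n * Leg n x))\<^sup>2) =
     integral {-1..1} (\<lambda>x. (g x)\<^sup>2) + (\<Sum>n<N. 2 / (2 * real n + 1) * ((d n - legendre_coeff g n)\<^sup>2 - (legendre_coeff g n)\<^sup>2))"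
proof (induction N)
  case 0
  then show ?case by simp
next
  case (Suc N)
  define r where "r x = g x - (\<Sum>n<N. d n * Leg n x)" for x
  have r: "continuous_on {-1..1} r"
    unfolding r_def by (intro continuous_intros g)
  note [continuous_intros] = g r
  have int: "(\<lambda>x. h x) integrable_on {-1..1}" if "continuous_on {-1..1} h" for h :: "real \<Rightarrow> real"
    using that by (rule integrable_continuous_real)
  have "integral {-1..1} (\<lambda>x. r x * Leg N x) =
      integral {-1..1} (\<lambda>x. g x * Leg N x) - integral {-1..1} (\<lambda>x. \<Sum>n<N. d n * (Leg n x * Leg N x))"
    unfolding r_def
    by (subst Henstock_Kurzweil_Integration.integral_diff[symmetric])
       (auto intro!: int continuous_intros simp: algebra_simps sum_distrib_left)
  also have "integral {-1..1} (\<lambda>x. \<Sum>n<N. d n * (Leg n x * Leg N x)) = 0"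
    by (subst integral_sum) (auto intro!: int continuous_intros sum.neutral simp: legendre_orthogonal)
  finally have rL: "integral {-1..1} (\<lambda>x. r x * Leg N x) = 2 / (2 * real N + 1) * legendre_coeff g N"
    by (simp add: legendre_coeff_def mult.commute field_simps)
  have "integral {-1..1} (\<lambda>x. (g x - (\<Sum>n<Suc N. d n * Leg n x))\<^sup>2) =
     integral {-1..1} (\<lambda>x. (r x)\<^sup>2 - 2 * d N * (r x * Leg N x) + (d N)\<^sup>2 * (Leg N x)\<^sup>2)"
    by (rule arg_cong2[where f = integral, OF refl])
       (auto simp: fun_eq_iff r_def power2_eq_square algebra_simps)
  also have "\<dots> = integral {-1..1} (\<lambda>x. (r x)\<^sup>2) - 2 * d N * integral {-1..1} (\<lambda>x. r x * Leg N x)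
      + (d N)\<^sup>2 * integral {-1..1} (\<lambda>x. (Leg N x)\<^sup>2)"
    by (subst Henstock_Kurzweil_Integration.integral_add
        | subst Henstock_Kurzweil_Integration.integral_diff
        | rule int continuous_intros)+ simp
  also have "\<dots> = integral {-1..1} (\<lambda>x. (r x)\<^sup>2) +
      2 / (2 * real N + 1) * ((d N - legendre_coeff g N)\<^sup>2 - (legendre_coeff g N)\<^sup>2)"
    unfolding rL legendre_norm by (simp add: power2_eq_square algebra_simps)
  finally show ?case using Suc unfolding r_def by simp
qed

text \<open>A uniformly close polynomial lies in the span of P_0, ..., P_(N-1) once N exceeds its
  degree, and the Legendre partial sum is at least as good in L2 as any element of that
  span.\<close>

lemma legendre_L2_convergence:
  assumes g: "continuous_on {-1..1} g" and e: "e > 0"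
  shows "\<exists>N0. \<forall>N\<ge>N0. integral {-1..1} (\<lambda>x. (g x - (\<Sum>n<N. legendre_coeff g n * Leg n x))\<^sup>2) < e"
proof -
  \<comment> \<open>The squared error over an interval of length 2 is then at most e/2, strictly
    below e.\<close>
  define \<delta> where "\<delta> = sqrt (e / 4)"
  have \<delta>: "\<delta> > 0" "\<delta>\<^sup>2 = e / 4" using e by (auto simp: \<delta>_def)
  obtain h where h: "real_polynomial_function h" "\<And>x. x \<in> {-1..1} \<Longrightarrow> \<bar>g x - h x\<bar> < \<delta>"
    using Stone_Weierstrass_real_polynomial_function[OF compact_Icc g \<delta>(1)] by metis
  obtain a m where hm: "h = (\<lambda>x. \<Sum>i\<le>m. a i * x ^ i)"
    using h(1) real_polynomial_function_iff_sum by blast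
  define Q where "Q = (\<Sum>i\<le>m. monom (a i) i)"
  have Q: "poly Q x = h x" for x
    by (simp add: Q_def hm poly_sum poly_monom)
  have "integral {-1..1} (\<lambda>x. (g x - (\<Sum>n<N. legendre_coeff g n * Leg n x))\<^sup>2) < e"
    if N: "N \<ge> Suc (degree Q)" for N
  proof -
    obtain d where d: "\<And>x. poly Q x = (\<Sum>n<N. d n * Leg n x)"
      using poly_legendre_expansion[of Q N] N by auto
    have "integral {-1..1} (\<lambda>x. (g x - (\<Sum>n<N. legendre_coeff g n * Leg n x))\<^sup>2)
        \<le> integral {-1..1} (\<lambda>x. (g x - (\<Sum>n<N. d n * Leg n x))\<^sup>2)"
      unfolding legendre_L2_error[OF g] by (intro add_left_mono sum_mono mult_left_mono diff_right_mono) auto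
    also have "\<dots> \<le> integral {-1..1} (\<lambda>x::real. \<delta>\<^sup>2)"
    proof (rule integral_le)
      show "(g x - (\<Sum>n<N. d n * Leg n x))\<^sup>2 \<le> \<delta>\<^sup>2" if "x \<in> {-1..1}" for x
        using h(2)[OF that] by (simp add: d[symmetric] Q abs_le_square_iff[symmetric])
    qed (auto intro!: integrable_continuous_real continuous_intros g)
    also have "\<dots> < e" using \<delta> e by simp
    finally show ?thesis .
  qed
  then show ?thesis by blast
qed

lemma legendre_L1_convergence:
  assumes g: "continuous_on {-1..1} g"
  shows "(\<lambda>N. integral {-1..1} (\<lambda>x. \<bar>g x - (\<Sum>n<N. legendre_coeff g n * Leg n x)\<bar>)) \<longlonglongrightarrow> 0"
proof (rule LIMSEQ_I)
  fix e :: real assume e: "e > 0"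
  define r where "r N x = g x - (\<Sum>n<N. legendre_coeff g n * Leg n x)" for N x
  have r: "continuous_on {-1..1} (r N)" for N
    unfolding r_def by (intro continuous_intros g)
  obtain N0 where N0: "\<And>N. N \<ge> N0 \<Longrightarrow> integral {-1..1} (\<lambda>x. (r N x)\<^sup>2) < e\<^sup>2 / 4"
    using legendre_L2_convergence[OF g, of "e\<^sup>2 / 4"] e unfolding r_def by auto
  have "norm (integral {-1..1} (\<lambda>x. \<bar>r N x\<bar>) - 0) < e" if "N \<ge> N0" for N
  proof -
    \<comment> \<open>A weighted arithmetic-geometric inequality in place of Cauchy-Schwarz. Over
      length 2 the constant contributes e/2 and the squared error less than e/4, which leaves a
      total below e.\<close>
    have "\<bar>y\<bar> \<le> y\<^sup>2 / e + e / 4" for y :: real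
    proof -
      have "0 \<le> (\<bar>y\<bar> - e / 2)\<^sup>2" by simp
      then have "\<bar>y\<bar> * e \<le> y\<^sup>2 + e\<^sup>2 / 4"
        by (simp add: power2_diff power_divide)
      then show ?thesis using e by (simp add: field_simps power2_eq_square)
    qed
    then have "integral {-1..1} (\<lambda>x. \<bar>r N x\<bar>) \<le> integral {-1..1} (\<lambda>x. (r N x)\<^sup>2 / e + e / 4)"
      by (intro integral_le integrable_continuous_real continuous_intros r) (use e in auto)
    also have "\<dots> = integral {-1..1} (\<lambda>x. (r N x)\<^sup>2) / e + e / 2"
      by (subst Henstock_Kurzweil_Integration.integral_add)
         (use e in \<open>auto intro!: integrable_continuous_real continuous_intros r\<close>)
    also have "\<dots> < (e\<^sup>2 / 4) / e + e / 2"
      using N0[OF that] e by (intro add_strict_right_mono divide_strict_right_mono)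
    also have "\<dots> < e" using e by (simp add: power2_eq_square)
    finally have "integral {-1..1} (\<lambda>x. \<bar>r N x\<bar>) < e" .
    moreover have "integral {-1..1} (\<lambda>x. \<bar>r N x\<bar>) \<ge> 0"
      by (intro integral_nonneg integrable_continuous_real continuous_intros r) auto
    ultimately show ?thesis by simp
  qed
  then show "\<exists>no. \<forall>N\<ge>no. norm (integral {-1..1} (\<lambda>x. \<bar>g x - (\<Sum>n<N. legendre_coeff g n * Leg n x)\<bar>) - 0) < e"
    unfolding r_def by blast
qed

lemma integral_rescale_symmetric:
  fixes h :: "real \<Rightarrow> 'a::real_normed_vector"
  assumes "\<xi> > 0"
  shows "integral {-\<xi>..\<xi>} (\<lambda>\<tau>. h (\<tau> / \<xi>)) = \<xi> *\<^sub>R integral {-1..1} h"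
proof -
  have "(\<lambda>x. x / (1 / \<xi>)) ` {-1..1} = (*) \<xi> ` {-1..1}"
    by (intro image_cong) auto
  also have "\<dots> = {-\<xi>..\<xi>}"
    using image_mult_atLeastAtMost[OF assms, of "-1" 1] by simp
  finally have "(\<lambda>x. x / (1 / \<xi>)) ` {-1..1} = {-\<xi>..\<xi>}" .
  then show ?thesis
    using integral_stretch_real[of "1 / \<xi>" "-1" 1 h] assms by simp
qed

text \<open>The substitution \<tau> = \<xi> x and splitting into real and imaginary parts reduce
  this to [-1,1]. The coefficient \<open>c\<close> is the one occurring in the series formula, up to
  the bracket in a_n or b_n.\<close>

lemma legendre_L1_convergence_complex:
  fixes g :: "real \<Rightarrow> complex"
  assumes \<xi>: "\<xi> > 0" and g: "continuous_on {-\<xi>..\<xi>} g"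
  defines "c \<equiv> \<lambda>n. of_real ((2 * real n + 1) / (2 * \<xi>)) *
             integral {-\<xi>..\<xi>} (\<lambda>\<tau>. of_real (Leg n (\<tau> / \<xi>)) * g \<tau>)"
  shows "(\<lambda>N. integral {-\<xi>..\<xi>} (\<lambda>\<tau>. norm (g \<tau> - (\<Sum>n<N. c n * of_real (Leg n (\<tau> / \<xi>)))))) \<longlonglongrightarrow> 0"
proof -
  define G where "G x = g (\<xi> * x)" for x
  have gG: "g \<tau> = G (\<tau> / \<xi>)" for \<tau> using \<xi> by (simp add: G_def)
  have G: "continuous_on {-1..1} G"
    unfolding G_def
  proof (rule continuous_on_compose2[OF g])
    show "(*) \<xi> ` {-1..1} \<subseteq> {-\<xi>..\<xi>}"
      using image_mult_atLeastAtMost[OF \<xi>, of "-1" 1] by simp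
  qed (intro continuous_intros)
  have int: "h integrable_on {-1..1}" if "continuous_on {-1..1} h" for h :: "real \<Rightarrow> 'b::banach"
    using that by (rule integrable_continuous_real)
  define R I where "R = (\<lambda>x. Re (G x))" and "I = (\<lambda>x. Im (G x))"
  have RI: "continuous_on {-1..1} R" "continuous_on {-1..1} I"
    unfolding R_def I_def by (intro continuous_intros G)+
  have c: "c n = Complex (legendre_coeff R n) (legendre_coeff I n)" for n
  proof -
    have "c n = of_real ((2 * real n + 1) / 2) * integral {-1..1} (\<lambda>x. of_real (Leg n x) * G x)"
      unfolding c_def gG integral_rescale_symmetric[OF \<xi>, of "\<lambda>x. of_real (Leg n x) * G x"]
      using \<xi> by (simp add: scaleR_conv_of_real)
    also have "integral {-1..1} (\<lambda>x. of_real (Leg n x) * G x) =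
        Complex (integral {-1..1} (\<lambda>x. Leg n x * R x)) (integral {-1..1} (\<lambda>x. Leg n x * I x))"
    proof -
      have "(\<lambda>x. of_real (Leg n x) * G x) integrable_on {-1..1}"
        by (intro int continuous_intros G)
      from has_integral_linear[OF integrable_integral[OF this] bounded_linear_Re]
        has_integral_linear[OF integrable_integral[OF this] bounded_linear_Im]
      show ?thesis
        by (intro complex_eqI) (auto simp: o_def R_def I_def integral_unique)
    qed
    finally show ?thesis
      by (simp add: legendre_coeff_def complex_eq_iff)
  qed
  define r where "r a N x = a x - (\<Sum>n<N. legendre_coeff a n * Leg n x)" for a N x
  have r: "continuous_on {-1..1} (r R N)" "continuous_on {-1..1} (r I N)" for N
    unfolding r_def by (intro continuous_intros RI)+
  have eq: "G x - (\<Sum>n<N. c n * of_real (Leg n x)) = Complex (r R N x) (r I N x)" for N x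
    by (simp add: complex_eq_iff r_def c R_def I_def)
  show ?thesis
  proof (rule Lim_null_comparison)
    show "\<forall>\<^sub>F N in sequentially. norm (integral {-\<xi>..\<xi>} (\<lambda>\<tau>. norm (g \<tau> - (\<Sum>n<N. c n * of_real (Leg n (\<tau> / \<xi>))))))
        \<le> \<xi> * (integral {-1..1} (\<lambda>x. \<bar>r R N x\<bar>) + integral {-1..1} (\<lambda>x. \<bar>r I N x\<bar>))"
    proof (rule always_eventually, rule allI)
      fix N
      have 1: "integral {-\<xi>..\<xi>} (\<lambda>\<tau>. norm (g \<tau> - (\<Sum>n<N. c n * of_real (Leg n (\<tau> / \<xi>)))))
         = \<xi> * integral {-1..1} (\<lambda>x. norm (Complex (r R N x) (r I N x)))"
        unfolding gG using integral_rescale_symmetric[OF \<xi>, of "\<lambda>x. norm (G x - (\<Sum>n<N. c n * of_real (Leg n x)))"]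
        by (simp add: eq)
      have ci: "continuous_on {-1..1} (\<lambda>x. norm (Complex (r R N x) (r I N x)))"
        unfolding eq[symmetric] by (intro continuous_intros G)
      have "integral {-1..1} (\<lambda>x. norm (Complex (r R N x) (r I N x)))
          \<le> integral {-1..1} (\<lambda>x. \<bar>r R N x\<bar> + \<bar>r I N x\<bar>)"
        by (rule integral_le[OF int int]) (use cmod_le[of "Complex (r R N x) (r I N x)" for x] in \<open>auto intro!: continuous_intros r ci\<close>)
      also have "\<dots> = integral {-1..1} (\<lambda>x. \<bar>r R N x\<bar>) + integral {-1..1} (\<lambda>x. \<bar>r I N x\<bar>)"
        by (intro Henstock_Kurzweil_Integration.integral_add int continuous_intros r)
      finally have 2: "integral {-1..1} (\<lambda>x. norm (Complex (r R N x) (r I N x))) \<le>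
         integral {-1..1} (\<lambda>x. \<bar>r R N x\<bar>) + integral {-1..1} (\<lambda>x. \<bar>r I N x\<bar>)" .
      have 3: "integral {-1..1} (\<lambda>x. norm (Complex (r R N x) (r I N x))) \<ge> 0"
        by (intro integral_nonneg int ci) auto
      show "norm (integral {-\<xi>..\<xi>} (\<lambda>\<tau>. norm (g \<tau> - (\<Sum>n<N. c n * of_real (Leg n (\<tau> / \<xi>))))))
        \<le> \<xi> * (integral {-1..1} (\<lambda>x. \<bar>r R N x\<bar>) + integral {-1..1} (\<lambda>x. \<bar>r I N x\<bar>))"
        using 1 2 3 \<xi> by (simp add: mult_left_mono)
    qed
    show "(\<lambda>N. \<xi> * (integral {-1..1} (\<lambda>x. \<bar>r R N x\<bar>) + integral {-1..1} (\<lambda>x. \<bar>r I N x\<bar>))) \<longlonglongrightarrow> 0"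
      unfolding r_def
      by (rule tendsto_eq_intros legendre_L1_convergence RI refl | simp)+
  qed
qed

section \<open>Calculus\<close>

text \<open>Existence of both partial derivatives and continuity of one give joint
  differentiability, and the chain rule applies. With k = -1 and k = 1 the lines are the
  characteristics.\<close>

lemma has_vector_derivative_along_line:
  fixes W :: "real \<Rightarrow> real \<Rightarrow> 'a::real_normed_vector"
  assumes D: "open D" "(x, c + k * x) \<in> D"
    and Wx: "\<And>x y. (x, y) \<in> D \<Longrightarrow> ((\<lambda>s. W s y) has_vector_derivative Wx x y) (at x)"
    and Wy: "\<And>x y. (x, y) \<in> D \<Longrightarrow> ((\<lambda>s. W x s) has_vector_derivative Wy x y) (at y)"
    and cont: "continuous_on D (\<lambda>(x, y). Wy x y)"
  shows "((\<lambda>s. W s (c + k * s)) has_vector_derivative (Wx x (c + k * x) + k *\<^sub>R Wy x (c + k * x))) (at x)"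
proof -
  define y where "y = c + k * x"
  obtain X Y' where XY': "open X" "open Y'" "(x, y) \<in> X \<times> Y'" "X \<times> Y' \<subseteq> D"
    using open_prod_elim[OF D] unfolding y_def by metis
  then obtain e where e: "e > 0" "ball y e \<subseteq> Y'"
    using open_contains_ball by blast
  \<comment> \<open>A ball, since the criterion for partial derivatives uses convexity in the second
    variable.\<close>
  define Y where "Y = ball y e"
  have Y: "open Y" "convex Y" "y \<in> Y" "x \<in> X" "X \<times> Y \<subseteq> D"
    using e XY' by (auto simp: Y_def)
  have "((\<lambda>(x, y). W x y) has_derivative (\<lambda>(tx, ty). tx *\<^sub>R Wx x y + blinfun_scaleR_left (Wy x y) ty)) (at (x, y) within X \<times> Y)"
  proof (rule has_derivative_partialsI)
    show "((\<lambda>x. W x y) has_derivative (\<lambda>h. h *\<^sub>R Wx x y)) (at x within X)"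
      using Wx[of x y] D(2) unfolding y_def has_vector_derivative_def
      by (auto intro: has_derivative_at_withinI)
    show "((\<lambda>y. W x y) has_derivative blinfun_apply (blinfun_scaleR_left (Wy x y))) (at y within Y)"
      if "x \<in> X" "y \<in> Y" for x y
    proof -
      have "(x, y) \<in> D" using that Y by auto
      from Wy[OF this] show ?thesis
        unfolding has_vector_derivative_def by (auto intro: has_derivative_at_withinI)
    qed
    have "continuous_on (X \<times> Y) (\<lambda>(x, y). Wy x y)"
      using cont Y(5) by (rule continuous_on_subset)
    then have "continuous_on (X \<times> Y) (\<lambda>(x, y). blinfun_scaleR_left (Wy x y))"
      by (auto simp: case_prod_beta intro!: bounded_linear.continuous_on[OF bounded_linear_blinfun_scaleR_left])
    then show "continuous (at (x, y) within X \<times> Y) (\<lambda>(x, y). blinfun_scaleR_left (Wy x y))"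
      using Y by (auto simp: continuous_on_eq_continuous_within)
  qed (use Y in auto)
  then have "((\<lambda>(x, y). W x y) has_derivative (\<lambda>(tx, ty). tx *\<^sub>R Wx x y + ty *\<^sub>R Wy x y)) (at (x, y))"
    using Y XY'(1) at_within_open[of "(x, y)" "X \<times> Y"] by (auto simp: open_Times)
  moreover have "((\<lambda>s. (s, c + k * s)) has_derivative (\<lambda>h. (h, k * h))) (at x)"
    by (auto intro!: derivative_eq_intros)
  ultimately have "((\<lambda>s. (\<lambda>(x, y). W x y) (s, c + k * s)) has_derivative
      (\<lambda>h. (\<lambda>(tx, ty). tx *\<^sub>R Wx x y + ty *\<^sub>R Wy x y) (h, k * h))) (at x)"
    unfolding y_def by (rule has_derivative_compose[rotated])
  then show ?thesis
    by (simp add: has_vector_derivative_def y_def scaleR_add_right mult.commute)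
qed

text \<open>Substituting y = c + k \<sigma> produces the factor 1/|k|, at most 1. This turns an
  integral along a characteristic into an L1 norm of the data; it is applied with k = 2 and k = -2.
  The primitive \<open>M\<close> handles both orientations of the line at once.\<close>

lemma integral_along_line_le:
  fixes h :: "real \<Rightarrow> real"
  assumes h: "continuous_on {a..b} h" "\<And>y. y \<in> {a..b} \<Longrightarrow> h y \<ge> 0"
    and s: "0 \<le> s" and k: "\<bar>k\<bar> \<ge> 1" and sub: "\<And>\<sigma>. \<sigma> \<in> {0..s} \<Longrightarrow> c + k * \<sigma> \<in> {a..b}"
  shows "integral {0..s} (\<lambda>\<sigma>. h (c + k * \<sigma>)) \<le> integral {a..b} h"
proof -
  define M where "M y = integral {a..y} h" for y
  have M: "(M has_vector_derivative h y) (at y within {a..b})" if "y \<in> {a..b}" for y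
    unfolding M_def using integral_has_vector_derivative[OF h(1) that] .
  have int: "h integrable_on {u..v}" if "{u..v} \<subseteq> {a..b}" for u v
    by (intro integrable_continuous_real continuous_on_subset[OF h(1) that])
  have M0: "0 \<le> M y \<and> M y \<le> integral {a..b} h" if "y \<in> {a..b}" for y
    using that unfolding M_def
    by (intro conjI integral_nonneg integral_subset_le int) (auto intro!: h(2))
  have hc: "continuous_on {0..s} (\<lambda>\<sigma>. h (c + k * \<sigma>))"
    by (rule continuous_on_compose2[OF h(1)]) (intro continuous_intros, use sub in auto)
  have "((\<lambda>\<sigma>. k * h (c + k * \<sigma>)) has_integral M (c + k * s) - M (c + k * 0)) {0..s}"
  proof (rule fundamental_theorem_of_calculus[OF s])
    fix \<sigma> assume \<sigma>: "\<sigma> \<in> {0..s}"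
    have "((\<lambda>\<sigma>. c + k * \<sigma>) has_vector_derivative k) (at \<sigma> within {0..s})"
      by (auto intro!: derivative_eq_intros)
    moreover have "(M has_vector_derivative h (c + k * \<sigma>)) (at (c + k * \<sigma>) within (\<lambda>\<sigma>. c + k * \<sigma>) ` {0..s})"
      by (rule has_vector_derivative_within_subset[OF M]) (use sub \<sigma> in auto)
    ultimately show "((\<lambda>\<sigma>. M (c + k * \<sigma>)) has_vector_derivative k * h (c + k * \<sigma>)) (at \<sigma> within {0..s})"
      using vector_diff_chain_within by (fastforce simp: o_def)
  qed
  then have "k * integral {0..s} (\<lambda>\<sigma>. h (c + k * \<sigma>)) = M (c + k * s) - M c"
    by (metis integral_unique integral_mult_right mult_zero_right add.right_neutral)
  moreover have "\<bar>M (c + k * s) - M c\<bar> \<le> integral {a..b} h"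
    using M0[of c] M0[of "c + k * s"] sub[of 0] sub[of s] s by auto
  moreover have I: "0 \<le> integral {0..s} (\<lambda>\<sigma>. h (c + k * \<sigma>))"
    by (intro integral_nonneg integrable_continuous_real hc) (use h(2)[OF sub] in auto)
  ultimately have "\<bar>k\<bar> * integral {0..s} (\<lambda>\<sigma>. h (c + k * \<sigma>)) \<le> integral {a..b} h"
    by (metis abs_mult abs_of_nonneg)
  moreover have "1 * integral {0..s} (\<lambda>\<sigma>. h (c + k * \<sigma>)) \<le> \<bar>k\<bar> * integral {0..s} (\<lambda>\<sigma>. h (c + k * \<sigma>))"
    by (rule mult_right_mono[OF k I])
  ultimately show ?thesis by linarith
qed

lemma continuous_on_map_snd:
  fixes g :: "real \<Rightarrow> real \<Rightarrow> 'a::topological_space"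
  assumes g: "continuous_on D' (\<lambda>z. g (fst z) (snd z))" and h: "continuous_on UNIV h"
    and D: "\<And>s t. (s, t) \<in> D \<Longrightarrow> (s, h t) \<in> D'"
  shows "continuous_on D (\<lambda>z. g (fst z) (h (snd z)))"
proof -
  have "continuous_on D (\<lambda>z. (fst z, h (snd z)))"
    by (intro continuous_intros continuous_on_compose2[OF h]) auto
  moreover have "(\<lambda>z. (fst z, h (snd z))) ` D \<subseteq> D'" using D by auto
  ultimately show ?thesis
    using continuous_on_compose2[OF g, of D "\<lambda>z. (fst z, h (snd z))"] by simp
qed

lemma continuous_on_map_fst:
  fixes F :: "real \<Rightarrow> real \<Rightarrow> 'a::topological_space"
  assumes F: "continuous_on D' (\<lambda>z. F (fst z) (snd z))" and h: "continuous_on T h" "D \<subseteq> T \<times> UNIV"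
    and D: "\<And>s t. (s, t) \<in> D \<Longrightarrow> (h s, t) \<in> D'"
  shows "continuous_on D (\<lambda>z. F (h (fst z)) (snd z))"
proof -
  have "continuous_on D (\<lambda>z. (h (fst z), snd z))"
    by (intro continuous_intros continuous_on_compose2[OF h(1)]) (use h(2) in auto)
  moreover have "(\<lambda>z. (h (fst z), snd z)) ` D \<subseteq> D'" using D by auto
  ultimately show ?thesis
    using continuous_on_compose2[OF F, of D "\<lambda>z. (h (fst z), snd z)"] by simp
qed

lemma continuous_on_fst_map: "continuous_on T h \<Longrightarrow> D \<subseteq> T \<times> UNIV \<Longrightarrow> continuous_on D (\<lambda>z. h (fst z))"
  by (rule continuous_on_compose2[of T]) (auto intro!: continuous_intros)

lemma C1_on_bounded_linear: 
  assumes "bounded_linear L" "C1_on T g"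
  shows "C1_on T (\<lambda>x. L (g x))"
proof -
  obtain g' where g': "continuous_on T g'" "\<And>x. x \<in> T \<Longrightarrow> (g has_vector_derivative g' x) (at x within T)"
    using assms(2) unfolding C1_on_def by blast
  show ?thesis
    unfolding C1_on_def
    by (intro exI[of _ "\<lambda>x. L (g' x)"] conjI ballI bounded_linear.continuous_on[OF assms(1)]
        bounded_linear.has_vector_derivative[OF assms(1)] g')
qed

lemma C1_on_affine:
  assumes g: "C1_on T g" and sub: "\<And>x. x \<in> T' \<Longrightarrow> c + k * x \<in> T"
  shows "C1_on T' (\<lambda>x. g (c + k * x))"
proof -
  obtain g' where g': "continuous_on T g'" "\<And>x. x \<in> T \<Longrightarrow> (g has_vector_derivative g' x) (at x within T)"
    using g unfolding C1_on_def by blast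
  have img: "(\<lambda>x. c + k * x) ` T' \<subseteq> T" using sub by auto
  show ?thesis
    unfolding C1_on_def
  proof (intro exI[of _ "\<lambda>x. k *\<^sub>R g' (c + k * x)"] conjI ballI)
    show "continuous_on T' (\<lambda>x. k *\<^sub>R g' (c + k * x))"
      by (intro continuous_intros continuous_on_compose2[OF g'(1) _ img])
    fix x assume x: "x \<in> T'"
    have "((\<lambda>x. c + k * x) has_vector_derivative k) (at x within T')"
      by (auto intro!: derivative_eq_intros)
    moreover have "(g has_vector_derivative g' (c + k * x)) (at (c + k * x) within (\<lambda>x. c + k * x) ` T')"
      by (rule has_vector_derivative_within_subset[OF g'(2)[OF sub[OF x]] img])
    ultimately show "((\<lambda>x. g (c + k * x)) has_vector_derivative k *\<^sub>R g' (c + k * x)) (at x within T')"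
      using vector_diff_chain_within by (fastforce simp: o_def)
  qed
qed

section \<open>Polynomial approximation in the C1 norm and limits of derivatives\<close>

lemma complex_polynomial_approx:
  fixes h :: "real \<Rightarrow> complex"
  assumes h: "continuous_on {a..b} h" and e: "e > 0"
  shows "\<exists>H :: complex poly. \<forall>x\<in>{a..b}. norm (h x - poly H (of_real x)) < e"
proof -
  have real: "\<exists>H :: complex poly. \<forall>x\<in>{a..b}. norm (of_real (r x) - poly H (of_real x)) < e / 2"
    if r: "continuous_on {a..b} r" for r :: "real \<Rightarrow> real"
  proof -
    have "e / 2 > 0" using e by simp
    then obtain p where p: "real_polynomial_function p" "\<And>x. x \<in> {a..b} \<Longrightarrow> \<bar>r x - p x\<bar> < e / 2"
      using Stone_Weierstrass_real_polynomial_function[OF compact_Icc r] by metis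
    obtain c m where pm: "p = (\<lambda>x. \<Sum>i\<le>m. c i * x ^ i)"
      using p(1) real_polynomial_function_iff_sum by blast
    define H where "H = (\<Sum>i\<le>m. monom (complex_of_real (c i)) i)"
    have "poly H (of_real x) = of_real (p x)" for x
      by (simp add: H_def pm poly_sum poly_monom)
    then have "norm (of_real (r x) - poly H (of_real x)) < e / 2" if "x \<in> {a..b}" for x
      using p(2)[OF that] by (simp flip: of_real_diff)
    then show ?thesis by blast
  qed
  have "continuous_on {a..b} (\<lambda>x. Re (h x))" "continuous_on {a..b} (\<lambda>x. Im (h x))"
    by (intro continuous_intros h)+
  from this[THEN real] obtain H1 H2 :: "complex poly" where
    H: "\<And>x. x \<in> {a..b} \<Longrightarrow> norm (of_real (Re (h x)) - poly H1 (of_real x)) < e / 2"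
       "\<And>x. x \<in> {a..b} \<Longrightarrow> norm (of_real (Im (h x)) - poly H2 (of_real x)) < e / 2" by metis
  have "norm (h x - poly (H1 + smult \<i> H2) (of_real x)) < e" if "x \<in> {a..b}" for x
  proof -
    have "h x - poly (H1 + smult \<i> H2) (of_real x) =
        (of_real (Re (h x)) - poly H1 (of_real x)) + \<i> * (of_real (Im (h x)) - poly H2 (of_real x))"
      using complex_eq[of "h x"] by (simp add: algebra_simps)
    then have "norm (h x - poly (H1 + smult \<i> H2) (of_real x)) \<le>
        norm (of_real (Re (h x)) - poly H1 (of_real x)) + norm (\<i> * (of_real (Im (h x)) - poly H2 (of_real x)))"
      by (metis norm_triangle_ineq)
    also have "\<dots> < e / 2 + e / 2"
      using H[OF that] by (intro add_strict_mono) (simp_all add: norm_mult)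
    finally show ?thesis by simp
  qed
  then show ?thesis by blast
qed

lemma poly_antiderivative:
  fixes H :: "complex poly"
  shows "\<exists>G. pderiv G = H"
proof
  define G where "G = Abs_poly (\<lambda>n. if n = 0 then 0 else coeff H (n - 1) / of_nat n)"
  have "coeff G = (\<lambda>n. if n = 0 then 0 else coeff H (n - 1) / of_nat n)"
    unfolding G_def by (rule coeff_Abs_poly[of "Suc (degree H)"]) (auto simp: coeff_eq_0)
  then show "pderiv G = H"
    by (intro poly_eqI) (simp add: coeff_pderiv del: of_nat_Suc)
qed

text \<open>The derivative is approximated and the approximation integrated, so that closeness of
  the functions follows from closeness of the derivatives and agreement at the left end.\<close>

lemma C1_polynomial_approx:
  fixes g :: "real \<Rightarrow> complex"
  assumes g': "continuous_on {a..b} g'" "\<And>x. x \<in> {a..b} \<Longrightarrow> (g has_vector_derivative g' x) (at x within {a..b})"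
    and e: "e > 0"
  shows "\<exists>G :: complex poly. \<forall>x\<in>{a..b}. norm (g x - poly G (of_real x)) \<le> e \<and> norm (g' x - poly (pderiv G) (of_real x)) \<le> e"
proof (cases "a \<le> b")
  case ab: True
  \<comment> \<open>Small enough both for the derivative (d \<le> e) and after integration (d (b -
    a) \<le> e); the 1 also covers a = b.\<close>
  define d where "d = e / (b - a + 1)"
  have d: "d > 0" "d \<le> e" "d * (b - a) \<le> e"
    using e ab by (auto simp: d_def field_simps)
  obtain H :: "complex poly" where H: "\<And>x. x \<in> {a..b} \<Longrightarrow> norm (g' x - poly H (of_real x)) < d"
    using complex_polynomial_approx[OF g'(1) d(1)] by blast
  obtain G0 where G0: "pderiv G0 = H" using poly_antiderivative by blast
  \<comment> \<open>The constant of integration is fixed by requiring G(a) = g(a).\<close>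
  define G where "G = G0 + [:g a - poly G0 (of_real a):]"
  have G: "pderiv G = H" "poly G (of_real a) = g a"
    by (simp_all add: G_def pderiv_add pderiv_pCons G0)
  have "norm (g x - poly G (of_real x)) \<le> e" if x: "x \<in> {a..b}" for x
  proof -
    have "((\<lambda>x. g' x - poly H (of_real x)) has_integral (g x - poly G (of_real x)) - (g a - poly G (of_real a))) {a..x}"
    proof (rule fundamental_theorem_of_calculus)
      fix y assume y: "y \<in> {a..x}"
      have "(g has_vector_derivative g' y) (at y within {a..x})"
        by (rule has_vector_derivative_within_subset[OF g'(2)]) (use x y in auto)
      moreover have "((\<lambda>x. poly G (complex_of_real x)) has_vector_derivative poly H (of_real y)) (at y within {a..x})"
        using has_vector_derivative_real_field[OF poly_DERIV[of G "complex_of_real y"]] G by simp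
      ultimately show "((\<lambda>x. g x - poly G (of_real x)) has_vector_derivative g' y - poly H (of_real y)) (at y within {a..x})"
        by (rule has_vector_derivative_diff)
    qed (use x in auto)
    then have "g x - poly G (of_real x) = integral {a..x} (\<lambda>x. g' x - poly H (of_real x))"
      by (simp add: G integral_unique)
    also have "norm \<dots> \<le> d * (x - a)"
    proof (rule integral_bound)
      show "continuous_on {a..x} (\<lambda>x. g' x - poly H (of_real x))"
        by (intro continuous_intros continuous_on_subset[OF g'(1)]) (use x in auto)
    qed (use x H in \<open>auto intro: less_imp_le\<close>)
    also have "\<dots> \<le> d * (b - a)" using x d by (intro mult_left_mono) auto
    finally show ?thesis using d by simp
  qed
  moreover have "norm (g' x - poly (pderiv G) (of_real x)) \<le> e" if "x \<in> {a..b}" for x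
    using H[OF that] d G by simp
  ultimately show ?thesis by blast
qed simp

lemma has_vector_derivative_uniform_limit:
  fixes F :: "nat \<Rightarrow> real \<Rightarrow> 'a::banach"
  assumes I: "open I" "convex I" "x \<in> I"
    and F': "\<And>n x. x \<in> I \<Longrightarrow> (F n has_vector_derivative F' n x) (at x)"
    and ul: "uniform_limit I F' G' sequentially"
    and lim: "\<And>x. x \<in> I \<Longrightarrow> (\<lambda>n. F n x) \<longlonglongrightarrow> G x"
  shows "(G has_vector_derivative G' x) (at x)"
proof -
  have "\<exists>g. \<forall>x\<in>I. (\<lambda>n. F n x) \<longlonglongrightarrow> g x \<and> (g has_derivative (\<lambda>h. h *\<^sub>R G' x)) (at x within I)"
  proof (rule has_derivative_sequence[where f = F and f' = "\<lambda>n x h. h *\<^sub>R F' n x" and ?x0.0 = x and l = "G x"])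
    show "(F n has_derivative (\<lambda>h. h *\<^sub>R F' n x)) (at x within I)" if "x \<in> I" for n x
      using F'[OF that] unfolding has_vector_derivative_def by (rule has_derivative_at_withinI)
    show "\<forall>\<^sub>F n in sequentially. \<forall>x\<in>I. \<forall>h. norm (h *\<^sub>R F' n x - h *\<^sub>R G' x) \<le> e * norm h" if "e > 0" for e
      using uniform_limitD[OF ul that]
    proof (eventually_elim, intro ballI allI)
      fix n x and h :: real assume "\<forall>x\<in>I. dist (F' n x) (G' x) < e" "x \<in> I"
      then have "norm (F' n x - G' x) \<le> e" by (auto simp: dist_norm less_imp_le)
      then have "\<bar>h\<bar> * norm (F' n x - G' x) \<le> \<bar>h\<bar> * e" by (rule mult_left_mono) simp
      then show "norm (h *\<^sub>R F' n x - h *\<^sub>R G' x) \<le> e * norm h"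
        by (simp flip: scaleR_diff_right add: mult.commute)
    qed
  qed (use I lim in auto)
  then obtain g where g: "\<And>x. x \<in> I \<Longrightarrow> (\<lambda>n. F n x) \<longlonglongrightarrow> g x"
    "(g has_derivative (\<lambda>h. h *\<^sub>R G' x)) (at x within I)"
    using I(3) by blast
  \<comment> \<open>The theorem on sequences of derivatives yields some limit function; uniqueness
    of limits identifies it with \<open>G\<close>.\<close>
  have "g y = G y" if "y \<in> I" for y using LIMSEQ_unique[OF g(1) lim] that by blast
  with g(2) have "(G has_derivative (\<lambda>h. h *\<^sub>R G' x)) (at x within I)"
    using I(3) by (metis has_derivative_transform)
  then show ?thesis
    using at_within_open[OF I(3,1)] by (simp add: has_vector_derivative_def)
qed


section \<open>The a priori bound\<close>

text \<open>One Gronwall step in weighted form. \<open>P\<close> is one component along its own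
  characteristic and \<open>R\<close> the other component there, bounded by its data plus a
  remainder of size A times the weight. The exponent 2Q + 1 makes Q/(2Q + 1) \<le> 1/2, so the
  remainder is halved, and it stays positive for Q = 0.\<close>

lemma characteristic_bound:
  fixes P R :: "real \<Rightarrow> complex"
  assumes P: "continuous_on {0..s} P"
    and P': "\<And>\<sigma>. \<sigma> \<in> {0<..<s} \<Longrightarrow> (P has_vector_derivative q \<sigma> *\<^sub>R R \<sigma>) (at \<sigma>)"
    and q: "\<And>\<sigma>. \<sigma> \<in> {0..s} \<Longrightarrow> \<bar>q \<sigma>\<bar> \<le> Q" and Q: "0 \<le> Q"
    and R: "\<And>\<sigma>. \<sigma> \<in> {0..s} \<Longrightarrow> norm (R \<sigma>) \<le> h (c + k * \<sigma>) + A * exp ((2 * Q + 1) * \<sigma>)"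
    and h: "continuous_on {a..b} h" "\<And>y. y \<in> {a..b} \<Longrightarrow> h y \<ge> 0"
    and s: "0 \<le> s" and k: "\<bar>k\<bar> \<ge> 1" and sub: "\<And>\<sigma>. \<sigma> \<in> {0..s} \<Longrightarrow> c + k * \<sigma> \<in> {a..b}"
    and A: "0 \<le> A"
  shows "norm (P s - P 0) \<le> Q * integral {a..b} h + A / 2 * exp ((2 * Q + 1) * s)"
proof -
  have PI: "((\<lambda>\<sigma>. q \<sigma> *\<^sub>R R \<sigma>) has_integral (P s - P 0)) {0..s}"
    by (rule fundamental_theorem_of_calculus_interior[OF s P P'])
  have hc: "continuous_on {0..s} (\<lambda>\<sigma>. h (c + k * \<sigma>))"
    by (rule continuous_on_compose2[OF h(1)]) (intro continuous_intros, use sub in auto)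
  let ?g = "\<lambda>\<sigma>. Q * h (c + k * \<sigma>) + Q * A * exp ((2 * Q + 1) * \<sigma>)"
  have "norm (P s - P 0) = norm (integral {0..s} (\<lambda>\<sigma>. q \<sigma> *\<^sub>R R \<sigma>))"
    using PI by (simp add: integral_unique)
  also have "\<dots> \<le> integral {0..s} ?g"
  proof (rule integral_norm_bound_integral)
    show "(\<lambda>\<sigma>. q \<sigma> *\<^sub>R R \<sigma>) integrable_on {0..s}" using PI by blast
    show "?g integrable_on {0..s}"
      by (intro integrable_continuous_real continuous_intros hc)
    show "norm (q \<sigma> *\<^sub>R R \<sigma>) \<le> ?g \<sigma>" if "\<sigma> \<in> {0..s}" for \<sigma>
      using mult_mono[OF q[OF that] R[OF that]] Q by (simp add: algebra_simps)
  qed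
  also have "\<dots> = Q * integral {0..s} (\<lambda>\<sigma>. h (c + k * \<sigma>)) + Q * A * integral {0..s} (\<lambda>\<sigma>. exp ((2 * Q + 1) * \<sigma>))"
    by (subst Henstock_Kurzweil_Integration.integral_add)
       (auto intro!: integrable_continuous_real continuous_intros hc)
  also have "integral {0..s} (\<lambda>\<sigma>. exp ((2 * Q + 1) * \<sigma>)) = (exp ((2 * Q + 1) * s) - 1) / (2 * Q + 1)"
  proof -
    have "((\<lambda>\<sigma>. exp ((2 * Q + 1) * \<sigma>)) has_integral
        exp ((2 * Q + 1) * s) / (2 * Q + 1) - exp ((2 * Q + 1) * 0) / (2 * Q + 1)) {0..s}"
      by (rule fundamental_theorem_of_calculus[OF s])
         (use Q in \<open>auto intro!: derivative_eq_intros simp: has_real_derivative_iff_has_vector_derivative[symmetric]\<close>)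
    then show ?thesis by (simp add: integral_unique diff_divide_distrib)
  qed
  also have "Q * integral {0..s} (\<lambda>\<sigma>. h (c + k * \<sigma>)) \<le> Q * integral {a..b} h"
    using integral_along_line_le[OF h s k sub] Q by (rule mult_left_mono)
  also have "Q * A * ((exp ((2 * Q + 1) * s) - 1) / (2 * Q + 1)) \<le> A / 2 * exp ((2 * Q + 1) * s)"
  proof -
    have "Q / (2 * Q + 1) \<le> 1 / 2" using Q by (simp add: field_simps)
    then have "Q / (2 * Q + 1) * (exp ((2 * Q + 1) * s) - 1) \<le> 1 / 2 * exp ((2 * Q + 1) * s)"
      using Q s by (intro mult_mono) auto
    from mult_left_mono[OF this A] show ?thesis by (simp add: field_simps)
  qed
  finally show ?thesis by simp
qed

definition vekua_eq_on :: "(real \<times> real) set \<Rightarrow> (real \<Rightarrow> real) \<Rightarrow> (real \<Rightarrow> real \<Rightarrow> bicomplex) \<Rightarrow> bool" where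
  "vekua_eq_on D f W \<longleftrightarrow> (\<exists>W\<xi> Wt.
        continuous_on D (\<lambda>(\<xi>, t). W\<xi> \<xi> t) \<and> continuous_on D (\<lambda>(\<xi>, t). Wt \<xi> t) \<and>
        (\<forall>\<xi> t. (\<xi>, t) \<in> D \<longrightarrow>
           ((\<lambda>s. W s t) has_vector_derivative W\<xi> \<xi> t) (at \<xi>) \<and>
           ((\<lambda>s. W \<xi> s) has_vector_derivative Wt \<xi> t) (at t) \<and>
           (1/2) *\<^sub>R (W\<xi> \<xi> t - bc_mult bc_j (Wt \<xi> t))
             - (deriv f \<xi> / (2 * f \<xi>)) *\<^sub>R bc_conj (W \<xi> t) = 0))"

text \<open>The solution concept is truncated to \<open>\<xi> \<in> S\<close> because in the Maxwell setting the range of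
  \<open>\<xi>(x)\<close>, \<open>x \<ge> 0\<close>, may be bounded, and \<open>f\<close> is meaningless beyond it.\<close>

definition tri :: "real set \<Rightarrow> real \<Rightarrow> real \<Rightarrow> (real \<times> real) set" where
  "tri S \<alpha> \<beta> = char_triangle \<alpha> \<beta> \<inter> S \<times> UNIV"

definition tri_int :: "real set \<Rightarrow> real \<Rightarrow> real \<Rightarrow> (real \<times> real) set" where
  "tri_int S \<alpha> \<beta> = char_triangle_int \<alpha> \<beta> \<inter> S \<times> UNIV"

definition vekua_solution_on ::
  "real set \<Rightarrow> (real \<Rightarrow> real) \<Rightarrow> real \<Rightarrow> real \<Rightarrow> (real \<Rightarrow> bicomplex) \<Rightarrow> (real \<Rightarrow> real \<Rightarrow> bicomplex) \<Rightarrow> bool" where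
  "vekua_solution_on S f \<alpha> \<beta> W0 W \<longleftrightarrow>
     continuous_on (tri S \<alpha> \<beta>) (\<lambda>(\<xi>, t). W \<xi> t) \<and>
     (\<forall>t\<in>{\<alpha>..\<beta>}. W 0 t = W0 t) \<and> vekua_eq_on (tri_int S \<alpha> \<beta>) f W"

lemma mem_tri: "(\<xi>, t) \<in> tri S \<alpha> \<beta> \<longleftrightarrow> 0 \<le> \<xi> \<and> \<xi> \<in> S \<and> \<alpha> \<le> t - \<xi> \<and> t + \<xi> \<le> \<beta>"
  by (auto simp: tri_def char_triangle_def)

lemma mem_tri_int: "(\<xi>, t) \<in> tri_int S \<alpha> \<beta> \<longleftrightarrow> 0 < \<xi> \<and> \<xi> \<in> S \<and> \<alpha> < t - \<xi> \<and> t + \<xi> < \<beta>"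
  by (auto simp: tri_int_def char_triangle_int_def)

lemma vekua_solution_iff: "vekua_solution f \<alpha> \<beta> W0 W \<longleftrightarrow> vekua_solution_on {0..} f \<alpha> \<beta> W0 W"
proof -
  have "tri {0..} \<alpha> \<beta> = char_triangle \<alpha> \<beta>" "tri_int {0..} \<alpha> \<beta> = char_triangle_int \<alpha> \<beta>"
    by (auto simp: tri_def tri_int_def char_triangle_def char_triangle_int_def)
  then show ?thesis
    unfolding vekua_solution_def vekua_solution_on_def vekua_eq_on_def by simp
qed

text \<open>Multiplication by j swaps the components and conjugation negates the second, which turns
  the bicomplex equation into two complex ones.\<close>

lemma vekua_equation_components:
  "(1/2) *\<^sub>R (A - bc_mult bc_j B) - (d / (2 * c)) *\<^sub>R bc_conj w = 0 \<longleftrightarrow>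
     fst A = snd B + (d / c) *\<^sub>R fst w \<and> snd A = fst B - (d / c) *\<^sub>R snd w"
proof -
  have "(1/2) *\<^sub>R (A - bc_mult bc_j B) - (d / (2 * c)) *\<^sub>R bc_conj w =
     (1/2) *\<^sub>R (A - bc_mult bc_j B - (d / c) *\<^sub>R bc_conj w)"
    by (simp add: scaleR_right_diff_distrib)
  then have "(1/2) *\<^sub>R (A - bc_mult bc_j B) - (d / (2 * c)) *\<^sub>R bc_conj w = 0 \<longleftrightarrow>
     A - bc_mult bc_j B - (d / c) *\<^sub>R bc_conj w = 0"
    by (simp only: scaleR_eq_0_iff) simp
  then show ?thesis
    by (auto simp: prod_eq_iff bc_mult_def bc_j_def bc_conj_def algebra_simps)
qed

section \<open>Half-open intervals and the standing assumptions on f\<close>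

text \<open>Models [0,b) and [0,\<infinity>) together. The lack of a last point means that every
  point lies inside some compact [0,\<eta>] with room to its right, so continuity can be checked on
  such pieces and derivatives at positive points are two-sided.\<close>

locale half_open_interval =
  fixes S :: "real set"
  assumes zero_S: "0 \<in> S" and S_nonneg: "\<xi> \<in> S \<Longrightarrow> 0 \<le> \<xi>"
    and S_down: "\<xi> \<in> S \<Longrightarrow> 0 \<le> \<eta> \<Longrightarrow> \<eta> \<le> \<xi> \<Longrightarrow> \<eta> \<in> S"
    and S_open: "\<xi> \<in> S \<Longrightarrow> \<exists>\<eta>\<in>S. \<xi> < \<eta>"
begin

lemma Icc_subset_S: "\<xi> \<in> S \<Longrightarrow> {0..\<xi>} \<subseteq> S"
  using S_down by auto

lemma open_S_pos: "open (S \<inter> {0<..})"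
proof (subst open_subopen, rule ballI)
  fix x assume x: "x \<in> S \<inter> {0<..}"
  then obtain \<eta> where \<eta>: "\<eta> \<in> S" "x < \<eta>" using S_open by blast
  have "open {0<..<\<eta>}" "x \<in> {0<..<\<eta>}" "{0<..<\<eta>} \<subseteq> S \<inter> {0<..}"
    using x \<eta> S_down[OF \<eta>(1)] by auto
  then show "\<exists>T. open T \<and> x \<in> T \<and> T \<subseteq> S \<inter> {0<..}" by blast
qed

lemma at_within_S:
  assumes "\<eta> \<in> S" "x \<in> S" "x < \<eta>"
  shows "at x within S = at x within {0..\<eta>}"
  by (rule at_within_nhd[of x "{..<\<eta>}"]) (use assms S_nonneg S_down[OF assms(1)] in auto)

lemma indefinite_integral:
  fixes h :: "real \<Rightarrow> real"
  assumes h: "continuous_on S h"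
  shows "continuous_on S (\<lambda>\<xi>. integral {0..\<xi>} h)"
    and "\<xi> \<in> S \<Longrightarrow> 0 < \<xi> \<Longrightarrow> ((\<lambda>\<xi>. integral {0..\<xi>} h) has_real_derivative h \<xi>) (at \<xi>)"
proof -
  have *: "((\<lambda>\<xi>. integral {0..\<xi>} h) has_real_derivative h \<xi>) (at \<xi> within S)" if "\<xi> \<in> S" for \<xi>
  proof -
    obtain \<eta> where \<eta>: "\<eta> \<in> S" "\<xi> < \<eta>" using S_open \<open>\<xi> \<in> S\<close> by blast
    show ?thesis
      unfolding at_within_S[OF \<eta>(1) that \<eta>(2)]
    proof (rule integral_has_real_derivative)
      show "continuous_on {0..\<eta>} h" by (rule continuous_on_subset[OF h Icc_subset_S[OF \<eta>(1)]])
      show "\<xi> \<in> {0..\<eta>}" using \<eta> S_nonneg[OF that] by simp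
    qed
  qed
  then show "continuous_on S (\<lambda>\<xi>. integral {0..\<xi>} h)"
    by (rule DERIV_continuous_on)
  show "((\<lambda>\<xi>. integral {0..\<xi>} h) has_real_derivative h \<xi>) (at \<xi>)" if "\<xi> \<in> S" "0 < \<xi>"
  proof -
    have "((\<lambda>\<xi>. integral {0..\<xi>} h) has_real_derivative h \<xi>) (at \<xi> within (S \<inter> {0<..}))"
      using *[OF that(1)] by (rule has_field_derivative_subset) auto
    then show ?thesis using that at_within_open[OF _ open_S_pos, of \<xi>] by simp
  qed
qed

lemma continuous_on_S_local:
  assumes "\<And>\<eta>. \<eta> \<in> S \<Longrightarrow> continuous_on {0..\<eta>} h"
  shows "continuous_on S h"
  unfolding continuous_on_eq_continuous_within
proof
  fix x assume x: "x \<in> S"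
  then obtain \<eta> where \<eta>: "\<eta> \<in> S" "x < \<eta>" using S_open by blast
  then show "continuous (at x within S) h"
    using assms[OF \<eta>(1)] S_nonneg[OF x] unfolding at_within_S[OF \<eta>(1) x \<eta>(2)] continuous_on_eq_continuous_within by simp
qed

end

text \<open>The derivative is two-sided, hence stated for positive \<xi> only; continuity of
  \<open>f'\<close> up to 0 keeps f'/f bounded near the initial line.\<close>

locale vekua_coefficient = half_open_interval S for S :: "real set" +
  fixes f f' :: "real \<Rightarrow> real"
  assumes cont_f: "continuous_on S f" and cont_f': "continuous_on S f'"
    and deriv_f: "\<xi> \<in> S \<Longrightarrow> 0 < \<xi> \<Longrightarrow> (f has_real_derivative f' \<xi>) (at \<xi>)"
    and f_nonzero: "\<xi> \<in> S \<Longrightarrow> f \<xi> \<noteq> 0"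
    and f_zero: "f 0 = 1"
begin

text \<open>The logarithmic derivative of f, twice the coefficient f'/(2f), because the factor 1/2
  of the operator has been cleared.\<close>

definition q :: "real \<Rightarrow> real" where "q \<xi> = f' \<xi> / f \<xi>"

lemma cont_q: "continuous_on S q"
  unfolding q_def by (intro continuous_intros cont_f cont_f') (auto simp: f_nonzero)

lemma open_tri_int: "open (tri_int S \<alpha> \<beta>)"
proof -
  have "tri_int S \<alpha> \<beta> = (S \<inter> {0<..}) \<times> UNIV \<inter> {z. \<alpha> < snd z - fst z} \<inter> {z. snd z + fst z < \<beta>}"
    by (auto simp: mem_tri_int)
  then show ?thesis
    by (auto intro!: open_Int open_Times open_S_pos open_Collect_less continuous_intros)
qed

lemma q_bounded: assumes "\<xi> \<in> S" shows "\<exists>Q\<ge>0. \<forall>s\<in>{0..\<xi>}. \<bar>q s\<bar> \<le> Q"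
proof -
  have "compact (q ` {0..\<xi>})"
    by (intro compact_continuous_image continuous_on_subset[OF cont_q] Icc_subset_S assms) auto
  then obtain Q where "\<forall>x\<in>q ` {0..\<xi>}. norm x \<le> Q"
    using compact_imp_bounded bounded_iff by blast
  then show ?thesis by (intro exI[of _ "max Q 0"]) (auto simp: le_max_iff_disj)
qed

lemma tri_int_pos: "tri_int S \<alpha> \<beta> \<subseteq> (S \<inter> {0<..}) \<times> UNIV"
  by (auto simp: mem_tri_int)

lemma deriv_f_eq: "\<xi> \<in> S \<Longrightarrow> 0 < \<xi> \<Longrightarrow> deriv f \<xi> = f' \<xi>"
  using deriv_f by (auto intro!: DERIV_imp_deriv)

lemma vekua_eq_on_iff:
  assumes "D \<subseteq> (S \<inter> {0<..}) \<times> UNIV"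
  shows "vekua_eq_on D f W \<longleftrightarrow> (\<exists>W\<xi> Wt.
        continuous_on D (\<lambda>(\<xi>, t). W\<xi> \<xi> t) \<and> continuous_on D (\<lambda>(\<xi>, t). Wt \<xi> t) \<and>
        (\<forall>\<xi> t. (\<xi>, t) \<in> D \<longrightarrow>
           ((\<lambda>s. W s t) has_vector_derivative W\<xi> \<xi> t) (at \<xi>) \<and>
           ((\<lambda>s. W \<xi> s) has_vector_derivative Wt \<xi> t) (at t) \<and>
           fst (W\<xi> \<xi> t) = snd (Wt \<xi> t) + q \<xi> *\<^sub>R fst (W \<xi> t) \<and>
           snd (W\<xi> \<xi> t) = fst (Wt \<xi> t) - q \<xi> *\<^sub>R snd (W \<xi> t)))"
  unfolding vekua_eq_on_def vekua_equation_components q_def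
  by (intro iff_exI iff_allI conj_cong imp_cong refl) (drule subsetD[OF assms], simp add: deriv_f_eq)+

lemmas vekua_eq_tri_int_iff = vekua_eq_on_iff[OF tri_int_pos]

text \<open>The data are the trace on \<xi> = 0 of a function continuous on the closed triangle.
  This supplies the integrability needed for the L1 norm in the a priori bound.\<close>

lemma data_continuous:
  assumes "vekua_solution_on S f \<alpha> \<beta> W0 W"
  shows "continuous_on {\<alpha>..\<beta>} W0"
proof -
  have "continuous_on {\<alpha>..\<beta>} (\<lambda>t. (\<lambda>(\<xi>, t). W \<xi> t) (0, t))"
    by (rule continuous_on_compose2[of "tri S \<alpha> \<beta>"])
       (use assms zero_S in \<open>auto simp: vekua_solution_on_def mem_tri intro!: continuous_intros\<close>)
  then show ?thesis
    by (rule continuous_on_eq) (use assms in \<open>auto simp: vekua_solution_on_def\<close>)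
qed

text \<open>The remainders \<open>\<rho>\<close> and \<open>\<mu>\<close> measure the deviation from
  free transport of the data. Their weighted supremum A satisfies A \<le> Q N + A/2, hence A \<le> 2
  Q N. Only the data on [t-\<xi>, t+\<xi>] enter because everything takes place in the triangle
  below (\<xi>,t), the domain of dependence of that point.\<close>

lemma a_priori_bound:
  assumes sol: "vekua_solution_on S f \<alpha> \<beta> W0 W"
    and pt: "(\<xi>, t) \<in> tri S \<alpha> \<beta>"
    and Q: "0 \<le> Q" "\<And>s. s \<in> {0..\<xi>} \<Longrightarrow> \<bar>q s\<bar> \<le> Q"
  defines "N \<equiv> integral {t-\<xi>..t+\<xi>} (\<lambda>s. norm (bc_plus (W0 s)) + norm (bc_minus (W0 s)))"
  shows "norm (bc_plus (W \<xi> t) - bc_plus (W0 (t + \<xi>))) \<le> 2 * Q * N * exp ((2 * Q + 1) * \<xi>)"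
    and "norm (bc_minus (W \<xi> t) - bc_minus (W0 (t - \<xi>))) \<le> 2 * Q * N * exp ((2 * Q + 1) * \<xi>)"
proof -
  define a b \<kappa> where "a = t - \<xi>" and "b = t + \<xi>" and "\<kappa> = 2 * Q + 1"
  define p m where "p s \<tau> = bc_plus (W s \<tau>)" and "m s \<tau> = bc_minus (W s \<tau>)" for s \<tau>
  define p0 m0 where "p0 \<tau> = bc_plus (W0 \<tau>)" and "m0 \<tau> = bc_minus (W0 \<tau>)" for \<tau>
  define h where "h \<tau> = norm (p0 \<tau>) + norm (m0 \<tau>)" for \<tau>
  define \<rho> \<mu> where "\<rho> s \<tau> = p s \<tau> - p0 (\<tau> + s)" and "\<mu> s \<tau> = m s \<tau> - m0 (\<tau> - s)" for s \<tau>
  have \<xi>S: "\<xi> \<in> S" "0 \<le> \<xi>" "\<alpha> \<le> a" "b \<le> \<beta>" using pt by (auto simp: mem_tri a_def b_def)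
  \<comment> \<open>The domain of dependence: base [a,b] on \<xi> = 0 and apex (\<xi>,t).\<close>
  define T where "T = char_triangle a b"
  define TI where "TI = char_triangle_int a b"
  have T: "T = {z. 0 \<le> fst z \<and> a \<le> snd z - fst z \<and> snd z + fst z \<le> b}"
    by (auto simp: T_def char_triangle_def)
  have Ts: "(s, \<tau>) \<in> T \<Longrightarrow> 0 \<le> s \<and> s \<le> \<xi> \<and> s \<in> S" for s \<tau>
    using S_down[OF \<xi>S(1), of s] by (auto simp: T a_def b_def)
  have T_sub: "T \<subseteq> tri S \<alpha> \<beta>"
    using Ts \<xi>S by (fastforce simp: mem_tri T)
  have TI_sub: "TI \<subseteq> tri_int S \<alpha> \<beta>"
  proof safe
    fix s \<tau> assume *: "(s, \<tau>) \<in> TI"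
    then have "(s, \<tau>) \<in> T" by (auto simp: TI_def T char_triangle_int_def)
    with Ts[OF this] * \<xi>S show "(s, \<tau>) \<in> tri_int S \<alpha> \<beta>"
      by (auto simp: TI_def char_triangle_int_def mem_tri_int)
  qed
  have Wcont: "continuous_on T (\<lambda>z. W (fst z) (snd z))"
    using sol continuous_on_subset[OF _ T_sub, of "\<lambda>(\<xi>, t). W \<xi> t"]
    by (simp add: vekua_solution_on_def case_prod_beta)
  have pcont: "continuous_on T (\<lambda>z. p (fst z) (snd z))" and mcont: "continuous_on T (\<lambda>z. m (fst z) (snd z))"
    unfolding p_def m_def bc_plus_def bc_minus_def bc_R_def bc_I_def
    by (intro continuous_intros Wcont)+
  have W0cont: "continuous_on {a..b} W0"
    using data_continuous[OF sol] by (rule continuous_on_subset) (use \<xi>S in auto)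
  have p0cont: "continuous_on {a..b} p0" and m0cont: "continuous_on {a..b} m0"
    unfolding p0_def m0_def bc_plus_def bc_minus_def bc_R_def bc_I_def
    by (intro continuous_intros W0cont)+
  have hcont: "continuous_on {a..b} h" unfolding h_def by (intro continuous_intros p0cont m0cont)
  have \<rho>cont: "continuous_on T (\<lambda>z. \<rho> (fst z) (snd z))"
    unfolding \<rho>_def
    by (intro continuous_intros pcont continuous_on_compose2[OF p0cont]) (auto simp: T)
  have \<mu>cont: "continuous_on T (\<lambda>z. \<mu> (fst z) (snd z))"
    unfolding \<mu>_def
    by (intro continuous_intros mcont continuous_on_compose2[OF m0cont]) (auto simp: T)
  have lineC: "continuous_on {0..s} (\<lambda>\<sigma>. g \<sigma> (c + k * \<sigma>))"
    if "continuous_on T (\<lambda>z. g (fst z) (snd z))" "\<And>\<sigma>. \<sigma> \<in> {0..s} \<Longrightarrow> (\<sigma>, c + k * \<sigma>) \<in> T"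
    for s c k and g :: "real \<Rightarrow> real \<Rightarrow> complex"
  proof -
    have "continuous_on {0..s} (\<lambda>\<sigma>. (\<sigma>, c + k * \<sigma>))" by (intro continuous_intros)
    moreover have "(\<lambda>\<sigma>. (\<sigma>, c + k * \<sigma>)) ` {0..s} \<subseteq> T" using that(2) by blast
    ultimately show ?thesis
      using continuous_on_compose2[OF that(1), of "{0..s}" "\<lambda>\<sigma>. (\<sigma>, c + k * \<sigma>)"] by simp
  qed
  have comp: "compact T"
  proof -
    have "closed T" unfolding T
      by (intro closed_Collect_conj closed_Collect_le continuous_intros)
    moreover have "T \<subseteq> {0..\<xi>} \<times> {a..b}" using Ts by (fastforce simp: T)
    ultimately show ?thesis
      by (metis compact_Int_closed compact_Times compact_Icc inf.absorb_iff2)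
  qed
  have init: "\<rho> 0 \<tau> = 0" "\<mu> 0 \<tau> = 0" if "\<tau> \<in> {a..b}" for \<tau>
    using sol that \<xi>S by (auto simp: \<rho>_def \<mu>_def p_def m_def p0_def m0_def vekua_solution_on_def)
  obtain W\<xi> Wt where W\<xi>t:
    "continuous_on (tri_int S \<alpha> \<beta>) (\<lambda>(\<xi>, t). Wt \<xi> t)"
    "\<And>\<xi> t. (\<xi>, t) \<in> tri_int S \<alpha> \<beta> \<Longrightarrow> ((\<lambda>s. W s t) has_vector_derivative W\<xi> \<xi> t) (at \<xi>)"
    "\<And>\<xi> t. (\<xi>, t) \<in> tri_int S \<alpha> \<beta> \<Longrightarrow> ((\<lambda>s. W \<xi> s) has_vector_derivative Wt \<xi> t) (at t)"
    "\<And>\<xi> t. (\<xi>, t) \<in> tri_int S \<alpha> \<beta> \<Longrightarrow> fst (W\<xi> \<xi> t) = snd (Wt \<xi> t) + q \<xi> *\<^sub>R fst (W \<xi> t)"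
    "\<And>\<xi> t. (\<xi>, t) \<in> tri_int S \<alpha> \<beta> \<Longrightarrow> snd (W\<xi> \<xi> t) = fst (Wt \<xi> t) - q \<xi> *\<^sub>R snd (W \<xi> t)"
  proof -
    have "vekua_eq_on (tri_int S \<alpha> \<beta>) f W" using sol by (simp add: vekua_solution_on_def)
    then obtain W\<xi> Wt where "continuous_on (tri_int S \<alpha> \<beta>) (\<lambda>(\<xi>, t). Wt \<xi> t)"
      "\<forall>\<xi> t. (\<xi>, t) \<in> tri_int S \<alpha> \<beta> \<longrightarrow>
           ((\<lambda>s. W s t) has_vector_derivative W\<xi> \<xi> t) (at \<xi>) \<and>
           ((\<lambda>s. W \<xi> s) has_vector_derivative Wt \<xi> t) (at t) \<and>
           fst (W\<xi> \<xi> t) = snd (Wt \<xi> t) + q \<xi> *\<^sub>R fst (W \<xi> t) \<and>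
           snd (W\<xi> \<xi> t) = fst (Wt \<xi> t) - q \<xi> *\<^sub>R snd (W \<xi> t)"
      by (auto simp only: vekua_eq_tri_int_iff)
    then show ?thesis by (intro that[of Wt W\<xi>]) simp_all
  qed
  have along: "((\<lambda>s. W s (c + k * s)) has_vector_derivative (W\<xi> s (c + k * s) + k *\<^sub>R Wt s (c + k * s))) (at s)"
    if "(s, c + k * s) \<in> TI" for s c k
    by (rule has_vector_derivative_along_line[OF open_tri_int _ W\<xi>t(2,3,1)]) (use that TI_sub in auto)
  have p': "((\<lambda>s. p s (c + (-1) * s)) has_vector_derivative q s *\<^sub>R m s (c + (-1) * s)) (at s)"
    if "(s, c + (-1) * s) \<in> TI" for s c
  proof -
    have bl: "bounded_linear (\<lambda>w. bc_plus w)"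
      unfolding bc_plus_def bc_R_def bc_I_def by (intro bounded_linear_add bounded_linear_fst bounded_linear_snd)
    have *: "(s, c - s) \<in> tri_int S \<alpha> \<beta>" using that TI_sub by auto
    from bounded_linear.has_vector_derivative[OF bl along[OF that]] show ?thesis
      using W\<xi>t(4,5)[OF *]
      by (simp add: p_def m_def bc_plus_def bc_minus_def bc_R_def bc_I_def algebra_simps)
  qed
  have m': "((\<lambda>s. m s (c + 1 * s)) has_vector_derivative q s *\<^sub>R p s (c + 1 * s)) (at s)"
    if "(s, c + 1 * s) \<in> TI" for s c
  proof -
    have bl: "bounded_linear (\<lambda>w. bc_minus w)"
      unfolding bc_minus_def bc_R_def bc_I_def by (intro bounded_linear_sub bounded_linear_fst bounded_linear_snd)
    have *: "(s, c + s) \<in> tri_int S \<alpha> \<beta>" using that TI_sub by auto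
    from bounded_linear.has_vector_derivative[OF bl along[OF that]] show ?thesis
      using W\<xi>t(4,5)[OF *]
      by (simp add: p_def m_def bc_plus_def bc_minus_def bc_R_def bc_I_def algebra_simps)
  qed
  have step: "norm (\<rho> s \<tau>) \<le> Q * N + A / 2 * exp (\<kappa> * s) \<and> norm (\<mu> s \<tau>) \<le> Q * N + A / 2 * exp (\<kappa> * s)"
    if st: "(s, \<tau>) \<in> TI" and A: "A \<ge> 0"
      and bd: "\<And>s \<tau>. (s, \<tau>) \<in> TI \<Longrightarrow> norm (\<rho> s \<tau>) \<le> A * exp (\<kappa> * s) \<and> norm (\<mu> s \<tau>) \<le> A * exp (\<kappa> * s)"
    for s \<tau> A
  proof -
    have s: "0 < s" "a < \<tau> - s" "\<tau> + s < b" "s \<le> \<xi>"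
      using st by (auto simp: TI_def char_triangle_int_def a_def b_def)
    \<comment> \<open>A characteristic starts on the base, outside the open triangle; there the
      remainders vanish and the bound holds trivially.\<close>
    have bd': "norm (\<rho> s \<tau>) \<le> A * exp (\<kappa> * s) \<and> norm (\<mu> s \<tau>) \<le> A * exp (\<kappa> * s)"
      if "(s, \<tau>) \<in> TI \<or> s = 0 \<and> \<tau> \<in> {a..b}" for s \<tau>
      using that bd[of s \<tau>] init[of \<tau>] A by auto
    have Nh: "N = integral {a..b} h"
      unfolding N_def a_def b_def h_def p0_def m0_def by simp
    have h0: "0 \<le> h y" for y by (simp add: h_def)
    have line1: "(\<sigma>, \<tau> + s + (-1) * \<sigma>) \<in> TI \<or> \<sigma> = 0 \<and> \<tau> + s + (-1) * \<sigma> \<in> {a..b}" if "\<sigma> \<in> {0..s}" for \<sigma>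
      using s that by (auto simp: TI_def char_triangle_int_def)
    have line2: "(\<sigma>, \<tau> - s + 1 * \<sigma>) \<in> TI \<or> \<sigma> = 0 \<and> \<tau> - s + 1 * \<sigma> \<in> {a..b}" if "\<sigma> \<in> {0..s}" for \<sigma>
      using s that by (auto simp: TI_def char_triangle_int_def)
    have "norm (p s (\<tau> + s + (-1) * s) - p 0 (\<tau> + s + (-1) * 0)) \<le> Q * integral {a..b} h + A / 2 * exp ((2 * Q + 1) * s)"
    \<comment> \<open>On the line with ordinate \<tau> + s - \<sigma> the data of \<open>m\<close>
      are evaluated at that ordinate minus \<sigma>, which gives slope -2.\<close>
    proof (rule characteristic_bound[where R = "\<lambda>\<sigma>. m \<sigma> (\<tau> + s + (-1) * \<sigma>)" and q = q and c = "\<tau> + s" and k = "-2"])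
      show "continuous_on {0..s} (\<lambda>\<sigma>. p \<sigma> (\<tau> + s + (-1) * \<sigma>))"
        by (rule lineC[OF pcont]) (use s in \<open>auto simp: T\<close>)
      show "((\<lambda>\<sigma>. p \<sigma> (\<tau> + s + (-1) * \<sigma>)) has_vector_derivative q \<sigma> *\<^sub>R m \<sigma> (\<tau> + s + (-1) * \<sigma>)) (at \<sigma>)"
        if "\<sigma> \<in> {0<..<s}" for \<sigma>
        using p' line1[of \<sigma>] that by auto
      show "norm (m \<sigma> (\<tau> + s + (-1) * \<sigma>)) \<le> h (\<tau> + s + (-2) * \<sigma>) + A * exp ((2 * Q + 1) * \<sigma>)" if "\<sigma> \<in> {0..s}" for \<sigma>
      proof -
        have "m \<sigma> (\<tau> + s + (-1) * \<sigma>) = m0 (\<tau> + s + (-2) * \<sigma>) + \<mu> \<sigma> (\<tau> + s + (-1) * \<sigma>)"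
          by (simp add: \<mu>_def algebra_simps)
        then have "norm (m \<sigma> (\<tau> + s + (-1) * \<sigma>)) \<le> norm (m0 (\<tau> + s + (-2) * \<sigma>)) + norm (\<mu> \<sigma> (\<tau> + s + (-1) * \<sigma>))"
          by (metis norm_triangle_ineq)
        also have "norm (m0 (\<tau> + s + (-2) * \<sigma>)) \<le> h (\<tau> + s + (-2) * \<sigma>)" by (simp add: h_def)
        also have "norm (\<mu> \<sigma> (\<tau> + s + (-1) * \<sigma>)) \<le> A * exp ((2 * Q + 1) * \<sigma>)"
          using bd'[OF line1[OF that]] by (simp add: \<kappa>_def)
        finally show ?thesis by simp
      qed
    qed (use s Q hcont h0 A in auto)
    moreover have "p s (\<tau> + s + (-1) * s) - p 0 (\<tau> + s + (-1) * 0) = \<rho> s \<tau>"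
      using init[of "\<tau> + s"] s by (simp add: \<rho>_def)
    moreover have "norm (m s (\<tau> - s + 1 * s) - m 0 (\<tau> - s + 1 * 0)) \<le> Q * integral {a..b} h + A / 2 * exp ((2 * Q + 1) * s)"
    \<comment> \<open>Mirror image: the ordinate \<tau> - s + \<sigma> plus another \<sigma> gives
      slope 2.\<close>
    proof (rule characteristic_bound[where R = "\<lambda>\<sigma>. p \<sigma> (\<tau> - s + 1 * \<sigma>)" and q = q and c = "\<tau> - s" and k = "2"])
      show "continuous_on {0..s} (\<lambda>\<sigma>. m \<sigma> (\<tau> - s + 1 * \<sigma>))"
        by (rule lineC[OF mcont]) (use s in \<open>auto simp: T\<close>)
      show "((\<lambda>\<sigma>. m \<sigma> (\<tau> - s + 1 * \<sigma>)) has_vector_derivative q \<sigma> *\<^sub>R p \<sigma> (\<tau> - s + 1 * \<sigma>)) (at \<sigma>)"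
        if "\<sigma> \<in> {0<..<s}" for \<sigma>
        using m' line2[of \<sigma>] that by auto
      show "norm (p \<sigma> (\<tau> - s + 1 * \<sigma>)) \<le> h (\<tau> - s + 2 * \<sigma>) + A * exp ((2 * Q + 1) * \<sigma>)" if "\<sigma> \<in> {0..s}" for \<sigma>
      proof -
        have "p \<sigma> (\<tau> - s + 1 * \<sigma>) = p0 (\<tau> - s + 2 * \<sigma>) + \<rho> \<sigma> (\<tau> - s + 1 * \<sigma>)"
          by (simp add: \<rho>_def algebra_simps)
        then have "norm (p \<sigma> (\<tau> - s + 1 * \<sigma>)) \<le> norm (p0 (\<tau> - s + 2 * \<sigma>)) + norm (\<rho> \<sigma> (\<tau> - s + 1 * \<sigma>))"
          by (metis norm_triangle_ineq)
        also have "norm (p0 (\<tau> - s + 2 * \<sigma>)) \<le> h (\<tau> - s + 2 * \<sigma>)" by (simp add: h_def)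
        also have "norm (\<rho> \<sigma> (\<tau> - s + 1 * \<sigma>)) \<le> A * exp ((2 * Q + 1) * \<sigma>)"
          using bd'[OF line2[OF that]] by (simp add: \<kappa>_def)
        finally show ?thesis by simp
      qed
    qed (use s Q hcont h0 A in auto)
    moreover have "m s (\<tau> - s + 1 * s) - m 0 (\<tau> - s + 1 * 0) = \<mu> s \<tau>"
      using init[of "\<tau> - s"] s by (simp add: \<mu>_def)
    ultimately show ?thesis unfolding \<kappa>_def Nh by simp
  qed
  have N0: "N \<ge> 0"
    unfolding N_def
    by (intro integral_nonneg integrable_continuous_real hcont[unfolded a_def b_def h_def p0_def m0_def]) auto
  have main: "norm (\<rho> s \<tau>) \<le> 2 * Q * N * exp (\<kappa> * s) \<and> norm (\<mu> s \<tau>) \<le> 2 * Q * N * exp (\<kappa> * s)"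
    if st: "(s, \<tau>) \<in> TI" for s \<tau>
  proof -
    have TIT: "TI \<subseteq> T" by (auto simp: TI_def T char_triangle_int_def)
    \<comment> \<open>With the weight \<open>exp (- \<kappa> s)\<close>, integration along characteristics halves the supremum.\<close>
    define v where "v z = exp (- \<kappa> * fst z) * max (norm (\<rho> (fst z) (snd z))) (norm (\<mu> (fst z) (snd z)))" for z
    have "continuous_on T v" unfolding v_def by (intro continuous_intros \<rho>cont \<mu>cont)
    then have "bounded (v ` T)" using comp compact_continuous_image compact_imp_bounded by blast
    then have bdd: "bdd_above (v ` TI)"
      by (meson TIT bdd_above_mono bounded_imp_bdd_above image_mono)
    \<comment> \<open>Finite because \<open>v\<close> is continuous on the compact closed triangle;
      finiteness is what allows A/2 to be absorbed.\<close>
    define A where "A = Sup (v ` TI)"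
    have vA: "v z \<le> A" if "z \<in> TI" for z unfolding A_def by (intro cSup_upper bdd) (use that in auto)
    have "0 \<le> v (s, \<tau>)" by (simp add: v_def le_max_iff_disj)
    then have A0: "0 \<le> A" using vA[OF st] by simp
    have vexp: "norm (\<rho> s \<tau>) \<le> B * exp (\<kappa> * s) \<and> norm (\<mu> s \<tau>) \<le> B * exp (\<kappa> * s) \<longleftrightarrow> v (s, \<tau>) \<le> B" for s \<tau> B
      by (auto simp: v_def exp_minus field_simps)
    have bd: "norm (\<rho> s \<tau>) \<le> A * exp (\<kappa> * s) \<and> norm (\<mu> s \<tau>) \<le> A * exp (\<kappa> * s)" if "(s, \<tau>) \<in> TI" for s \<tau>
      using vexp vA[OF that] by blast
    have "v z \<le> Q * N + A / 2" if z: "z \<in> TI" for z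
    proof (cases z)
      case (Pair s \<tau>)
      have "\<kappa> * s \<ge> 0" using z Q(1) by (auto simp: Pair \<kappa>_def TI_def char_triangle_int_def)
      \<comment> \<open>The data term carries no weight; since the weight is at least 1, it may be
        given one.\<close>
      then have "Q * N * 1 \<le> Q * N * exp (\<kappa> * s)"
        using Q(1) N0 by (intro mult_left_mono) auto
      then have "norm (\<rho> s \<tau>) \<le> (Q * N + A / 2) * exp (\<kappa> * s) \<and> norm (\<mu> s \<tau>) \<le> (Q * N + A / 2) * exp (\<kappa> * s)"
        using step[OF z[unfolded Pair] A0 bd] by (auto simp: algebra_simps)
      then show ?thesis unfolding Pair vexp .
    qed
    then have "A \<le> Q * N + A / 2"
      unfolding A_def by (intro cSup_least) (use st in auto)
    then have "A \<le> 2 * Q * N" by simp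
    with vA[OF st] show ?thesis unfolding vexp by simp
  qed
  have lim: "norm (\<rho> \<xi> t) \<le> 2 * Q * N * exp (\<kappa> * \<xi>) \<and> norm (\<mu> \<xi> t) \<le> 2 * Q * N * exp (\<kappa> * \<xi>)"
  proof (cases "\<xi> = 0")
    case True
    then show ?thesis using init[of t] Q(1) N0 by (simp add: a_def b_def)
  next
    case False
    \<comment> \<open>The apex is reached along the vertical segment below it, which lies in the
      open triangle, where the bound is already known.\<close>
    have c: "closure {0<..<\<xi>} = {0..\<xi>}" using False \<xi>S by (intro closure_greaterThanLessThan) auto
    have bd: "norm (\<rho> s t) \<le> 2 * Q * N * exp (\<kappa> * \<xi>) \<and> norm (\<mu> s t) \<le> 2 * Q * N * exp (\<kappa> * \<xi>)" if "s \<in> {0<..<\<xi>}" for s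
    proof -
      have "2 * Q * N * exp (\<kappa> * s) \<le> 2 * Q * N * exp (\<kappa> * \<xi>)"
        using Q(1) N0 that by (intro mult_left_mono) (auto simp: \<kappa>_def)
      then show ?thesis using main[of s t] that by (auto simp: TI_def char_triangle_int_def a_def b_def)
    qed
    have "continuous_on {0..\<xi>} (\<lambda>s. \<rho> s t)" "continuous_on {0..\<xi>} (\<lambda>s. \<mu> s t)"
      using lineC[OF \<rho>cont, of \<xi> t 0] lineC[OF \<mu>cont, of \<xi> t 0] by (auto simp: T a_def b_def)
    then show ?thesis
      using continuous_on_closure_norm_le[of "{0<..<\<xi>}" "\<lambda>s. \<rho> s t" _ \<xi>]
        continuous_on_closure_norm_le[of "{0<..<\<xi>}" "\<lambda>s. \<mu> s t" _ \<xi>] bd \<xi>S unfolding c by auto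
  qed
  show "norm (bc_plus (W \<xi> t) - bc_plus (W0 (t + \<xi>))) \<le> 2 * Q * N * exp ((2 * Q + 1) * \<xi>)"
    "norm (bc_minus (W \<xi> t) - bc_minus (W0 (t - \<xi>))) \<le> 2 * Q * N * exp ((2 * Q + 1) * \<xi>)"
    using lim by (simp_all add: \<rho>_def \<mu>_def p_def m_def p0_def m0_def \<kappa>_def)
qed

end

section \<open>Symmetries and polynomial solutions\<close>

context vekua_coefficient
begin

text \<open>The value of \<open>W\<^sub>\<xi>\<close> prescribed by the equation when \<open>W = w\<close> and \<open>W\<^sub>t = wt\<close>.\<close>

definition \<xi>_slope :: "real \<Rightarrow> bicomplex \<Rightarrow> bicomplex \<Rightarrow> bicomplex" where
  "\<xi>_slope \<xi> w wt = (snd wt + q \<xi> *\<^sub>R fst w, fst wt - q \<xi> *\<^sub>R snd w)"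

lemma tri_int_subset: "tri_int S \<alpha> \<beta> \<subseteq> tri S \<alpha> \<beta>"
  by (auto simp: mem_tri mem_tri_int)

lemma continuous_on_q_fst: "D \<subseteq> S \<times> UNIV \<Longrightarrow> continuous_on D (\<lambda>z. q (fst z))"
  by (rule continuous_on_compose2[OF cont_q]) (auto intro!: continuous_intros)

text \<open>The equation expresses the \<xi>-derivative through W and its t-derivative, so only the
  latter has to be exhibited; continuity of the former follows from that of W, its t-derivative and
  \<open>q\<close>.\<close>

lemma solution_iff:
  "vekua_solution_on S f \<alpha> \<beta> W0 W \<longleftrightarrow>
     continuous_on (tri S \<alpha> \<beta>) (\<lambda>z. W (fst z) (snd z)) \<and> (\<forall>t\<in>{\<alpha>..\<beta>}. W 0 t = W0 t) \<and>
     (\<exists>Wt. continuous_on (tri_int S \<alpha> \<beta>) (\<lambda>z. Wt (fst z) (snd z)) \<and>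
       (\<forall>\<xi> t. (\<xi>, t) \<in> tri_int S \<alpha> \<beta> \<longrightarrow>
           ((\<lambda>s. W s t) has_vector_derivative \<xi>_slope \<xi> (W \<xi> t) (Wt \<xi> t)) (at \<xi>) \<and>
           ((\<lambda>s. W \<xi> s) has_vector_derivative Wt \<xi> t) (at t)))" (is "?l \<longleftrightarrow> ?r")
proof
  assume l: ?l
  then have "vekua_eq_on (tri_int S \<alpha> \<beta>) f W" by (simp add: vekua_solution_on_def)
  then obtain W\<xi> Wt where c: "continuous_on (tri_int S \<alpha> \<beta>) (\<lambda>(\<xi>, t). Wt \<xi> t)"
    and d: "\<forall>\<xi> t. (\<xi>, t) \<in> tri_int S \<alpha> \<beta> \<longrightarrow>
           ((\<lambda>s. W s t) has_vector_derivative W\<xi> \<xi> t) (at \<xi>) \<and>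
           ((\<lambda>s. W \<xi> s) has_vector_derivative Wt \<xi> t) (at t) \<and>
           fst (W\<xi> \<xi> t) = snd (Wt \<xi> t) + q \<xi> *\<^sub>R fst (W \<xi> t) \<and>
           snd (W\<xi> \<xi> t) = fst (Wt \<xi> t) - q \<xi> *\<^sub>R snd (W \<xi> t)"
    by (auto simp only: vekua_eq_tri_int_iff)
  have "W\<xi> \<xi> t = \<xi>_slope \<xi> (W \<xi> t) (Wt \<xi> t)" if "(\<xi>, t) \<in> tri_int S \<alpha> \<beta>" for \<xi> t
    using d that by (simp add: \<xi>_slope_def prod_eq_iff)
  with l c d show ?r
    by (auto simp: vekua_solution_on_def case_prod_beta)
next
  assume r: ?r
  then obtain Wt where c: "continuous_on (tri_int S \<alpha> \<beta>) (\<lambda>z. Wt (fst z) (snd z))"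
    and d: "\<forall>\<xi> t. (\<xi>, t) \<in> tri_int S \<alpha> \<beta> \<longrightarrow>
           ((\<lambda>s. W s t) has_vector_derivative \<xi>_slope \<xi> (W \<xi> t) (Wt \<xi> t)) (at \<xi>) \<and>
           ((\<lambda>s. W \<xi> s) has_vector_derivative Wt \<xi> t) (at t)"
    by auto
  have W: "continuous_on (tri_int S \<alpha> \<beta>) (\<lambda>z. W (fst z) (snd z))"
    by (rule continuous_on_subset[OF _ tri_int_subset]) (use r in simp)
  have "vekua_eq_on (tri_int S \<alpha> \<beta>) f W"
    unfolding vekua_eq_tri_int_iff
  proof (intro exI conjI)
    show "continuous_on (tri_int S \<alpha> \<beta>) (\<lambda>(\<xi>, t). \<xi>_slope \<xi> (W \<xi> t) (Wt \<xi> t))"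
      unfolding \<xi>_slope_def case_prod_beta
      by (intro continuous_intros W c continuous_on_q_fst) (auto simp: tri_int_def)
    show "continuous_on (tri_int S \<alpha> \<beta>) (\<lambda>(\<xi>, t). Wt \<xi> t)" using c by (simp add: case_prod_beta)
  qed (use d in \<open>auto simp: \<xi>_slope_def\<close>)
  with r show ?l by (simp add: vekua_solution_on_def case_prod_beta)
qed

lemma solutionE:
  assumes "vekua_solution_on S f \<alpha> \<beta> W0 W"
  obtains Wt where "continuous_on (tri S \<alpha> \<beta>) (\<lambda>z. W (fst z) (snd z))" "\<forall>t\<in>{\<alpha>..\<beta>}. W 0 t = W0 t"
    "continuous_on (tri_int S \<alpha> \<beta>) (\<lambda>z. Wt (fst z) (snd z))"
    "\<And>\<xi> t. (\<xi>, t) \<in> tri_int S \<alpha> \<beta> \<Longrightarrow>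
           ((\<lambda>s. W s t) has_vector_derivative \<xi>_slope \<xi> (W \<xi> t) (Wt \<xi> t)) (at \<xi>)"
    "\<And>\<xi> t. (\<xi>, t) \<in> tri_int S \<alpha> \<beta> \<Longrightarrow> ((\<lambda>s. W \<xi> s) has_vector_derivative Wt \<xi> t) (at t)"
  using assms unfolding solution_iff by (elim conjE exE) simp

section \<open>Linearity, symmetries and uniqueness\<close>

lemma solution_add_scaleR:
  assumes "vekua_solution_on S f \<alpha> \<beta> W0 W" "vekua_solution_on S f \<alpha> \<beta> V0 V"
  shows "vekua_solution_on S f \<alpha> \<beta> (\<lambda>t. W0 t + c *\<^sub>R V0 t) (\<lambda>\<xi> t. W \<xi> t + c *\<^sub>R V \<xi> t)"
proof -
  obtain Wt where W: "continuous_on (tri S \<alpha> \<beta>) (\<lambda>z. W (fst z) (snd z))" "\<forall>t\<in>{\<alpha>..\<beta>}. W 0 t = W0 t"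
    "continuous_on (tri_int S \<alpha> \<beta>) (\<lambda>z. Wt (fst z) (snd z))"
    "\<And>\<xi> t. (\<xi>, t) \<in> tri_int S \<alpha> \<beta> \<Longrightarrow>
           ((\<lambda>s. W s t) has_vector_derivative \<xi>_slope \<xi> (W \<xi> t) (Wt \<xi> t)) (at \<xi>)"
    "\<And>\<xi> t. (\<xi>, t) \<in> tri_int S \<alpha> \<beta> \<Longrightarrow> ((\<lambda>s. W \<xi> s) has_vector_derivative Wt \<xi> t) (at t)"
    using assms(1) by (rule solutionE) simp
  obtain Vt where V: "continuous_on (tri S \<alpha> \<beta>) (\<lambda>z. V (fst z) (snd z))" "\<forall>t\<in>{\<alpha>..\<beta>}. V 0 t = V0 t"
    "continuous_on (tri_int S \<alpha> \<beta>) (\<lambda>z. Vt (fst z) (snd z))"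
    "\<And>\<xi> t. (\<xi>, t) \<in> tri_int S \<alpha> \<beta> \<Longrightarrow>
           ((\<lambda>s. V s t) has_vector_derivative \<xi>_slope \<xi> (V \<xi> t) (Vt \<xi> t)) (at \<xi>)"
    "\<And>\<xi> t. (\<xi>, t) \<in> tri_int S \<alpha> \<beta> \<Longrightarrow> ((\<lambda>s. V \<xi> s) has_vector_derivative Vt \<xi> t) (at t)"
    using assms(2) by (rule solutionE) simp
  have lin: "\<xi>_slope \<xi> (w + c *\<^sub>R v) (wt + c *\<^sub>R vt) = \<xi>_slope \<xi> w wt + c *\<^sub>R \<xi>_slope \<xi> v vt" for \<xi> w wt v vt
    by (simp add: \<xi>_slope_def algebra_simps)
  show ?thesis
    unfolding solution_iff
  proof (intro conjI exI[of _ "\<lambda>\<xi> t. Wt \<xi> t + c *\<^sub>R Vt \<xi> t"] allI impI)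
    fix \<xi> t assume D: "(\<xi>, t) \<in> tri_int S \<alpha> \<beta>"
    show "((\<lambda>s. W s t + c *\<^sub>R V s t) has_vector_derivative \<xi>_slope \<xi> (W \<xi> t + c *\<^sub>R V \<xi> t) (Wt \<xi> t + c *\<^sub>R Vt \<xi> t)) (at \<xi>)"
      unfolding lin using W(4,5)[OF D] V(4,5)[OF D]
      by (intro has_vector_derivative_add bounded_linear.has_vector_derivative[OF bounded_linear_scaleR_right]) auto
    show "((\<lambda>s. W \<xi> s + c *\<^sub>R V \<xi> s) has_vector_derivative Wt \<xi> t + c *\<^sub>R Vt \<xi> t) (at t)"
      using W(4,5)[OF D] V(4,5)[OF D]
      by (intro has_vector_derivative_add bounded_linear.has_vector_derivative[OF bounded_linear_scaleR_right]) auto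
  qed (use W(2) V(2) in \<open>auto intro!: continuous_intros W V\<close>)
qed

lemma solution_add:
  assumes "vekua_solution_on S f \<alpha> \<beta> W0 W" "vekua_solution_on S f \<alpha> \<beta> V0 V"
  shows "vekua_solution_on S f \<alpha> \<beta> (\<lambda>t. W0 t + V0 t) (\<lambda>\<xi> t. W \<xi> t + V \<xi> t)"
  using solution_add_scaleR[OF assms, of 1] by simp

lemma solution_diff:
  assumes "vekua_solution_on S f \<alpha> \<beta> W0 W" "vekua_solution_on S f \<alpha> \<beta> V0 V"
  shows "vekua_solution_on S f \<alpha> \<beta> (\<lambda>t. W0 t - V0 t) (\<lambda>\<xi> t. W \<xi> t - V \<xi> t)"
  using solution_add_scaleR[OF assms, of "-1"] by simp

text \<open>Translation is harmless as the coefficient depends on \<xi> only. In the second part,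
  reversing t changes the sign of the t-derivative and conjugation changes the sign of j, so their
  product is preserved.\<close>

lemma solution_affine:
  assumes "vekua_solution_on S f \<alpha> \<beta> W0 W"
  shows "vekua_solution_on S f (\<alpha> - c) (\<beta> - c) (\<lambda>t. W0 (t + c)) (\<lambda>\<xi> t. W \<xi> (t + c))"
    and "vekua_solution_on S f (c - \<beta>) (c - \<alpha>) (\<lambda>t. bc_conj (W0 (c - t))) (\<lambda>\<xi> t. bc_conj (W \<xi> (c - t)))"
proof -
  obtain Wt where W: "continuous_on (tri S \<alpha> \<beta>) (\<lambda>z. W (fst z) (snd z))" "\<forall>t\<in>{\<alpha>..\<beta>}. W 0 t = W0 t"
    "continuous_on (tri_int S \<alpha> \<beta>) (\<lambda>z. Wt (fst z) (snd z))"
    "\<And>\<xi> t. (\<xi>, t) \<in> tri_int S \<alpha> \<beta> \<Longrightarrow>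
           ((\<lambda>s. W s t) has_vector_derivative \<xi>_slope \<xi> (W \<xi> t) (Wt \<xi> t)) (at \<xi>)"
    "\<And>\<xi> t. (\<xi>, t) \<in> tri_int S \<alpha> \<beta> \<Longrightarrow> ((\<lambda>s. W \<xi> s) has_vector_derivative Wt \<xi> t) (at t)"
    using assms(1) by (rule solutionE) simp
  have c1: "continuous_on (tri S (\<alpha> - c) (\<beta> - c)) (\<lambda>z. W (fst z) (snd z + c))"
    by (rule continuous_on_map_snd[OF W(1), where h = "\<lambda>t. t + c"]) (auto intro!: continuous_intros simp: mem_tri mem_tri_int)
  have c2: "continuous_on (tri_int S (\<alpha> - c) (\<beta> - c)) (\<lambda>z. Wt (fst z) (snd z + c))"
    by (rule continuous_on_map_snd[OF W(3), where h = "\<lambda>t. t + c"]) (auto intro!: continuous_intros simp: mem_tri mem_tri_int)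
  have c3: "continuous_on (tri S (c - \<beta>) (c - \<alpha>)) (\<lambda>z. W (fst z) (c - snd z))"
    by (rule continuous_on_map_snd[OF W(1), where h = "\<lambda>t. c - t"]) (auto intro!: continuous_intros simp: mem_tri mem_tri_int)
  have c4: "continuous_on (tri_int S (c - \<beta>) (c - \<alpha>)) (\<lambda>z. Wt (fst z) (c - snd z))"
    by (rule continuous_on_map_snd[OF W(3), where h = "\<lambda>t. c - t"]) (auto intro!: continuous_intros simp: mem_tri mem_tri_int)
  have bl: "bounded_linear bc_conj"
    unfolding bc_conj_def
    by (intro bounded_linear_Pair bounded_linear_fst bounded_linear_minus bounded_linear_snd)
  note [continuous_intros] = bounded_linear.continuous_on[OF bl]
  show "vekua_solution_on S f (\<alpha> - c) (\<beta> - c) (\<lambda>t. W0 (t + c)) (\<lambda>\<xi> t. W \<xi> (t + c))"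
    unfolding solution_iff
  proof (intro conjI exI[of _ "\<lambda>\<xi> t. Wt \<xi> (t + c)"] allI impI c1 c2)
    fix \<xi> t assume "(\<xi>, t) \<in> tri_int S (\<alpha> - c) (\<beta> - c)"
    then have D: "(\<xi>, t + c) \<in> tri_int S \<alpha> \<beta>" by (auto simp: mem_tri_int)
    show "((\<lambda>s. W s (t + c)) has_vector_derivative \<xi>_slope \<xi> (W \<xi> (t + c)) (Wt \<xi> (t + c))) (at \<xi>)"
      by (rule W(4)[OF D])
    have "((\<lambda>t. t + c) has_vector_derivative 1) (at t)" by (auto intro!: derivative_eq_intros)
    from vector_diff_chain_at[OF this W(5)[OF D]]
    show "((\<lambda>s. W \<xi> (s + c)) has_vector_derivative Wt \<xi> (t + c)) (at t)" by (simp add: o_def)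
  qed (use W(2) in auto)
  show "vekua_solution_on S f (c - \<beta>) (c - \<alpha>) (\<lambda>t. bc_conj (W0 (c - t))) (\<lambda>\<xi> t. bc_conj (W \<xi> (c - t)))"
    unfolding solution_iff
  proof (intro conjI exI[of _ "\<lambda>\<xi> t. - bc_conj (Wt \<xi> (c - t))"] allI impI)
    fix \<xi> t assume "(\<xi>, t) \<in> tri_int S (c - \<beta>) (c - \<alpha>)"
    then have D: "(\<xi>, c - t) \<in> tri_int S \<alpha> \<beta>" by (auto simp: mem_tri_int)
    have eq: "\<xi>_slope \<xi> (bc_conj w) (- bc_conj wt) = bc_conj (\<xi>_slope \<xi> w wt)" for w wt
      by (simp add: \<xi>_slope_def bc_conj_def)
    show "((\<lambda>s. bc_conj (W s (c - t))) has_vector_derivative \<xi>_slope \<xi> (bc_conj (W \<xi> (c - t))) (- bc_conj (Wt \<xi> (c - t)))) (at \<xi>)"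
      unfolding eq by (rule bounded_linear.has_vector_derivative[OF bl W(4)[OF D]])
    have "((\<lambda>t. c - t) has_vector_derivative - 1) (at t)" by (auto intro!: derivative_eq_intros)
    from bounded_linear.has_vector_derivative[OF bl vector_diff_chain_at[OF this W(5)[OF D]]]
    show "((\<lambda>s. bc_conj (W \<xi> (c - s))) has_vector_derivative - bc_conj (Wt \<xi> (c - t))) (at t)"
      by (simp add: o_def bc_conj_def)
  qed (use W(2) in \<open>auto intro!: continuous_intros c3 c4\<close>)
qed

lemma solution_restrict:
  assumes "vekua_solution_on S f \<alpha> \<beta> W0 W" "\<alpha> \<le> \<alpha>'" "\<beta>' \<le> \<beta>" "\<And>t. t \<in> {\<alpha>'..\<beta>'} \<Longrightarrow> W0' t = W0 t"
  shows "vekua_solution_on S f \<alpha>' \<beta>' W0' W"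
proof -
  have 1: "tri S \<alpha>' \<beta>' \<subseteq> tri S \<alpha> \<beta>" and 2: "tri_int S \<alpha>' \<beta>' \<subseteq> tri_int S \<alpha> \<beta>"
    using assms(2,3) by (auto simp: mem_tri mem_tri_int)
  from assms(1) obtain Wt where W: "continuous_on (tri S \<alpha> \<beta>) (\<lambda>z. W (fst z) (snd z))" "\<forall>t\<in>{\<alpha>..\<beta>}. W 0 t = W0 t"
    "continuous_on (tri_int S \<alpha> \<beta>) (\<lambda>z. Wt (fst z) (snd z))"
    "\<And>\<xi> t. (\<xi>, t) \<in> tri_int S \<alpha> \<beta> \<Longrightarrow>
           ((\<lambda>s. W s t) has_vector_derivative \<xi>_slope \<xi> (W \<xi> t) (Wt \<xi> t)) (at \<xi>)"
    "\<And>\<xi> t. (\<xi>, t) \<in> tri_int S \<alpha> \<beta> \<Longrightarrow> ((\<lambda>s. W \<xi> s) has_vector_derivative Wt \<xi> t) (at t)"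
    by (rule solutionE) simp
  show ?thesis
    unfolding solution_iff
  proof (intro conjI exI[of _ Wt] allI impI)
    show "continuous_on (tri S \<alpha>' \<beta>') (\<lambda>z. W (fst z) (snd z))" by (rule continuous_on_subset[OF W(1) 1])
    show "continuous_on (tri_int S \<alpha>' \<beta>') (\<lambda>z. Wt (fst z) (snd z))" by (rule continuous_on_subset[OF W(3) 2])
    show "\<forall>t\<in>{\<alpha>'..\<beta>'}. W 0 t = W0' t" using W(2) assms(2-4) by simp
  qed (use W(4,5) 2 in auto)
qed

lemma solution_unique:
  assumes "vekua_solution_on S f \<alpha> \<beta> W0 W" "vekua_solution_on S f \<alpha> \<beta> W0 V" "(\<xi>, t) \<in> tri S \<alpha> \<beta>"
  shows "W \<xi> t = V \<xi> t"
proof -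
  have d: "vekua_solution_on S f \<alpha> \<beta> (\<lambda>t. W0 t - W0 t) (\<lambda>\<xi> t. W \<xi> t - V \<xi> t)"
    by (rule solution_diff[OF assms(1,2)])
  obtain Q where Q: "Q \<ge> 0" "\<And>s. s \<in> {0..\<xi>} \<Longrightarrow> \<bar>q s\<bar> \<le> Q"
    using q_bounded[of \<xi>] assms(3) unfolding mem_tri by metis
  have 0: "bc_plus 0 = 0" "bc_minus 0 = 0"
    by (simp_all add: bc_plus_def bc_minus_def bc_R_def bc_I_def)
  have "bc_plus (W \<xi> t - V \<xi> t) = 0" "bc_minus (W \<xi> t - V \<xi> t) = 0"
    using a_priori_bound[OF d assms(3) Q] by (simp_all add: 0)
  then have "fst (W \<xi> t - V \<xi> t) + snd (W \<xi> t - V \<xi> t) = 0" "fst (W \<xi> t - V \<xi> t) = snd (W \<xi> t - V \<xi> t)"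
    by (simp_all add: bc_plus_def bc_minus_def bc_R_def bc_I_def)
  then have "fst (W \<xi> t - V \<xi> t) = 0 \<and> snd (W \<xi> t - V \<xi> t) = 0" by (simp only: double_zero) simp
  then show ?thesis by (simp add: prod_eq_iff)
qed

section \<open>Recursive integrals as formal powers and the resulting solutions\<close>

text \<open>Interlacing \<open>Xrec\<close> and \<open>Xtil\<close> by parity removes the
  alternation of weights: in \<open>X_Suc\<close> one family is always integrated against 1/f^2 and
  the other always against f^2, each feeding the other.\<close>

definition X\<phi> :: "nat \<Rightarrow> real \<Rightarrow> real" where "X\<phi> j = (if odd j then Xrec f j else Xtil f j)"
definition X\<psi> :: "nat \<Rightarrow> real \<Rightarrow> real" where "X\<psi> j = (if odd j then Xtil f j else Xrec f j)"

lemma X_0: "X\<phi> 0 = (\<lambda>_. 1)" "X\<psi> 0 = (\<lambda>_. 1)"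
  by (auto simp: X\<phi>_def X\<psi>_def)

lemma X_Suc:
  "X\<phi> (Suc j) = (\<lambda>\<xi>. real (Suc j) * integral {0..\<xi>} (\<lambda>s. X\<psi> j s * (1 / (f s)\<^sup>2)))"
  "X\<psi> (Suc j) = (\<lambda>\<xi>. real (Suc j) * integral {0..\<xi>} (\<lambda>s. X\<phi> j s * (f s)\<^sup>2))"
  by (simp_all add: X\<phi>_def X\<psi>_def)

lemma phi_eq: "phi f j \<xi> = f \<xi> * X\<phi> j \<xi>" and psi_eq: "psi f j \<xi> = X\<psi> j \<xi> / f \<xi>"
  by (simp_all add: phi_def psi_def X\<phi>_def X\<psi>_def)

lemma X_continuous: "continuous_on S (X\<phi> j) \<and> continuous_on S (X\<psi> j)"
proof (induction j)
  case 0
  then show ?case by (simp add: X_0)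
next
  case (Suc j)
  then show ?case
    unfolding X_Suc
    by (intro conjI continuous_on_mult continuous_on_const indefinite_integral continuous_on_power
        continuous_on_divide cont_f) (auto simp: f_nonzero)
qed

lemma X_derivative:
  assumes "\<xi> \<in> S" "0 < \<xi>"
  shows "(X\<phi> (Suc j) has_real_derivative real (Suc j) * (X\<psi> j \<xi> / (f \<xi>)\<^sup>2)) (at \<xi>)"
    and "(X\<psi> (Suc j) has_real_derivative real (Suc j) * (X\<phi> j \<xi> * (f \<xi>)\<^sup>2)) (at \<xi>)"
proof -
  have c: "continuous_on S (\<lambda>s. X\<psi> j s * (1 / (f s)\<^sup>2))" "continuous_on S (\<lambda>s. X\<phi> j s * (f s)\<^sup>2)"
    using X_continuous[of j] by (auto intro!: continuous_intros cont_f simp: f_nonzero)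
  show "(X\<phi> (Suc j) has_real_derivative real (Suc j) * (X\<psi> j \<xi> / (f \<xi>)\<^sup>2)) (at \<xi>)"
    unfolding X_Suc using DERIV_cmult[OF indefinite_integral(2)[OF c(1) assms], of "real (Suc j)"] by simp
  show "(X\<psi> (Suc j) has_real_derivative real (Suc j) * (X\<phi> j \<xi> * (f \<xi>)\<^sup>2)) (at \<xi>)"
    unfolding X_Suc using DERIV_cmult[OF indefinite_integral(2)[OF c(2) assms], of "real (Suc j)"] by simp
qed

lemma X_at_0: "j \<noteq> 0 \<Longrightarrow> X\<phi> j 0 = 0" "j \<noteq> 0 \<Longrightarrow> X\<psi> j 0 = 0"
  by (cases j; simp add: X_Suc)+

text \<open>If X j s is the power s^j and N exceeds the degree of G, this is the exact Taylor
  expansion of G(t+s). The recursive integrals take the place of the powers.\<close>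

definition taylor :: "(nat \<Rightarrow> real \<Rightarrow> real) \<Rightarrow> nat \<Rightarrow> complex poly \<Rightarrow> real \<Rightarrow> real \<Rightarrow> complex" where
  "taylor X N G s t = (\<Sum>j<N. (X j s / fact j) *\<^sub>R poly ((pderiv ^^ j) G) (of_real t))"

text \<open>The truncation index N is a separate parameter, so that G and its derivative can be used
  with the same N; terms beyond the degree vanish.\<close>

definition poly_solution :: "nat \<Rightarrow> complex poly \<Rightarrow> real \<Rightarrow> real \<Rightarrow> bicomplex" where
  "poly_solution N G s t = (1/2) *\<^sub>R (f s *\<^sub>R taylor X\<phi> N G s t, (1 / f s) *\<^sub>R taylor X\<psi> N G s t)"

lemma higher_pderiv_eq_0: "degree (G :: complex poly) < j \<Longrightarrow> (pderiv ^^ j) G = 0"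
  by (rule poly_eqI) (simp add: coeff_higher_pderiv coeff_eq_0)

lemma taylor_t_derivative:
  "((\<lambda>t. taylor X N G s t) has_vector_derivative taylor X N (pderiv G) s t) (at t)"
proof -
  have "((\<lambda>t. poly ((pderiv ^^ j) G) (complex_of_real t)) has_vector_derivative poly ((pderiv ^^ j) (pderiv G)) (of_real t)) (at t)" for j
  proof -
    have "(pderiv ^^ j) (pderiv G) = pderiv ((pderiv ^^ j) G)"
      by (induction j) auto
    then show ?thesis
      using has_vector_derivative_real_field[OF poly_DERIV[of "(pderiv ^^ j) G" "complex_of_real t"]] by simp
  qed
  then show ?thesis
    unfolding taylor_def
    by (intro has_vector_derivative_sum bounded_linear.has_vector_derivative[OF bounded_linear_scaleR_right])
qed

text \<open>Differentiating lowers the index of the formal power and switches its family, while the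
  leftover derivative of G is absorbed as an expansion of \<open>pderiv G\<close>. The weight
  \<open>c\<close> is 1/f^2 or f^2.\<close>

lemma taylor_s_derivative:
  assumes X0: "X 0 = (\<lambda>_. 1)"
    and X: "\<And>j. (X (Suc j) has_real_derivative real (Suc j) * (Y j s * c)) (at s)"
    and N: "degree G < N"
  shows "((\<lambda>s. taylor X N G s t) has_vector_derivative c *\<^sub>R taylor Y N (pderiv G) s t) (at s)"
proof -
  obtain M where M: "N = Suc M" using N by (cases N) auto
  have d: "((\<lambda>s. (X (Suc j) s / fact (Suc j)) *\<^sub>R poly ((pderiv ^^ Suc j) G) (of_real t)) has_vector_derivative
      (c * Y j s / fact j) *\<^sub>R poly ((pderiv ^^ j) (pderiv G)) (complex_of_real t)) (at s)" for j
  proof -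
    have "((\<lambda>s. X (Suc j) s / fact (Suc j)) has_real_derivative real (Suc j) * (Y j s * c) / fact (Suc j)) (at s)"
      by (rule DERIV_cdivide[OF X])
    moreover have "real (Suc j) * (Y j s * c) / fact (Suc j) = c * Y j s / fact j"
      by (simp add: fact_Suc field_simps del: of_nat_Suc)
    moreover have "(pderiv ^^ Suc j) G = (pderiv ^^ j) (pderiv G)" by (simp add: funpow_swap1)
    ultimately show ?thesis
      using has_vector_derivative_scaleR[of "\<lambda>s. X (Suc j) s / fact (Suc j)" _ s UNIV "\<lambda>_. poly ((pderiv ^^ Suc j) G) (complex_of_real t)" 0]
      by (simp add: has_real_derivative_iff_has_vector_derivative mult.commute[of c "Y j s"])
  qed
  have "taylor X N G s t = poly G t + (\<Sum>j<M. (X (Suc j) s / fact (Suc j)) *\<^sub>R poly ((pderiv ^^ Suc j) G) (of_real t))" for s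
    unfolding taylor_def M sum.lessThan_Suc_shift by (simp add: X0)
  moreover have "c *\<^sub>R taylor Y N (pderiv G) s t =
      0 + (\<Sum>j<M. (c * Y j s / fact j) *\<^sub>R poly ((pderiv ^^ j) (pderiv G)) (complex_of_real t))"
  proof -
    \<comment> \<open>The expansion of \<open>pderiv G\<close> has one more term than the
      differentiated sum; that term vanishes since N exceeds the degree of G.\<close>
    have "(pderiv ^^ M) (pderiv G) = 0"
      using higher_pderiv_eq_0[of G "Suc M"] N M by (simp add: funpow_swap1)
    then show ?thesis by (simp add: taylor_def M scaleR_sum_right)
  qed
  ultimately show ?thesis
    by (simp only:) (intro has_vector_derivative_add has_vector_derivative_const has_vector_derivative_sum d)
qed

lemma taylor_continuous:
  assumes "\<And>j. continuous_on S (X j)" "D \<subseteq> S \<times> UNIV"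
  shows "continuous_on D (\<lambda>z. taylor X N G (fst z) (snd z))"
proof -
  have "continuous_on D (\<lambda>z. X j (fst z))" for j
    by (rule continuous_on_compose2[OF assms(1)]) (use assms(2) in \<open>auto intro!: continuous_intros\<close>)
  then show ?thesis
    unfolding taylor_def by (intro continuous_intros) auto
qed

lemma poly_solution_continuous:
  assumes "D \<subseteq> S \<times> UNIV"
  shows "continuous_on D (\<lambda>z. poly_solution N G (fst z) (snd z))"
proof -
  have "continuous_on D (\<lambda>z. f (fst z))"
    by (rule continuous_on_compose2[OF cont_f]) (use assms in \<open>auto intro!: continuous_intros\<close>)
  then show ?thesis
    unfolding poly_solution_def
    using assms f_nonzero X_continuous by (intro continuous_intros taylor_continuous) auto
qed

lemma poly_solution_t_derivative:
  "((\<lambda>t. poly_solution N G s t) has_vector_derivative poly_solution N (pderiv G) s t) (at t)"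
  unfolding poly_solution_def
  by (intro bounded_linear.has_vector_derivative[OF bounded_linear_scaleR_right]
      has_vector_derivative_Pair taylor_t_derivative)

text \<open>By the product rule, differentiating f and 1/f gives the terms with q and -q. In the
  rest f/f^2 = 1/f and f^2/f = f, which are just the outer factors of the opposite component for
  \<open>pderiv G\<close>.\<close>

lemma poly_solution_s_derivative:
  assumes "s \<in> S" "0 < s" "degree G < N"
  shows "((\<lambda>s. poly_solution N G s t) has_vector_derivative
           \<xi>_slope s (poly_solution N G s t) (poly_solution N (pderiv G) s t)) (at s)"
proof -
  have fs: "f s \<noteq> 0" using f_nonzero assms by auto
  have f': "(f has_vector_derivative f' s) (at s)"
    using deriv_f[OF assms(1,2)] by (simp add: has_real_derivative_iff_has_vector_derivative)
  have "((\<lambda>s. 1 / f s) has_real_derivative - f' s / (f s)\<^sup>2) (at s)"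
    using deriv_f[OF assms(1,2)] fs by (auto intro!: derivative_eq_intros simp: power2_eq_square)
  then have if': "((\<lambda>s. 1 / f s) has_vector_derivative - f' s / (f s)\<^sup>2) (at s)"
    by (simp add: has_real_derivative_iff_has_vector_derivative)
  have a: "((\<lambda>s. taylor X\<phi> N G s t) has_vector_derivative (1 / (f s)\<^sup>2) *\<^sub>R taylor X\<psi> N (pderiv G) s t) (at s)"
    by (rule taylor_s_derivative[where X = X\<phi> and Y = X\<psi>]) (use assms(3) X_0(1) X_derivative(1)[OF assms(1,2)] in simp_all)
  have b: "((\<lambda>s. taylor X\<psi> N G s t) has_vector_derivative ((f s)\<^sup>2) *\<^sub>R taylor X\<phi> N (pderiv G) s t) (at s)"
    by (rule taylor_s_derivative[where X = X\<psi> and Y = X\<phi>]) (use assms(3) X_0(2) X_derivative(2)[OF assms(1,2)] in simp_all)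
  have "((\<lambda>s. poly_solution N G s t) has_vector_derivative
     (1/2) *\<^sub>R (f s *\<^sub>R ((1 / (f s)\<^sup>2) *\<^sub>R taylor X\<psi> N (pderiv G) s t) + f' s *\<^sub>R taylor X\<phi> N G s t,
       (1 / f s) *\<^sub>R (((f s)\<^sup>2) *\<^sub>R taylor X\<phi> N (pderiv G) s t) + (- f' s / (f s)\<^sup>2) *\<^sub>R taylor X\<psi> N G s t)) (at s)"
    unfolding poly_solution_def
    by (intro bounded_linear.has_vector_derivative[OF bounded_linear_scaleR_right]
        has_vector_derivative_Pair has_vector_derivative_scaleR a b)
       (use f' if' in \<open>simp_all add: has_real_derivative_iff_has_vector_derivative\<close>)
  moreover have "(1/2) *\<^sub>R (f s *\<^sub>R ((1 / (f s)\<^sup>2) *\<^sub>R taylor X\<psi> N (pderiv G) s t) + f' s *\<^sub>R taylor X\<phi> N G s t,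
       (1 / f s) *\<^sub>R (((f s)\<^sup>2) *\<^sub>R taylor X\<phi> N (pderiv G) s t) + (- f' s / (f s)\<^sup>2) *\<^sub>R taylor X\<psi> N G s t) =
     \<xi>_slope s (poly_solution N G s t) (poly_solution N (pderiv G) s t)"
    using fs by (simp add: \<xi>_slope_def poly_solution_def q_def power2_eq_square scaleR_add_right scaleR_diff_right)
  ultimately show ?thesis by simp
qed

lemma taylor_at_0:
  assumes "X 0 = (\<lambda>_. 1)" "\<And>j. j \<noteq> 0 \<Longrightarrow> X j 0 = 0" "0 < N"
  shows "taylor X N G 0 t = poly G t"
proof -
  obtain M where M: "N = Suc M" using assms(3) by (cases N) auto
  show ?thesis unfolding taylor_def M sum.lessThan_Suc_shift using assms by simp
qed

lemma poly_solution:
  assumes "degree G < N"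
  shows "vekua_solution_on S f \<alpha> \<beta> (\<lambda>t. (1/2) *\<^sub>R (poly G t, poly G t)) (poly_solution N G)"
  unfolding solution_iff
proof (intro conjI exI[of _ "poly_solution N (pderiv G)"] allI impI ballI)
  show "continuous_on (tri S \<alpha> \<beta>) (\<lambda>z. poly_solution N G (fst z) (snd z))"
    by (rule poly_solution_continuous) (auto simp: tri_def)
  show "continuous_on (tri_int S \<alpha> \<beta>) (\<lambda>z. poly_solution N (pderiv G) (fst z) (snd z))"
    by (rule poly_solution_continuous) (auto simp: tri_int_def)
  show "poly_solution N G 0 t = (1/2) *\<^sub>R (poly G t, poly G t)" for t
    using assms by (simp add: poly_solution_def f_zero taylor_at_0 X_0 X_at_0)
  fix \<xi> t assume "(\<xi>, t) \<in> tri_int S \<alpha> \<beta>"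
  then show "((\<lambda>s. poly_solution N G s t) has_vector_derivative
      \<xi>_slope \<xi> (poly_solution N G \<xi> t) (poly_solution N (pderiv G) \<xi> t)) (at \<xi>)"
    by (intro poly_solution_s_derivative assms) (auto simp: mem_tri_int)
  show "(poly_solution N G \<xi> has_vector_derivative poly_solution N (pderiv G) \<xi> t) (at t)"
    by (rule poly_solution_t_derivative)
qed

text \<open>At t = 0 the j-th derivative of G is j! times a coefficient, which cancels the
  factorial. For a rescaled Legendre polynomial as G this gives the sums inside a_n and b_n.\<close>

lemma poly_solution_at_center:
  "poly_solution N G \<xi> 0 =
     (1/2) *\<^sub>R (\<Sum>j<N. phi f j \<xi> *\<^sub>R coeff G j, \<Sum>j<N. psi f j \<xi> *\<^sub>R coeff G j)"
proof -
  have "taylor X N G \<xi> 0 = (\<Sum>j<N. X j \<xi> *\<^sub>R coeff G j)" for X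
    unfolding taylor_def
  proof (rule sum.cong[OF refl])
    fix j
    have "poly ((pderiv ^^ j) G) (complex_of_real 0) = fact j * coeff G j"
      by (simp add: poly_0_coeff_0 coeff_higher_pderiv pochhammer_fact)
    then show "(X j \<xi> / fact j) *\<^sub>R poly ((pderiv ^^ j) G) (complex_of_real 0) = X j \<xi> *\<^sub>R coeff G j"
      by (simp add: scaleR_conv_of_real)
  qed
  then show ?thesis
    by (simp add: poly_solution_def phi_eq psi_eq scaleR_sum_right)
qed

end

section \<open>Existence\<close>

text \<open>The multiple z P^+ of the idempotent, with characteristic components z and 0.\<close>

definition half_diag :: "complex \<Rightarrow> bicomplex" where
  "half_diag z = (1/2) *\<^sub>R (z, z)"

lemma half_diag_simps [simp]: "bc_plus (half_diag z) = z" "bc_minus (half_diag z) = 0"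
  by (auto simp: half_diag_def bc_plus_def bc_minus_def bc_R_def bc_I_def scaleR_conv_of_real)

lemma half_diag_diff: "half_diag z - half_diag w = half_diag (z - w)"
  by (simp add: half_diag_def scaleR_diff_right)

context vekua_coefficient
begin

section \<open>Estimates and limits for data with vanishing minus component\<close>

text \<open>The doubled components of W are p + m and p - m, so the two a priori bounds add up,
  turning the constant 2 into 4. The doubled form is the one summed by the series for a_n and
  b_n.\<close>

lemma half_diag_bound:
  assumes sol: "vekua_solution_on S f \<alpha> \<beta> (\<lambda>t. half_diag (g t)) W"
    and pt: "(\<xi>, t) \<in> tri S \<alpha> \<beta>"
    and Q: "0 \<le> Q" "\<And>s. s \<in> {0..\<xi>} \<Longrightarrow> \<bar>q s\<bar> \<le> Q"
  defines "K \<equiv> 4 * Q * integral {t-\<xi>..t+\<xi>} (\<lambda>s. norm (g s)) * exp ((2 * Q + 1) * \<xi>)"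
  shows "norm (2 * fst (W \<xi> t) - g (t + \<xi>)) \<le> K" "norm (2 * snd (W \<xi> t) - g (t + \<xi>)) \<le> K"
proof -
  have 1: "norm (bc_plus (W \<xi> t) - g (t + \<xi>)) \<le> K / 2" and 2: "norm (bc_minus (W \<xi> t)) \<le> K / 2"
    using a_priori_bound[OF sol pt Q] by (simp_all add: K_def mult_ac)
  have u: "2 * fst (W \<xi> t) - g (t + \<xi>) = (bc_plus (W \<xi> t) - g (t + \<xi>)) + bc_minus (W \<xi> t)"
    and v: "2 * snd (W \<xi> t) - g (t + \<xi>) = (bc_plus (W \<xi> t) - g (t + \<xi>)) - bc_minus (W \<xi> t)"
    by (simp_all add: bc_plus_def bc_minus_def bc_R_def bc_I_def)
  show "norm (2 * fst (W \<xi> t) - g (t + \<xi>)) \<le> K"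
    unfolding u using norm_triangle_mono[OF 1 2] by simp
  show "norm (2 * snd (W \<xi> t) - g (t + \<xi>)) \<le> K"
    unfolding v using norm_triangle_ineq4[of "bc_plus (W \<xi> t) - g (t + \<xi>)" "bc_minus (W \<xi> t)"] 1 2
    by linarith
qed

text \<open>The L1 norm over an interval of length at most 2\<eta> is bounded by the supremum. In
  \<open>K\<close> the summand 1 accounts for the transported data. The constant is the same for all
  data and all intervals, which is what a Cauchy sequence of solutions requires.\<close>

lemma half_diag_sup_bound:
  assumes \<eta>: "\<eta> \<in> S"
  obtains K where "K > 0" "\<And>\<alpha> \<beta> g W \<xi> t \<epsilon>. vekua_solution_on S f \<alpha> \<beta> (\<lambda>t. half_diag (g t)) W \<Longrightarrow>
    (\<xi>, t) \<in> tri S \<alpha> \<beta> \<Longrightarrow> \<xi> \<le> \<eta> \<Longrightarrow> (\<And>s. s \<in> {\<alpha>..\<beta>} \<Longrightarrow> norm (g s) \<le> \<epsilon>) \<Longrightarrow> norm (W \<xi> t) \<le> K * \<epsilon>"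
proof -
  obtain Q where Q: "Q \<ge> 0" "\<And>s. s \<in> {0..\<eta>} \<Longrightarrow> \<bar>q s\<bar> \<le> Q"
    using q_bounded[OF \<eta>] by metis
  have \<eta>0: "\<eta> \<ge> 0" using S_nonneg \<eta> .
  define K where "K = 1 + 8 * Q * \<eta> * exp ((2 * Q + 1) * \<eta>)"
  show thesis
  proof (rule that[of K])
    have "0 \<le> 8 * Q * \<eta> * exp ((2 * Q + 1) * \<eta>)" using Q \<eta>0 by simp
    then show "K > 0" by (simp add: K_def)
    fix \<alpha> \<beta> g W \<xi> t and \<epsilon> :: real
    assume sol: "vekua_solution_on S f \<alpha> \<beta> (\<lambda>t. half_diag (g t)) W" and pt: "(\<xi>, t) \<in> tri S \<alpha> \<beta>"
      and \<xi>: "\<xi> \<le> \<eta>" and g: "\<And>s. s \<in> {\<alpha>..\<beta>} \<Longrightarrow> norm (g s) \<le> \<epsilon>"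
    have \<xi>0: "0 \<le> \<xi>" "\<alpha> \<le> t - \<xi>" "t + \<xi> \<le> \<beta>" using pt by (auto simp: mem_tri)
    have \<epsilon>: "\<epsilon> \<ge> 0" by (rule order.trans[OF norm_ge_zero g[of "t + \<xi>"]]) (use \<xi>0 in auto)
    have gc: "continuous_on {t-\<xi>..t+\<xi>} g"
    proof -
      have "continuous_on {\<alpha>..\<beta>} (\<lambda>t. bc_plus (half_diag (g t)))"
        unfolding bc_plus_def bc_R_def bc_I_def by (intro continuous_intros data_continuous[OF sol])
      then have "continuous_on {\<alpha>..\<beta>} g" by simp
      then show ?thesis by (rule continuous_on_subset) (use \<xi>0 in auto)
    qed
    have I: "integral {t-\<xi>..t+\<xi>} (\<lambda>s. norm (g s)) \<le> \<epsilon> * (2 * \<eta>)"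
    proof -
      have "norm (integral {t-\<xi>..t+\<xi>} (\<lambda>s. norm (g s))) \<le> \<epsilon> * ((t + \<xi>) - (t - \<xi>))"
        by (rule integral_bound) (use \<xi>0 g in \<open>auto intro!: continuous_intros gc\<close>)
      also have "\<dots> \<le> \<epsilon> * (2 * \<eta>)" using \<epsilon> \<xi> by (intro mult_left_mono) auto
      finally show ?thesis by simp
    qed
    have I0: "0 \<le> integral {t-\<xi>..t+\<xi>} (\<lambda>s. norm (g s))"
      by (intro integral_nonneg integrable_continuous_real continuous_intros gc) auto
    have "4 * Q * integral {t-\<xi>..t+\<xi>} (\<lambda>s. norm (g s)) * exp ((2 * Q + 1) * \<xi>) \<le> 4 * Q * (\<epsilon> * (2 * \<eta>)) * exp ((2 * Q + 1) * \<eta>)"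
      using I I0 \<xi> \<xi>0 Q \<epsilon> \<eta>0 by (intro mult_mono) auto
    also have "\<dots> = (K - 1) * \<epsilon>" by (simp add: K_def)
    finally have le: "4 * Q * integral {t-\<xi>..t+\<xi>} (\<lambda>s. norm (g s)) * exp ((2 * Q + 1) * \<xi>) \<le> (K - 1) * \<epsilon>" .
    have q': "\<And>s. s \<in> {0..\<xi>} \<Longrightarrow> \<bar>q s\<bar> \<le> Q" using Q(2) \<xi> by auto
    have one: "norm x \<le> K * \<epsilon> / 2" if "norm (2 * x - g (t + \<xi>)) \<le> (K - 1) * \<epsilon>" for x
    proof -
      have "norm (2 * x) \<le> norm (2 * x - g (t + \<xi>)) + norm (g (t + \<xi>))"
        using norm_triangle_ineq[of "2 * x - g (t + \<xi>)" "g (t + \<xi>)"] by simp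
      also have "\<dots> \<le> (K - 1) * \<epsilon> + \<epsilon>" using that g[of "t + \<xi>"] \<xi>0 by (intro add_mono) auto
      finally show ?thesis by (simp add: norm_mult algebra_simps)
    qed
    have "norm (W \<xi> t) \<le> norm (fst (W \<xi> t)) + norm (snd (W \<xi> t))"
      using norm_Pair_le[of "fst (W \<xi> t)" "snd (W \<xi> t)"] by simp
    also have "\<dots> \<le> K * \<epsilon> / 2 + K * \<epsilon> / 2"
      using half_diag_bound[OF sol pt Q(1) q'] le by (intro add_mono one) (meson order.trans)+
    finally show "norm (W \<xi> t) \<le> K * \<epsilon>" by simp
  qed
qed

lemma slope_bound:
  assumes "\<bar>q s\<bar> \<le> Q"
  shows "norm (\<xi>_slope s w wt) \<le> 2 * norm wt + 2 * Q * norm w"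
proof -
  have a: "norm (q s *\<^sub>R x) \<le> Q * norm w" if "norm x \<le> norm w" for x :: complex
    using mult_mono[OF assms that] assms by simp
  have "norm (\<xi>_slope s w wt) \<le> norm (snd wt + q s *\<^sub>R fst w) + norm (fst wt - q s *\<^sub>R snd w)"
    unfolding \<xi>_slope_def by (rule norm_Pair_le)
  also have "\<dots> \<le> (norm wt + Q * norm w) + (norm wt + Q * norm w)"
    using norm_fst_le[of "fst w" "snd w"] norm_snd_le[of "snd w" "fst w"]
      norm_fst_le[of "fst wt" "snd wt"] norm_snd_le[of "snd wt" "fst wt"]
    by (intro add_mono order.trans[OF norm_triangle_ineq] order.trans[OF norm_triangle_ineq4] a) auto
  finally show ?thesis by simp
qed

text \<open>Bounds on q, and hence uniform convergence, are available only for \<xi> \<le> \<eta>;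
  continuity, being local, still passes to the whole triangle.\<close>

lemma continuous_on_tri_local:
  fixes W :: "real \<Rightarrow> real \<Rightarrow> bicomplex"
  assumes "\<And>\<eta>. \<eta> \<in> S \<Longrightarrow> continuous_on (tri S \<alpha> \<beta> \<inter> {..\<eta>} \<times> UNIV) (\<lambda>z. W (fst z) (snd z))"
  shows "continuous_on (tri S \<alpha> \<beta>) (\<lambda>z. W (fst z) (snd z))"
  unfolding continuous_on_eq_continuous_within
proof
  fix z assume z: "z \<in> tri S \<alpha> \<beta>"
  then obtain \<eta> where \<eta>: "\<eta> \<in> S" "fst z < \<eta>" using S_open[of "fst z"] by (cases z) (auto simp: mem_tri)
  have "at z within tri S \<alpha> \<beta> = at z within (tri S \<alpha> \<beta> \<inter> {..\<eta>} \<times> UNIV)"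
    by (rule at_within_nhd[of z "{..<\<eta>} \<times> UNIV"]) (use \<eta> in \<open>auto intro: open_Times simp: mem_Times_iff\<close>)
  moreover have "continuous (at z within (tri S \<alpha> \<beta> \<inter> {..\<eta>} \<times> UNIV)) (\<lambda>z. W (fst z) (snd z))"
    using assms[OF \<eta>(1)] z \<eta> unfolding continuous_on_eq_continuous_within by (auto simp: mem_Times_iff)
  ultimately show "continuous (at z within tri S \<alpha> \<beta>) (\<lambda>z. W (fst z) (snd z))" by simp
qed

text \<open>The t-derivatives of the polynomial solutions are again solutions, with the
  differentiated polynomials as data. Hence one and the same bound gives uniform convergence of the
  solutions and of their t-derivatives, and the equation carries it over to the
  \<xi>-derivatives.\<close>

lemma solution_exists_half_diag:
  assumes g: "C1_on {\<alpha>..\<beta>} g"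
  shows "\<exists>W. vekua_solution_on S f \<alpha> \<beta> (\<lambda>t. half_diag (g t)) W"
proof -
  obtain g' where g': "continuous_on {\<alpha>..\<beta>} g'"
    "\<And>x. x \<in> {\<alpha>..\<beta>} \<Longrightarrow> (g has_vector_derivative g' x) (at x within {\<alpha>..\<beta>})"
    using g unfolding C1_on_def by blast
  have "\<forall>n. \<exists>G :: complex poly. \<forall>x\<in>{\<alpha>..\<beta>}. norm (g x - poly G (of_real x)) \<le> inverse (real (Suc n)) \<and>
      norm (g' x - poly (pderiv G) (of_real x)) \<le> inverse (real (Suc n))"
    using C1_polynomial_approx[OF g'] by simp
  then obtain G where G: "\<And>n x. x \<in> {\<alpha>..\<beta>} \<Longrightarrow> norm (g x - poly (G n) (of_real x)) \<le> inverse (real (Suc n))"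
      "\<And>n x. x \<in> {\<alpha>..\<beta>} \<Longrightarrow> norm (g' x - poly (pderiv (G n)) (of_real x)) \<le> inverse (real (Suc n))"
    by metis
  define V where "V n = poly_solution (Suc (degree (G n))) (G n)" for n
  \<comment> \<open>The truncation index of \<open>V\<close> is kept, so that this is literally the
    t-derivative of \<open>V n\<close>.\<close>
  define V' where "V' n = poly_solution (Suc (degree (G n))) (pderiv (G n))" for n
  have V: "vekua_solution_on S f \<alpha> \<beta> (\<lambda>t. half_diag (poly (G n) (of_real t))) (V n)" for n
    unfolding V_def half_diag_def by (rule poly_solution) simp
  have V': "vekua_solution_on S f \<alpha> \<beta> (\<lambda>t. half_diag (poly (pderiv (G n)) (of_real t))) (V' n)" for n
    unfolding V'_def half_diag_def
    by (rule poly_solution) (simp add: degree_pderiv less_Suc_eq_le)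
  define W where "W \<xi> t = lim (\<lambda>n. V n \<xi> t)" for \<xi> t
  define W' where "W' \<xi> t = lim (\<lambda>n. V' n \<xi> t)" for \<xi> t
  \<comment> \<open>Used twice: for the solutions with data tending to \<open>g\<close>, and for
    their t-derivatives with data tending to \<open>g'\<close>.\<close>
  have conv: "uniform_limit (tri S \<alpha> \<beta> \<inter> {..\<eta>} \<times> UNIV) (\<lambda>n z. U n (fst z) (snd z))
        (\<lambda>z. lim (\<lambda>n. U n (fst z) (snd z))) sequentially"
    if \<eta>: "\<eta> \<in> S" and U: "\<And>n. vekua_solution_on S f \<alpha> \<beta> (\<lambda>t. half_diag (h n t)) (U n)"
      and h: "\<And>n x. x \<in> {\<alpha>..\<beta>} \<Longrightarrow> norm (h0 x - h n x) \<le> inverse (real (Suc n))" for \<eta> U h h0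
  proof -
    obtain K where K: "K > 0" "\<And>\<alpha> \<beta> g W \<xi> t \<epsilon>. vekua_solution_on S f \<alpha> \<beta> (\<lambda>t. half_diag (g t)) W \<Longrightarrow>
      (\<xi>, t) \<in> tri S \<alpha> \<beta> \<Longrightarrow> \<xi> \<le> \<eta> \<Longrightarrow> (\<And>s. s \<in> {\<alpha>..\<beta>} \<Longrightarrow> norm (g s) \<le> \<epsilon>) \<Longrightarrow> norm (W \<xi> t) \<le> K * \<epsilon>"
      using half_diag_sup_bound[OF \<eta>] by metis
    have "uniformly_Cauchy_on (tri S \<alpha> \<beta> \<inter> {..\<eta>} \<times> UNIV) (\<lambda>n z. U n (fst z) (snd z))"
    proof (rule uniformly_Cauchy_onI)
      fix e :: real assume e: "e > 0"
      obtain M where M: "inverse (real (Suc M)) < e / (2 * K)"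
        using reals_Archimedean[of "e / (2 * K)"] e K(1) by auto
      have "dist (U m (fst z) (snd z)) (U n (fst z) (snd z)) < e"
        if z: "z \<in> tri S \<alpha> \<beta> \<inter> {..\<eta>} \<times> UNIV" and mn: "m \<ge> M" "n \<ge> M" for z m n
      proof -
        have "vekua_solution_on S f \<alpha> \<beta> (\<lambda>t. half_diag (h m t) - half_diag (h n t)) (\<lambda>\<xi> t. U m \<xi> t - U n \<xi> t)"
          by (rule solution_diff[OF U U])
        then have sol: "vekua_solution_on S f \<alpha> \<beta> (\<lambda>t. half_diag (h m t - h n t)) (\<lambda>\<xi> t. U m \<xi> t - U n \<xi> t)"
          by (simp add: half_diag_diff)
        have "norm (h m s - h n s) \<le> 2 * inverse (real (Suc M))" if s: "s \<in> {\<alpha>..\<beta>}" for s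
        proof -
          have i: "inverse (real (Suc k)) \<le> inverse (real (Suc M))" if "k \<ge> M" for k
            using that by (intro le_imp_inverse_le) auto
          have "norm (h m s - h n s) \<le> norm (h0 s - h n s) + norm (h0 s - h m s)"
            using norm_triangle_ineq4[of "h0 s - h n s" "h0 s - h m s"] by simp
          also have "\<dots> \<le> inverse (real (Suc M)) + inverse (real (Suc M))"
            using h[OF s, of n] h[OF s, of m] i[OF mn(1)] i[OF mn(2)] by linarith
          finally show ?thesis by simp
        qed
        then have "norm (U m (fst z) (snd z) - U n (fst z) (snd z)) \<le> K * (2 * inverse (real (Suc M)))"
          using K(2)[OF sol, of "fst z" "snd z"] z by auto
        also have "\<dots> < e" using M K(1) by (simp add: field_simps)
        finally show ?thesis by (simp add: dist_norm)
      qed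
      then show "\<exists>M. \<forall>z\<in>tri S \<alpha> \<beta> \<inter> {..\<eta>} \<times> UNIV. \<forall>m\<ge>M. \<forall>n\<ge>M. dist (U m (fst z) (snd z)) (U n (fst z) (snd z)) < e"
        by blast
    qed
    then show ?thesis
      using Cauchy_uniformly_convergent uniformly_convergent_uniform_limit_iff by blast
  qed
  have uV: "uniform_limit (tri S \<alpha> \<beta> \<inter> {..\<eta>} \<times> UNIV) (\<lambda>n z. V n (fst z) (snd z)) (\<lambda>z. W (fst z) (snd z)) sequentially"
    if "\<eta> \<in> S" for \<eta>
    unfolding W_def using G(1) by (rule conv[OF that V])
  have uV': "uniform_limit (tri S \<alpha> \<beta> \<inter> {..\<eta>} \<times> UNIV) (\<lambda>n z. V' n (fst z) (snd z)) (\<lambda>z. W' (fst z) (snd z)) sequentially"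
    if "\<eta> \<in> S" for \<eta>
    unfolding W'_def using G(2) by (rule conv[OF that V'])
  have lim: "(\<lambda>n. V n \<xi> t) \<longlonglongrightarrow> W \<xi> t" if "(\<xi>, t) \<in> tri S \<alpha> \<beta>" for \<xi> t
  proof -
    have "\<xi> \<in> S" using that by (simp add: mem_tri)
    from tendsto_uniform_limitI[OF uV[OF this], of "(\<xi>, t)"] that show ?thesis by simp
  qed
  have contW: "continuous_on (tri S \<alpha> \<beta>) (\<lambda>z. W (fst z) (snd z))"
    by (rule continuous_on_tri_local, rule uniform_limit_theorem[OF _ uV])
       (auto simp: V_def intro!: always_eventually poly_solution_continuous simp: tri_def)
  have contW': "continuous_on (tri S \<alpha> \<beta>) (\<lambda>z. W' (fst z) (snd z))"
    by (rule continuous_on_tri_local, rule uniform_limit_theorem[OF _ uV'])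
       (auto simp: V'_def intro!: always_eventually poly_solution_continuous simp: tri_def)
  have "vekua_solution_on S f \<alpha> \<beta> (\<lambda>t. half_diag (g t)) W"
    unfolding solution_iff
  proof (intro conjI exI[of _ W'] allI impI ballI)
    show "continuous_on (tri S \<alpha> \<beta>) (\<lambda>z. W (fst z) (snd z))" by (rule contW)
    show "continuous_on (tri_int S \<alpha> \<beta>) (\<lambda>z. W' (fst z) (snd z))"
      by (rule continuous_on_subset[OF contW' tri_int_subset])
    fix t assume t: "t \<in> {\<alpha>..\<beta>}"
    have "(\<lambda>n. poly (G n) (of_real t)) \<longlonglongrightarrow> g t"
    proof (rule LIM_zero_cancel, rule Lim_null_comparison)
      show "\<forall>\<^sub>F n in sequentially. norm (poly (G n) (of_real t) - g t) \<le> inverse (real (Suc n))"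
        using G(1)[OF t] by (intro always_eventually) (simp add: norm_minus_commute)
    qed (rule LIMSEQ_inverse_real_of_nat)
    then have "(\<lambda>n. half_diag (poly (G n) (of_real t))) \<longlonglongrightarrow> half_diag (g t)"
      unfolding half_diag_def by (intro tendsto_intros)
    moreover have "V n 0 t = half_diag (poly (G n) (of_real t))" for n
      using V[of n] t by (auto simp: vekua_solution_on_def)
    moreover have "(\<lambda>n. V n 0 t) \<longlonglongrightarrow> W 0 t"
      by (rule lim) (use t zero_S in \<open>auto simp: mem_tri\<close>)
    ultimately show "W 0 t = half_diag (g t)" using LIMSEQ_unique by simp
  next
    fix \<xi> t assume pt: "(\<xi>, t) \<in> tri_int S \<alpha> \<beta>"
    then have \<xi>: "\<xi> \<in> S" "0 < \<xi>" "\<alpha> < t - \<xi>" "t + \<xi> < \<beta>" by (auto simp: mem_tri_int)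
    show "(W \<xi> has_vector_derivative W' \<xi> t) (at t)"
    proof (rule has_vector_derivative_uniform_limit)
      let ?I = "{\<alpha> + \<xi><..<\<beta> - \<xi>}"
      show "open ?I" "convex ?I" "t \<in> ?I" using \<xi> by auto
      show "(V n \<xi> has_vector_derivative V' n \<xi> x) (at x)" for n x
        unfolding V_def V'_def by (rule poly_solution_t_derivative)
      have sub: "x \<in> ?I \<Longrightarrow> (\<xi>, x) \<in> tri S \<alpha> \<beta> \<inter> {..\<xi>} \<times> UNIV" for x
        using \<xi> by (auto simp: mem_tri)
      show "(\<lambda>n. V n \<xi> x) \<longlonglongrightarrow> W \<xi> x" if "x \<in> ?I" for x
        by (rule lim) (use sub[OF that] in blast)
      show "uniform_limit ?I (\<lambda>n. V' n \<xi>) (W' \<xi>) sequentially"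
      proof (rule uniform_limitI)
        fix e :: real assume "e > 0"
        from uniform_limitD[OF uV'[OF \<xi>(1)] this]
        show "\<forall>\<^sub>F n in sequentially. \<forall>x\<in>?I. dist (V' n \<xi> x) (W' \<xi> x) < e"
        proof eventually_elim
          case (elim n)
          show ?case
          proof
            fix x assume "x \<in> ?I"
            from bspec[OF elim sub[OF this]] show "dist (V' n \<xi> x) (W' \<xi> x) < e" by simp
          qed
        qed
      qed
    qed
    \<comment> \<open>A point beyond \<xi> gives a neighbourhood of \<xi> on which q is bounded and
      the convergence is uniform.\<close>
    obtain \<eta> where \<eta>: "\<eta> \<in> S" "\<xi> < \<eta>" using S_open \<xi>(1) by blast
    obtain Q where Q: "Q \<ge> 0" "\<And>s. s \<in> {0..\<eta>} \<Longrightarrow> \<bar>q s\<bar> \<le> Q" using q_bounded[OF \<eta>(1)] by metis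
    show "((\<lambda>s. W s t) has_vector_derivative \<xi>_slope \<xi> (W \<xi> t) (W' \<xi> t)) (at \<xi>)"
    proof (rule has_vector_derivative_uniform_limit[where F = "\<lambda>n s. V n s t" and F' = "\<lambda>n s. \<xi>_slope s (V n s t) (V' n s t)"
          and G' = "\<lambda>s. \<xi>_slope s (W s t) (W' s t)"])
      let ?I = "{0<..<min \<eta> (min (t - \<alpha>) (\<beta> - t))}"
      show "open ?I" "convex ?I" "\<xi> \<in> ?I" using \<xi> \<eta> by auto
      have S: "s \<in> S" "0 < s" "s \<in> {0..\<eta>}" if "s \<in> ?I" for s
        using S_down[OF \<eta>(1), of s] that by auto
      have sub: "(s, t) \<in> tri S \<alpha> \<beta> \<inter> {..\<eta>} \<times> UNIV" if "s \<in> ?I" for s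
        using that S[OF that] by (auto simp: mem_tri)
      show "((\<lambda>s. V n s t) has_vector_derivative \<xi>_slope s (V n s t) (V' n s t)) (at s)" if "s \<in> ?I" for n s
        unfolding V_def V'_def by (rule poly_solution_s_derivative) (use S[OF that] in auto)
      show "(\<lambda>n. V n s t) \<longlonglongrightarrow> W s t" if "s \<in> ?I" for s
        by (rule lim) (use sub[OF that] in blast)
      show "uniform_limit ?I (\<lambda>n s. \<xi>_slope s (V n s t) (V' n s t)) (\<lambda>s. \<xi>_slope s (W s t) (W' s t)) sequentially"
      proof (rule uniform_limitI)
        fix e :: real assume e: "e > 0"
        \<comment> \<open>\<open>slope_bound\<close> turns an error d into d (2Q + 2); the 3 makes
          the result strictly smaller than e.\<close>
        define d where "d = e / (2 * Q + 3)"
        have d0: "d > 0" using e Q(1) by (auto simp: d_def)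
        have "d * (2 * Q + 3) = e" using Q(1) by (simp add: d_def)
        then have d: "d > 0" "2 * d + 2 * Q * d < e" using d0 by (auto simp: algebra_simps)
        from uniform_limitD[OF uV[OF \<eta>(1)] d(1)] uniform_limitD[OF uV'[OF \<eta>(1)] d(1)]
        show "\<forall>\<^sub>F n in sequentially. \<forall>s\<in>?I. dist (\<xi>_slope s (V n s t) (V' n s t)) (\<xi>_slope s (W s t) (W' s t)) < e"
        proof eventually_elim
          case (elim n)
          show ?case
          proof
            fix s assume s: "s \<in> ?I"
            have a: "norm (V n s t - W s t) \<le> d" "norm (V' n s t - W' s t) \<le> d"
              using bspec[OF elim(1) sub[OF s]] bspec[OF elim(2) sub[OF s]] by (auto simp: dist_norm)
            have "dist (\<xi>_slope s (V n s t) (V' n s t)) (\<xi>_slope s (W s t) (W' s t)) =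
                norm (\<xi>_slope s (V n s t - W s t) (V' n s t - W' s t))"
              by (simp add: dist_norm \<xi>_slope_def algebra_simps)
            also have "\<dots> \<le> 2 * norm (V' n s t - W' s t) + 2 * Q * norm (V n s t - W s t)"
              by (rule slope_bound[OF Q(2)[OF S(3)[OF s]]])
            also have "\<dots> \<le> 2 * d + 2 * Q * d"
              using a Q(1) by (intro add_mono mult_left_mono) auto
            finally show "dist (\<xi>_slope s (V n s t) (V' n s t)) (\<xi>_slope s (W s t) (W' s t)) < e"
              using d by simp
          qed
        qed
      qed
    qed
  qed
  then show ?thesis by blast
qed

end

section \<open>The series representation\<close>

text \<open>The polynomial P_n(x/\<xi>), written in monomials because its coefficients are the
  weights of \<phi>_k and \<psi>_k in a_n and b_n.\<close>

definition legendre_scaled :: "real \<Rightarrow> nat \<Rightarrow> complex poly" where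
  "legendre_scaled \<xi> n = (\<Sum>k\<le>n. monom (of_real (coeff (legendre n) k / \<xi> ^ k)) k)"

lemma poly_legendre_scaled: "poly (legendre_scaled \<xi> n) (of_real \<tau>) = of_real (Leg n (\<tau> / \<xi>))"
proof -
  have "Leg n x = (\<Sum>k\<le>n. coeff (legendre n) k * x ^ k)" for x
    unfolding poly_altdef
    by (rule sum.mono_neutral_left) (use legendre_degree[of n] in \<open>auto simp: coeff_eq_0 not_le\<close>)
  then show ?thesis
    by (simp add: legendre_scaled_def poly_sum poly_monom power_divide)
qed

lemma coeff_legendre_scaled:
  "coeff (legendre_scaled \<xi> n) k = of_real (coeff (legendre n) k / \<xi> ^ k)"
proof (cases "k \<le> n")
  case True
  then show ?thesis unfolding legendre_scaled_def by (rule coeff_sum_monom)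
next
  case False
  then show ?thesis
    using legendre_degree[of n] by (simp add: legendre_scaled_def coeff_sum coeff_eq_0 sum.neutral)
qed

lemma degree_legendre_scaled: "degree (legendre_scaled \<xi> n) \<le> n"
  unfolding legendre_scaled_def by (rule degree_sum_le) (auto intro: order.trans[OF degree_monom_le])

lemma bounded_linear_bc: "bounded_linear bc_plus" "bounded_linear bc_minus"
  unfolding bc_plus_def bc_minus_def bc_R_def bc_I_def
  by (intro bounded_linear_add bounded_linear_sub bounded_linear_fst bounded_linear_snd)+

text \<open>The idempotent decomposition of w: conjugation turns z P^+ into z P^-.\<close>

lemma half_diag_plus_minus: "half_diag (bc_plus w) + bc_conj (half_diag (bc_minus w)) = w"
  by (simp add: half_diag_def bc_conj_def bc_plus_def bc_minus_def bc_R_def bc_I_def prod_eq_iff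
      scaleR_conv_of_real field_simps)

context vekua_coefficient
begin

text \<open>Let G_N be the N-th Legendre partial sum of g on [-\<xi>,\<xi>]. By linearity, the
  doubled polynomial solution with data G_N, taken at (\<xi>,0) and diminished by G_N(\<xi>), is the
  N-th partial sum of the series. \<open>half_diag_bound\<close> applied to the difference of
  solutions bounds the distance to the claimed sum by a multiple of the L1 error of G_N.\<close>

lemma expansion_half_diag:
  assumes \<xi>: "\<xi> \<in> S" "0 < \<xi>"
    and sol: "vekua_solution_on S f (-\<xi>) \<xi> (\<lambda>t. half_diag (g t)) W"
  defines "I \<equiv> \<lambda>n. integral {-\<xi>..\<xi>} (\<lambda>\<tau>. complex_of_real (poly (legendre n) (\<tau> / \<xi>)) * g \<tau>)"
  shows "(\<lambda>n. complex_of_real (acoef f n \<xi> / \<xi>) * I n) sums (2 * fst (W \<xi> 0) - g \<xi>)"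
    and "(\<lambda>n. complex_of_real (bcoef f n \<xi> / \<xi>) * I n) sums (2 * snd (W \<xi> 0) - g \<xi>)"
proof -
  have gc: "continuous_on {-\<xi>..\<xi>} g"
  proof -
    have "continuous_on {-\<xi>..\<xi>} (\<lambda>t. bc_plus (half_diag (g t)))"
      by (intro bounded_linear.continuous_on[OF bounded_linear_bc(1)] data_continuous[OF sol])
    then show ?thesis by simp
  qed
  define c where "c n = of_real ((2 * real n + 1) / (2 * \<xi>)) * I n" for n
  define G where "G N = (\<Sum>n<N. smult (c n) (legendre_scaled \<xi> n))" for N
  define r where "r N = integral {-\<xi>..\<xi>} (\<lambda>\<tau>. norm (g \<tau> - poly (G N) (of_real \<tau>)))" for N
  have pG: "poly (G N) (of_real \<tau>) = (\<Sum>n<N. c n * of_real (Leg n (\<tau> / \<xi>)))" for N \<tau>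
    by (simp add: G_def poly_sum poly_legendre_scaled)
  have r: "r \<longlonglongrightarrow> 0"
    using legendre_L1_convergence_complex[OF \<xi>(2) gc] unfolding r_def pG c_def I_def .
  obtain Q where Q: "Q \<ge> 0" "\<And>s. s \<in> {0..\<xi>} \<Longrightarrow> \<bar>q s\<bar> \<le> Q" using q_bounded[OF \<xi>(1)] by metis
  define k where "k = 4 * Q * exp ((2 * Q + 1) * \<xi>)"
  have deg: "degree (G N) < Suc N" for N
    unfolding G_def less_Suc_eq_le
    by (intro degree_sum_le) (auto intro: order.trans[OF degree_smult_le] order.trans[OF degree_legendre_scaled])
  have pt: "(\<xi>, 0) \<in> tri S (-\<xi>) \<xi>" using \<xi> by (simp add: mem_tri)
  define U where "U N = poly_solution (Suc N) (G N) \<xi> 0" for N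
  have diff: "vekua_solution_on S f (-\<xi>) \<xi> (\<lambda>t. half_diag (g t - poly (G N) (of_real t)))
      (\<lambda>\<xi> t. W \<xi> t - poly_solution (Suc N) (G N) \<xi> t)" for N
    using solution_diff[OF sol poly_solution[OF deg[of N], folded half_diag_def]]
    by (simp only: half_diag_diff)
  note bound = half_diag_bound[OF diff pt Q, simplified, folded U_def r_def]
  have lim1: "(\<lambda>N. 2 * (fst (W \<xi> 0) - fst (U N)) - (g \<xi> - poly (G N) (of_real \<xi>))) \<longlonglongrightarrow> 0"
  proof (rule Lim_null_comparison)
    show "\<forall>\<^sub>F N in sequentially. norm (2 * (fst (W \<xi> 0) - fst (U N)) - (g \<xi> - poly (G N) (of_real \<xi>))) \<le> k * r N"
      using bound(1) by (intro always_eventually) (simp add: k_def mult_ac)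
    show "(\<lambda>N. k * r N) \<longlonglongrightarrow> 0" using tendsto_mult_right_zero[OF r] .
  qed
  have lim2: "(\<lambda>N. 2 * (snd (W \<xi> 0) - snd (U N)) - (g \<xi> - poly (G N) (of_real \<xi>))) \<longlonglongrightarrow> 0"
  proof (rule Lim_null_comparison)
    show "\<forall>\<^sub>F N in sequentially. norm (2 * (snd (W \<xi> 0) - snd (U N)) - (g \<xi> - poly (G N) (of_real \<xi>))) \<le> k * r N"
      using bound(2) by (intro always_eventually) (simp add: k_def mult_ac)
    show "(\<lambda>N. k * r N) \<longlonglongrightarrow> 0" using tendsto_mult_right_zero[OF r] .
  qed
  \<comment> \<open>All P_n equal 1 at the right endpoint, so the endpoint value is the plain sum of
    the coefficients; this produces the -1 in a_n and b_n.\<close>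
  have G1: "poly (G N) (of_real \<xi>) = (\<Sum>n<N. c n)" for N
    unfolding pG using \<xi> by simp
  \<comment> \<open>Kept for an arbitrary family X, to be used with \<phi> for the first component
    and with \<psi> for the second.\<close>
  have partial: "(\<Sum>j<Suc N. (X j \<xi>) *\<^sub>R coeff (G N) j) - poly (G N) (of_real \<xi>) =
      (\<Sum>n<N. complex_of_real ((2 * real n + 1) / 2 * ((\<Sum>k\<le>n. coeff (legendre n) k * X k \<xi> / \<xi> ^ k) - 1) / \<xi>) * I n)"
    for N and X :: "nat \<Rightarrow> real \<Rightarrow> real"
  proof -
    have inner: "(\<Sum>j<Suc N. X j \<xi> *\<^sub>R coeff (legendre_scaled \<xi> n) j) =
        of_real (\<Sum>k\<le>n. coeff (legendre n) k * X k \<xi> / \<xi> ^ k)" if "n < N" for n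
    proof -
      have "(\<Sum>j<Suc N. X j \<xi> *\<^sub>R coeff (legendre_scaled \<xi> n) j) =
          (\<Sum>j<Suc N. complex_of_real (coeff (legendre n) j * X j \<xi> / \<xi> ^ j))"
        by (simp add: coeff_legendre_scaled scaleR_conv_of_real mult.commute)
      also have "\<dots> = (\<Sum>j\<le>n. complex_of_real (coeff (legendre n) j * X j \<xi> / \<xi> ^ j))"
        by (rule sum.mono_neutral_right) (use that legendre_degree[of n] in \<open>auto simp: coeff_eq_0\<close>)
      finally show ?thesis by simp
    qed
    have "(\<Sum>j<Suc N. X j \<xi> *\<^sub>R coeff (G N) j) = (\<Sum>j<Suc N. \<Sum>n<N. c n * (X j \<xi> *\<^sub>R coeff (legendre_scaled \<xi> n) j))"
      by (simp add: G_def coeff_sum scaleR_sum_right)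
    also have "\<dots> = (\<Sum>n<N. c n * (\<Sum>j<Suc N. X j \<xi> *\<^sub>R coeff (legendre_scaled \<xi> n) j))"
      by (subst sum.swap) (simp only: sum_distrib_left)
    also have "\<dots> = (\<Sum>n<N. c n * of_real (\<Sum>k\<le>n. coeff (legendre n) k * X k \<xi> / \<xi> ^ k))"
      by (intro sum.cong refl arg_cong2[where f = "(*)"] inner) auto
    finally have "(\<Sum>j<Suc N. X j \<xi> *\<^sub>R coeff (G N) j) - poly (G N) (of_real \<xi>) =
        (\<Sum>n<N. c n * of_real (\<Sum>k\<le>n. coeff (legendre n) k * X k \<xi> / \<xi> ^ k) - c n)"
      by (simp only: G1 sum_subtractf)
    also have "\<dots> = (\<Sum>n<N. complex_of_real ((2 * real n + 1) / 2 * ((\<Sum>k\<le>n. coeff (legendre n) k * X k \<xi> / \<xi> ^ k) - 1) / \<xi>) * I n)"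
    proof (rule sum.cong[OF refl])
      fix n
      define s where "s = (\<Sum>k\<le>n. coeff (legendre n) k * X k \<xi> / \<xi> ^ k)"
      define \<kappa> where "\<kappa> = complex_of_real ((2 * real n + 1) / (2 * \<xi>))"
      have "complex_of_real ((2 * real n + 1) / 2 * (s - 1) / \<xi>) = \<kappa> * (of_real s - 1)"
        by (simp add: \<kappa>_def field_simps)
      moreover have "c n = \<kappa> * I n" by (simp add: c_def \<kappa>_def)
      ultimately show "c n * of_real (\<Sum>k\<le>n. coeff (legendre n) k * X k \<xi> / \<xi> ^ k) - c n =
        complex_of_real ((2 * real n + 1) / 2 * ((\<Sum>k\<le>n. coeff (legendre n) k * X k \<xi> / \<xi> ^ k) - 1) / \<xi>) * I n"
        unfolding s_def[symmetric] by (simp only:) (simp add: algebra_simps)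
    qed
    finally show ?thesis .
  qed
  have U: "2 * fst (U N) = (\<Sum>j<Suc N. phi f j \<xi> *\<^sub>R coeff (G N) j)"
    "2 * snd (U N) = (\<Sum>j<Suc N. psi f j \<xi> *\<^sub>R coeff (G N) j)" for N
    unfolding U_def poly_solution_at_center by (simp_all add: scaleR_conv_of_real)
  \<comment> \<open>The partial sum is the claimed value minus exactly the quantity shown to tend to
    0 in \<open>lim1\<close>.\<close>
  have e1: "(\<Sum>n<N. complex_of_real (acoef f n \<xi> / \<xi>) * I n) =
      (2 * fst (W \<xi> 0) - g \<xi>) - (2 * (fst (W \<xi> 0) - fst (U N)) - (g \<xi> - poly (G N) (of_real \<xi>)))" for N
    using partial[of "\<lambda>j. phi f j" N] unfolding U[symmetric] acoef_def by (simp add: algebra_simps)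
  have e2: "(\<Sum>n<N. complex_of_real (bcoef f n \<xi> / \<xi>) * I n) =
      (2 * snd (W \<xi> 0) - g \<xi>) - (2 * (snd (W \<xi> 0) - snd (U N)) - (g \<xi> - poly (G N) (of_real \<xi>)))" for N
    using partial[of "\<lambda>j. psi f j" N] unfolding U[symmetric] bcoef_def by (simp add: algebra_simps)
  show "(\<lambda>n. complex_of_real (acoef f n \<xi> / \<xi>) * I n) sums (2 * fst (W \<xi> 0) - g \<xi>)"
    unfolding sums_def e1 using tendsto_diff[OF tendsto_const[of "2 * fst (W \<xi> 0) - g \<xi>"] lim1] by (simp only: diff_zero)
  show "(\<lambda>n. complex_of_real (bcoef f n \<xi> / \<xi>) * I n) sums (2 * snd (W \<xi> 0) - g \<xi>)"
    unfolding sums_def e2 using tendsto_diff[OF tendsto_const[of "2 * snd (W \<xi> 0) - g \<xi>"] lim2] by (simp only: diff_zero)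
qed

theorem solution_exists:
  assumes W0: "C1_on {\<alpha>..\<beta>} W0"
  shows "\<exists>W. vekua_solution_on S f \<alpha> \<beta> W0 W"
proof -
  \<comment> \<open>The reflection of t about the midpoint maps [\<alpha>,\<beta>] onto itself and
    carries the minus part of the data to the plus part.\<close>
  define c where "c = \<alpha> + \<beta>"
  have "C1_on {\<alpha>..\<beta>} (\<lambda>t. bc_plus (W0 t))"
    by (rule C1_on_bounded_linear[OF bounded_linear_bc(1) W0])
  then obtain V where V: "vekua_solution_on S f \<alpha> \<beta> (\<lambda>t. half_diag (bc_plus (W0 t))) V"
    using solution_exists_half_diag by blast
  have "C1_on {\<alpha>..\<beta>} (\<lambda>t. bc_minus (W0 (c + (-1) * t)))"
    by (rule C1_on_affine[OF C1_on_bounded_linear[OF bounded_linear_bc(2) W0]]) (auto simp: c_def)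
  then obtain U where "vekua_solution_on S f \<alpha> \<beta> (\<lambda>t. half_diag (bc_minus (W0 (c + (-1) * t)))) U"
    using solution_exists_half_diag by blast
  from solution_affine(2)[OF this, of c]
  have "vekua_solution_on S f \<alpha> \<beta> (\<lambda>t. bc_conj (half_diag (bc_minus (W0 t)))) (\<lambda>\<xi> t. bc_conj (U \<xi> (c - t)))"
    by (simp add: c_def)
  from solution_add[OF V this] show ?thesis
    unfolding half_diag_plus_minus by blast
qed

text \<open>Translation moves the point to (\<xi>,0), the place where
  \<open>expansion_half_diag\<close> evaluates. There W splits by uniqueness into a solution for the
  plus part and the reflected conjugate of one for the minus part. The conjugation accounts for the
  minus signs in front of b_n and the reflection for the arguments t - \<tau>.\<close>

theorem solution_formula:
  assumes W0: "C1_on {\<alpha>..\<beta>} W0" and sol: "vekua_solution_on S f \<alpha> \<beta> W0 W"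
    and pt: "(\<xi>, t) \<in> tri S \<alpha> \<beta>" "0 < \<xi>"
  shows "summable (termA1 f W0 \<xi> t) \<and> summable (termB1 f W0 \<xi> t) \<and>
         summable (termA2 f W0 \<xi> t) \<and> summable (termB2 f W0 \<xi> t) \<and>
         W \<xi> t = vekua_formula1 f W0 \<xi> t \<and> W \<xi> t = vekua_formula2 f W0 \<xi> t"
proof -
  have \<xi>: "\<xi> \<in> S" "\<alpha> \<le> t - \<xi>" "t + \<xi> \<le> \<beta>" using pt by (auto simp: mem_tri)
  define g where "g \<tau> = bc_plus (W0 (t + \<tau>))" for \<tau>
  define h where "h \<tau> = bc_minus (W0 (t - \<tau>))" for \<tau>
  have C1g: "C1_on {-\<xi>..\<xi>} g"
    using C1_on_affine[OF C1_on_bounded_linear[OF bounded_linear_bc(1) W0], of "{-\<xi>..\<xi>}" t 1] \<xi>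
    by (simp add: g_def[abs_def])
  have C1h: "C1_on {-\<xi>..\<xi>} h"
    using C1_on_affine[OF C1_on_bounded_linear[OF bounded_linear_bc(2) W0], of "{-\<xi>..\<xi>}" t "-1"] \<xi>
    by (simp add: h_def[abs_def])
  obtain V where V: "vekua_solution_on S f (-\<xi>) \<xi> (\<lambda>t. half_diag (g t)) V"
    using solution_exists_half_diag[OF C1g] by blast
  obtain U where U: "vekua_solution_on S f (-\<xi>) \<xi> (\<lambda>t. half_diag (h t)) U"
    using solution_exists_half_diag[OF C1h] by blast
  have Wt: "W \<xi> t = V \<xi> 0 + bc_conj (U \<xi> 0)"
  proof -
    have U': "vekua_solution_on S f (-\<xi>) \<xi> (\<lambda>t. bc_conj (half_diag (h (0 - t)))) (\<lambda>\<xi> t. bc_conj (U \<xi> (0 - t)))"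
      using solution_affine(2)[OF U, of 0] by simp
    have "vekua_solution_on S f (-\<xi>) \<xi> (\<lambda>s. W0 (s + t)) (\<lambda>\<xi> s. W \<xi> (s + t))"
      by (rule solution_restrict[OF solution_affine(1)[OF sol, of t]]) (use \<xi> in auto)
    moreover have "half_diag (g s) + bc_conj (half_diag (h (0 - s))) = W0 (s + t)" for s
      by (simp add: g_def h_def half_diag_plus_minus add.commute)
    with solution_add[OF V U'] have "vekua_solution_on S f (-\<xi>) \<xi> (\<lambda>s. W0 (s + t)) (\<lambda>\<xi> t. V \<xi> t + bc_conj (U \<xi> (0 - t)))"
      by simp
    ultimately have "W \<xi> (0 + t) = V \<xi> 0 + bc_conj (U \<xi> (0 - 0))"
      by (rule solution_unique) (use \<xi> pt(2) in \<open>simp add: mem_tri\<close>)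
    then show ?thesis by simp
  qed
  define J where "J e n = integral {-\<xi>..\<xi>} (\<lambda>\<tau>. complex_of_real (poly (legendre n) (\<tau> / \<xi>)) * e \<tau>)" for e n
  note sg = expansion_half_diag[OF \<xi>(1) pt(2) V, folded J_def]
  note sh = expansion_half_diag[OF \<xi>(1) pt(2) U, folded J_def]
  have cont: "continuous_on {-\<xi>..\<xi>} g" "continuous_on {-\<xi>..\<xi>} h"
    using C1g C1h unfolding C1_on_def continuous_on_eq_continuous_within
    by (auto intro: has_vector_derivative_continuous)
  have int: "(\<lambda>\<tau>. complex_of_real (poly (legendre n) (\<tau> / \<xi>)) * e \<tau>) integrable_on {-\<xi>..\<xi>}"
    if "continuous_on {-\<xi>..\<xi>} e" for e n
    by (intro integrable_continuous_real continuous_intros that) (use pt(2) in auto)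
  have A1: "termA1 f W0 \<xi> t n = of_real (acoef f n \<xi> / \<xi>) * J g n + of_real (acoef f n \<xi> / \<xi>) * J h n" for n
    unfolding termA1_def J_def g_def[symmetric] h_def[symmetric] distrib_left
    by (simp only: Henstock_Kurzweil_Integration.integral_add[OF int[OF cont(1)] int[OF cont(2)]] distrib_left)
  have B1: "termB1 f W0 \<xi> t n = of_real (bcoef f n \<xi> / \<xi>) * J g n - of_real (bcoef f n \<xi> / \<xi>) * J h n" for n
    unfolding termB1_def J_def g_def[symmetric] h_def[symmetric] right_diff_distrib
    by (simp only: Henstock_Kurzweil_Integration.integral_diff[OF int[OF cont(1)] int[OF cont(2)]] right_diff_distrib)
  \<comment> \<open>The second formula carries 1/(2\<xi>) outside the sum, so its terms are \<xi>
    times the pairs whose sums are known.\<close>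
  have A2: "termA2 f W0 \<xi> t n = \<xi> *\<^sub>R (of_real (acoef f n \<xi> / \<xi>) * J g n, of_real (bcoef f n \<xi> / \<xi>) * J g n)" for n
    unfolding termA2_def J_def g_def[symmetric]
    using pt(2) by (simp add: bc_mult_def bc_of_complex_def bc_j_def scaleR_conv_of_real)
  have B2: "termB2 f W0 \<xi> t n = \<xi> *\<^sub>R (of_real (acoef f n \<xi> / \<xi>) * J h n, - (of_real (bcoef f n \<xi> / \<xi>) * J h n))" for n
    unfolding termB2_def J_def h_def[symmetric]
    using pt(2) by (simp add: bc_mult_def bc_of_complex_def bc_j_def scaleR_conv_of_real)
  have sumsPair: "(\<lambda>n. (x n, y n)) sums (a, b)" if "x sums a" "y sums b" for x y :: "nat \<Rightarrow> complex" and a b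
  proof -
    have "(\<lambda>N. (\<Sum>n<N. x n, \<Sum>n<N. y n)) \<longlonglongrightarrow> (a, b)"
      using that unfolding sums_def by (rule tendsto_Pair)
    moreover have "(\<Sum>n<N. (x n, y n)) = (\<Sum>n<N. x n, \<Sum>n<N. y n)" for N
      by (simp add: prod_eq_iff fst_sum snd_sum)
    ultimately show ?thesis by (simp add: sums_def)
  qed
  have sA1: "termA1 f W0 \<xi> t sums ((2 * fst (V \<xi> 0) - g \<xi>) + (2 * fst (U \<xi> 0) - h \<xi>))"
    unfolding A1[abs_def] by (rule sums_add[OF sg(1) sh(1)])
  have sB1: "termB1 f W0 \<xi> t sums ((2 * snd (V \<xi> 0) - g \<xi>) - (2 * snd (U \<xi> 0) - h \<xi>))"
    unfolding B1[abs_def] by (rule sums_diff[OF sg(2) sh(2)])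
  have sA2: "termA2 f W0 \<xi> t sums (\<xi> *\<^sub>R (2 * fst (V \<xi> 0) - g \<xi>, 2 * snd (V \<xi> 0) - g \<xi>))"
    unfolding A2[abs_def] by (rule sums_scaleR_right[OF sumsPair[OF sg]])
  have sB2: "termB2 f W0 \<xi> t sums (\<xi> *\<^sub>R (2 * fst (U \<xi> 0) - h \<xi>, - (2 * snd (U \<xi> 0) - h \<xi>)))"
    unfolding B2[abs_def] by (rule sums_scaleR_right[OF sumsPair[OF sh(1) sums_minus[OF sh(2)]]])
  have "vekua_formula1 f W0 \<xi> t = W \<xi> t"
    unfolding vekua_formula1_def sums_unique[OF sA1, symmetric] sums_unique[OF sB1, symmetric] g_def[symmetric] h_def[symmetric] Wt
    by (simp add: bc_mult_def bc_of_complex_def bc_j_def bc_conj_def prod_eq_iff field_simps)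
  moreover have "vekua_formula2 f W0 \<xi> t = W \<xi> t"
    unfolding vekua_formula2_def sums_unique[OF sA2, symmetric] sums_unique[OF sB2, symmetric] g_def[symmetric] h_def[symmetric] Wt
    using pt(2)
    by (simp add: bc_Pp_def bc_Pm_def bc_mult_def bc_of_complex_def bc_j_def bc_conj_def prod_eq_iff scaleR_conv_of_real algebra_simps)
  ultimately show ?thesis
    using sA1 sB1 sA2 sB2 by (simp add: sums_iff)
qed

end

section \<open>The Maxwell system\<close>

lemma half_open_interval_nonneg: "half_open_interval {0..}"
proof
  show "\<exists>\<eta>\<in>{0..}. \<xi> < \<eta>" if "\<xi> \<in> {0..}" for \<xi> :: real
    by (rule bexI[of _ "\<xi> + 1"]) (use that in auto)
qed auto

locale maxwell_medium =
  fixes \<epsilon> \<epsilon>' :: "real \<Rightarrow> real" and \<mu> :: real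
  assumes cont_\<epsilon>': "continuous_on {0..} \<epsilon>'"
    and deriv_\<epsilon>: "0 \<le> x \<Longrightarrow> (\<epsilon> has_real_derivative \<epsilon>' x) (at x within {0..})"
    and \<epsilon>_pos: "0 \<le> x \<Longrightarrow> 0 < \<epsilon> x" and \<mu>_pos: "0 < \<mu>"
begin

abbreviation xi :: "real \<Rightarrow> real" where "xi \<equiv> xi_of \<epsilon> \<mu>"
abbreviation x_inv :: "real \<Rightarrow> real" where "x_inv \<equiv> x_of \<epsilon> \<mu>"
abbreviation c :: "real \<Rightarrow> real" where "c \<equiv> c_of \<epsilon> \<mu>"
abbreviation \<Xi> :: "real set" where "\<Xi> \<equiv> xi ` {0..}"

lemma cont_\<epsilon>: "continuous_on {0..} \<epsilon>"
  using deriv_\<epsilon> by (intro DERIV_continuous_on) auto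

lemma deriv_\<epsilon>_at: assumes "0 < x" shows "(\<epsilon> has_real_derivative \<epsilon>' x) (at x)"
proof -
  have "(\<epsilon> has_real_derivative \<epsilon>' x) (at x within {0<..})"
    by (rule has_field_derivative_subset[OF deriv_\<epsilon>]) (use assms in auto)
  then show ?thesis using assms at_within_open[of x "{0<..}"] by simp
qed

lemma c_pos: "0 \<le> x \<Longrightarrow> 0 < c x"
  using \<epsilon>_pos \<mu>_pos by (simp add: c_of_def)

lemma xi_0: "xi 0 = 0"
  by (simp add: xi_of_def)

lemma cont_xi: "continuous_on {0..} xi"
proof -
  interpret half_open_interval "{0..}" by (rule half_open_interval_nonneg)
  show ?thesis
    unfolding xi_of_def[abs_def]
    by (intro continuous_intros indefinite_integral(1) cont_\<epsilon>)
qed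

lemma deriv_xi: assumes "0 < x" shows "(xi has_real_derivative inverse (c x)) (at x)"
proof -
  interpret half_open_interval "{0..}" by (rule half_open_interval_nonneg)
  have "continuous_on {0..} (\<lambda>s. sqrt (\<epsilon> s))" by (intro continuous_intros cont_\<epsilon>)
  from DERIV_cmult[OF indefinite_integral(2)[OF this, of x], of "sqrt \<mu>"] assms
  show ?thesis
    by (simp add: xi_of_def[abs_def] c_of_def real_sqrt_mult mult.commute)
qed

lemma xi_strict_mono: assumes "0 \<le> x" "x < y" shows "xi x < xi y"
proof (rule DERIV_pos_imp_increasing_open[OF assms(2)])
  show "\<exists>d. (xi has_real_derivative d) (at z) \<and> 0 < d" if "x < z" "z < y" for z
    using deriv_xi[of z] c_pos[of z] assms that by (intro exI[of _ "inverse (c z)"]) auto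
  show "continuous_on {x..y} xi"
    by (rule continuous_on_subset[OF cont_xi]) (use assms in auto)
qed

lemma xi_inj: "0 \<le> x \<Longrightarrow> 0 \<le> y \<Longrightarrow> xi x = xi y \<Longrightarrow> x = y"
  using xi_strict_mono[of x y] xi_strict_mono[of y x] by (cases x y rule: linorder_cases) auto

lemma xi_nonneg: "0 \<le> x \<Longrightarrow> 0 \<le> xi x"
  using xi_strict_mono[of 0 x] xi_0 by (cases "x = 0") auto

lemma xi_pos: "0 < x \<Longrightarrow> 0 < xi x"
  using xi_strict_mono[of 0 x] xi_0 by auto

lemma x_inv_xi: "0 \<le> x \<Longrightarrow> x_inv (xi x) = x"
  unfolding x_of_def by (rule the_equality) (auto intro: xi_inj)

lemma xi_x_inv: "s \<in> \<Xi> \<Longrightarrow> xi (x_inv s) = s \<and> 0 \<le> x_inv s"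
  using x_inv_xi by auto

lemma x_inv_pos: "s \<in> \<Xi> \<Longrightarrow> 0 < s \<Longrightarrow> 0 < x_inv s"
  using xi_x_inv[of s] xi_0 by (cases "x_inv s = 0") auto

lemma xi_image_Icc: assumes "0 \<le> x" shows "xi ` {0..x} = {0..xi x}"
proof
  show "xi ` {0..x} \<subseteq> {0..xi x}"
    using xi_nonneg xi_strict_mono by (force simp: order_le_less)
  show "{0..xi x} \<subseteq> xi ` {0..x}"
  proof
    fix s assume "s \<in> {0..xi x}"
    then have "\<exists>y\<ge>0. y \<le> x \<and> xi y = s"
      using IVT'[of xi 0 s x] continuous_on_subset[OF cont_xi, of "{0..x}"] assms xi_0 by auto
    then show "s \<in> xi ` {0..x}" by auto
  qed
qed

text \<open>As \<xi>(x) is continuous, strictly increasing and zero at x = 0, its range is an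
  interval starting at 0 without a last point, bounded or not.\<close>

sublocale half_open_interval \<Xi>
proof
  show "0 \<in> \<Xi>" using xi_0 by force
  show "0 \<le> s" if "s \<in> \<Xi>" for s using that xi_nonneg by auto
  show "r \<in> \<Xi>" if "s \<in> \<Xi>" "0 \<le> r" "r \<le> s" for s r
  proof -
    from that(1) obtain x where "s = xi x" "x \<in> {0..}" by (rule imageE)
    then have "r \<in> xi ` {0..x}" using xi_image_Icc[of x] that by auto
    then show ?thesis by auto
  qed
  show "\<exists>r\<in>\<Xi>. s < r" if "s \<in> \<Xi>" for s
  proof -
    from that obtain x where "s = xi x" "x \<in> {0..}" by (rule imageE)
    then show ?thesis using xi_strict_mono[of x "x + 1"] by (intro bexI[of _ "xi (x + 1)"]) auto
  qed
qed

section \<open>The inverse change of variable and the coefficient f\<close>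

lemma cont_x_inv: "continuous_on \<Xi> x_inv"
proof (rule continuous_on_S_local)
  fix \<eta> assume "\<eta> \<in> \<Xi>"
  then obtain x where x: "0 \<le> x" "\<eta> = xi x" by auto
  have "continuous_on (xi ` {0..x}) x_inv"
    by (rule continuous_on_inv) (use x_inv_xi continuous_on_subset[OF cont_xi] in auto)
  then show "continuous_on {0..\<eta>} x_inv" using xi_image_Icc[OF x(1)] x by simp
qed

lemma deriv_x_inv:
  assumes s: "s \<in> \<Xi>" "0 < s"
  shows "(x_inv has_real_derivative c (x_inv s)) (at s)"
proof -
  obtain \<eta> where \<eta>: "\<eta> \<in> \<Xi>" "s < \<eta>" using S_open[OF s(1)] by blast
  have "(x_inv has_real_derivative inverse (inverse (c (x_inv s)))) (at s)"
  proof (rule DERIV_inverse_function[where f = xi and a = 0 and b = \<eta>])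
    show "(xi has_real_derivative inverse (c (x_inv s))) (at (x_inv s))"
      by (rule deriv_xi[OF x_inv_pos[OF s]])
    show "inverse (c (x_inv s)) \<noteq> 0" using c_pos[of "x_inv s"] xi_x_inv[OF s(1)] by simp
    show "xi (x_inv y) = y" if "0 < y" "y < \<eta>" for y
      using xi_x_inv S_down[OF \<eta>(1), of y] that by simp
    have "continuous_on (\<Xi> \<inter> {0<..}) x_inv" by (rule continuous_on_subset[OF cont_x_inv]) auto
    then show "isCont x_inv s" using continuous_on_eq_continuous_at[OF open_S_pos] s by auto
  qed (use s \<eta> in auto)
  then show ?thesis by simp
qed

text \<open>The coefficient f in the original variable, \<kappa>(x) = f(\<xi>(x)). By
  \<open>\<kappa>_eq\<close> it is a constant times the fourth root of \<epsilon>(x) \<mu>, so the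
  next formula is its derivative by the chain rule.\<close>

definition \<kappa> :: "real \<Rightarrow> real" where "\<kappa> x = sqrt (c 0) / sqrt (c x)"

definition \<kappa>' :: "real \<Rightarrow> real" where
  "\<kappa>' x = sqrt (c 0) * (inverse (sqrt (sqrt (\<epsilon> x * \<mu>))) / 2 * (inverse (sqrt (\<epsilon> x * \<mu>)) / 2 * (\<epsilon>' x * \<mu>)))"

lemma \<kappa>_eq: "\<kappa> x = sqrt (c 0) * sqrt (sqrt (\<epsilon> x * \<mu>))"
  by (simp add: \<kappa>_def c_of_def real_sqrt_divide)

lemma \<kappa>_pos: "0 \<le> x \<Longrightarrow> 0 < \<kappa> x"
  using c_pos[of x] c_pos[of 0] by (simp add: \<kappa>_def)

lemma cont_\<kappa>: "continuous_on {0..} \<kappa>"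
  unfolding \<kappa>_eq[abs_def] by (intro continuous_intros cont_\<epsilon>)

lemma cont_\<kappa>': "continuous_on {0..} \<kappa>'"
proof -
  have "sqrt (\<epsilon> x * \<mu>) \<noteq> 0" if "0 \<le> x" for x
    using \<epsilon>_pos[OF that] \<mu>_pos by simp
  then show ?thesis
    unfolding \<kappa>'_def[abs_def] by (intro continuous_intros cont_\<epsilon> cont_\<epsilon>') auto
qed

lemma deriv_\<kappa>: assumes "0 < x" shows "(\<kappa> has_real_derivative \<kappa>' x) (at x)"
proof -
  have p: "0 < \<epsilon> x * \<mu>" using \<epsilon>_pos[of x] \<mu>_pos assms by simp
  have 1: "((\<lambda>x. \<epsilon> x * \<mu>) has_real_derivative \<epsilon>' x * \<mu>) (at x)"
    by (rule DERIV_cmult_right[OF deriv_\<epsilon>_at[OF assms]])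
  have 2: "((\<lambda>x. sqrt (\<epsilon> x * \<mu>)) has_real_derivative inverse (sqrt (\<epsilon> x * \<mu>)) / 2 * (\<epsilon>' x * \<mu>)) (at x)"
    by (rule DERIV_chain2[OF DERIV_real_sqrt[OF p] 1])
  have 3: "((\<lambda>x. sqrt (sqrt (\<epsilon> x * \<mu>))) has_real_derivative
      inverse (sqrt (sqrt (\<epsilon> x * \<mu>))) / 2 * (inverse (sqrt (\<epsilon> x * \<mu>)) / 2 * (\<epsilon>' x * \<mu>))) (at x)"
    by (rule DERIV_chain2[OF DERIV_real_sqrt 2]) (use p in simp)
  show ?thesis
    unfolding \<kappa>_eq[abs_def] \<kappa>'_def by (rule DERIV_cmult[OF 3])
qed

lemma cont_c: "continuous_on {0..} c"
proof -
  have "sqrt (\<epsilon> x * \<mu>) \<noteq> 0" if "0 \<le> x" for x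
    using \<epsilon>_pos[OF that] \<mu>_pos by simp
  then show ?thesis
    unfolding c_of_def[abs_def] by (intro continuous_intros cont_\<epsilon>) auto
qed

abbreviation g :: "real \<Rightarrow> real" where "g \<equiv> f_of \<epsilon> \<mu>"

lemma g_eq: "g s = \<kappa> (x_inv s)"
  by (simp add: f_of_def \<kappa>_def)

lemma g_xi: "0 \<le> x \<Longrightarrow> g (xi x) = \<kappa> x"
  by (simp add: g_eq x_inv_xi)

text \<open>Here the derivative of f is \<kappa>'(x) times dx/d\<xi>, and dx/d\<xi> is the wave
  speed c(x).\<close>

sublocale vekua_coefficient \<Xi> g "\<lambda>s. \<kappa>' (x_inv s) * c (x_inv s)"
proof
  have img: "x_inv ` \<Xi> \<subseteq> {0..}" using xi_x_inv by auto
  show "continuous_on \<Xi> g"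
    unfolding g_eq[abs_def] by (rule continuous_on_compose2[OF cont_\<kappa> cont_x_inv img])
  show "continuous_on \<Xi> (\<lambda>s. \<kappa>' (x_inv s) * c (x_inv s))"
    by (intro continuous_on_mult continuous_on_compose2[OF cont_\<kappa>' cont_x_inv img]
        continuous_on_compose2[OF cont_c cont_x_inv img])
  show "(g has_real_derivative \<kappa>' (x_inv s) * c (x_inv s)) (at s)" if "s \<in> \<Xi>" "0 < s" for s
    unfolding g_eq[abs_def] by (rule DERIV_chain2[OF deriv_\<kappa>[OF x_inv_pos[OF that]] deriv_x_inv[OF that]])
  show "g s \<noteq> 0" if "s \<in> \<Xi>" for s
    using \<kappa>_pos[of "x_inv s"] xi_x_inv[OF that] by (simp add: g_eq)
  show "g 0 = 1" using g_xi[of 0] c_pos[of 0] by (simp add: xi_0 \<kappa>_def)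
qed

section \<open>Weights of the fields and the equivalence of the two problems\<close>

text \<open>The weights of the fields at x = 0. All dependence on x sits in f: by
  \<open>sqrt_c_\<epsilon>\<close> and \<open>sqrt_c_\<mu>\<close> the weights are \<open>kE\<close>
  f and \<open>kH\<close> / f, with \<open>kE\<close> \<open>kH\<close> = 1.\<close>

definition kE :: real where "kE = sqrt (c 0 * \<epsilon> 0)"
definition kH :: real where "kH = sqrt (c 0 * \<mu>)"

lemma c_sq: "0 \<le> x \<Longrightarrow> (c x)\<^sup>2 * \<epsilon> x * \<mu> = 1"
  using \<epsilon>_pos[of x] \<mu>_pos by (simp add: c_of_def power_divide)

lemma kE_pos: "0 < kE" and kH_pos: "0 < kH"
  using c_pos[of 0] \<epsilon>_pos[of 0] \<mu>_pos by (auto simp: kE_def kH_def)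

lemma kE_kH: "kE * kH = 1"
proof -
  have "kE * kH = sqrt ((c 0)\<^sup>2 * \<epsilon> 0 * \<mu>)"
    by (simp add: kE_def kH_def real_sqrt_mult power2_eq_square mult_ac)
  then show ?thesis by (simp add: c_sq)
qed

lemma \<kappa>_sq: assumes "0 \<le> x" shows "(\<kappa> x)\<^sup>2 * c x = c 0"
  using c_pos[OF assms] c_pos[of 0] by (simp add: \<kappa>_def power_divide)

lemma sqrt_c_\<mu>: assumes "0 \<le> x" shows "sqrt (c x * \<mu>) = kH / \<kappa> x"
proof (rule real_sqrt_unique)
  have "(kH / \<kappa> x)\<^sup>2 = c 0 * \<mu> / (\<kappa> x)\<^sup>2"
    using c_pos[of 0] \<mu>_pos by (simp add: kH_def power_divide)
  also have "\<dots> = c x * \<mu>" using \<kappa>_sq[OF assms] \<kappa>_pos[OF assms] by (simp add: field_simps)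
  finally show "(kH / \<kappa> x)\<^sup>2 = c x * \<mu>" .
  show "0 \<le> kH / \<kappa> x" using kH_pos \<kappa>_pos[OF assms] by simp
qed

text \<open>Divided by \<kappa>(x), this converts \<mu> times the t-derivative of H into the
  t-derivative of the second component of W.\<close>

lemma \<mu>_relation: assumes "0 \<le> x" shows "kE * (\<kappa> x)\<^sup>2 * (c x * \<mu>) = kH"
proof -
  have "kH\<^sup>2 = c 0 * \<mu>" using c_pos[of 0] \<mu>_pos by (simp add: kH_def)
  then have "kE * (\<kappa> x)\<^sup>2 * (c x * \<mu>) = kE * kH\<^sup>2" using \<kappa>_sq[OF assms] by (simp add: mult_ac)
  also have "\<dots> = kH" using kE_kH by (simp add: power2_eq_square)
  finally show ?thesis .
qed

text \<open>The counterpart for the other Maxwell equation: divided by \<kappa>(x), it converts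
  \<epsilon> times the t-derivative of E into the t-derivative of the first component of W.\<close>

lemma \<epsilon>_relation: assumes "0 \<le> x" shows "kH * (c x * \<epsilon> x) = kE * (\<kappa> x)\<^sup>2"
proof -
  have "kH * (c x * \<epsilon> x) = kE * (\<kappa> x)\<^sup>2 * ((c x)\<^sup>2 * \<epsilon> x * \<mu>)"
    using \<mu>_relation[OF assms, symmetric] by (simp add: power2_eq_square mult_ac)
  then show ?thesis using c_sq[OF assms] by simp
qed

lemma sqrt_c_\<epsilon>: assumes "0 \<le> x" shows "sqrt (c x * \<epsilon> x) = kE * \<kappa> x"
proof (rule real_sqrt_unique)
  show "(kE * \<kappa> x)\<^sup>2 = c x * \<epsilon> x" using \<epsilon>_relation[OF assms] kE_kH by algebra
  show "0 \<le> kE * \<kappa> x" using kE_pos \<kappa>_pos[OF assms] by simp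
qed

lemma W0_of_eq: "W0_of \<epsilon> \<mu> E0 H0 t = (kE *\<^sub>R E0 t, kH *\<^sub>R (\<i> * H0 t))"
  by (simp add: W0_of_def kE_def kH_def bc_of_complex_def bc_mult_def bc_j_def scaleR_conv_of_real)

lemma mem_maxwell_domain: "(x, t) \<in> maxwell_domain \<epsilon> \<mu> \<alpha> \<beta> \<longleftrightarrow> 0 \<le> x \<and> (xi x, t) \<in> tri \<Xi> \<alpha> \<beta>"
  using xi_nonneg by (auto simp: maxwell_domain_def mem_tri)

lemma mem_maxwell_domain_int: "(x, t) \<in> maxwell_domain_int \<epsilon> \<mu> \<alpha> \<beta> \<longleftrightarrow> 0 < x \<and> (xi x, t) \<in> tri_int \<Xi> \<alpha> \<beta>"
  using xi_pos by (auto simp: maxwell_domain_int_def mem_tri_int)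

text \<open>The two weights are reciprocal up to constants, so their logarithmic derivatives are
  f'/f and -f'/f: these are the zeroth-order terms of the Vekua equation, and the Maxwell equations
  supply the first-order ones.\<close>

lemma maxwell_imp_vekua:
  assumes sol: "maxwell_solution \<epsilon> \<mu> \<alpha> \<beta> E0 H0 E H"
  shows "vekua_solution_on \<Xi> g \<alpha> \<beta> (W0_of \<epsilon> \<mu> E0 H0)
     (\<lambda>s t. ((kE * g s) *\<^sub>R E (x_inv s) t, (kH * (1 / g s)) *\<^sub>R (\<i> * H (x_inv s) t)))"
proof -
  let ?D = "maxwell_domain \<epsilon> \<mu> \<alpha> \<beta>" and ?DI = "maxwell_domain_int \<epsilon> \<mu> \<alpha> \<beta>"
  obtain Ex Et Hx Ht where
    c: "continuous_on ?DI (\<lambda>(x, t). Et x t)" "continuous_on ?DI (\<lambda>(x, t). Ht x t)"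
    and d: "\<forall>x t. (x, t) \<in> ?DI \<longrightarrow>
           ((\<lambda>s. E s t) has_vector_derivative Ex x t) (at x) \<and>
           ((\<lambda>s. E x s) has_vector_derivative Et x t) (at t) \<and>
           ((\<lambda>s. H s t) has_vector_derivative Hx x t) (at x) \<and>
           ((\<lambda>s. H x s) has_vector_derivative Ht x t) (at t) \<and>
           complex_of_real (\<epsilon> x) * Et x t = \<i> * Hx x t \<and>
           \<i> * Ex x t = - complex_of_real \<mu> * Ht x t"
    using sol unfolding maxwell_solution_def by (elim conjE exE) simp
  have c0: "continuous_on ?D (\<lambda>z. E (fst z) (snd z))" "continuous_on ?D (\<lambda>z. H (fst z) (snd z))"
    using sol by (simp_all add: maxwell_solution_def case_prod_beta)
  have init: "E 0 t = E0 t" "H 0 t = H0 t" if "t \<in> {\<alpha>..\<beta>}" for t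
    using sol that by (auto simp: maxwell_solution_def)
  have sub: "tri \<Xi> \<alpha> \<beta> \<subseteq> \<Xi> \<times> UNIV" "tri_int \<Xi> \<alpha> \<beta> \<subseteq> \<Xi> \<times> UNIV"
    by (auto simp: tri_def tri_int_def)
  have D: "(x_inv s, t) \<in> ?D" if "(s, t) \<in> tri \<Xi> \<alpha> \<beta>" for s t
    using that xi_x_inv[of s] by (auto simp: mem_maxwell_domain mem_tri)
  have DI: "(x_inv s, t) \<in> ?DI" if "(s, t) \<in> tri_int \<Xi> \<alpha> \<beta>" for s t
    using that xi_x_inv[of s] x_inv_pos[of s] by (auto simp: mem_maxwell_domain_int mem_tri_int)
  have gz: "g (fst z) \<noteq> 0" if "z \<in> tri \<Xi> \<alpha> \<beta> \<or> z \<in> tri_int \<Xi> \<alpha> \<beta>" for z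
    using f_nonzero[of "fst z"] that by (cases z) (auto simp: mem_tri mem_tri_int)
  have c': "continuous_on ?DI (\<lambda>z. Et (fst z) (snd z))" "continuous_on ?DI (\<lambda>z. Ht (fst z) (snd z))"
    using c by (simp_all add: case_prod_beta)
  show ?thesis
    unfolding solution_iff
  proof (intro conjI exI[of _ "\<lambda>s t. ((kE * g s) *\<^sub>R Et (x_inv s) t, (kH * (1 / g s)) *\<^sub>R (\<i> * Ht (x_inv s) t))"] allI impI ballI)
    show "continuous_on (tri \<Xi> \<alpha> \<beta>) (\<lambda>z. ((kE * g (fst z)) *\<^sub>R E (x_inv (fst z)) (snd z),
        (kH * (1 / g (fst z))) *\<^sub>R (\<i> * H (x_inv (fst z)) (snd z))))"
      using gz by (intro continuous_intros continuous_on_fst_map[OF cont_f sub(1)]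
          continuous_on_map_fst[OF c0(1) cont_x_inv sub(1) D] continuous_on_map_fst[OF c0(2) cont_x_inv sub(1) D]) auto
    show "continuous_on (tri_int \<Xi> \<alpha> \<beta>) (\<lambda>z. ((kE * g (fst z)) *\<^sub>R Et (x_inv (fst z)) (snd z),
        (kH * (1 / g (fst z))) *\<^sub>R (\<i> * Ht (x_inv (fst z)) (snd z))))"
      using gz by (intro continuous_intros continuous_on_fst_map[OF cont_f sub(2)]
          continuous_on_map_fst[OF c'(1) cont_x_inv sub(2) DI] continuous_on_map_fst[OF c'(2) cont_x_inv sub(2) DI]) auto
    show "((kE * g 0) *\<^sub>R E (x_inv 0) t, (kH * (1 / g 0)) *\<^sub>R (\<i> * H (x_inv 0) t)) = W0_of \<epsilon> \<mu> E0 H0 t"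
      if "t \<in> {\<alpha>..\<beta>}" for t
      using init[OF that] x_inv_xi[of 0] by (simp add: W0_of_eq f_zero xi_0)
  next
    fix s t assume st: "(s, t) \<in> tri_int \<Xi> \<alpha> \<beta>"
    define x where "x = x_inv s"
    have s: "s \<in> \<Xi>" "0 < s" using st by (auto simp: mem_tri_int)
    have x: "0 < x" "0 \<le> x" using x_inv_pos[OF s] by (auto simp: x_def)
    have dx: "((\<lambda>s. E s t) has_vector_derivative Ex x t) (at x)" "((\<lambda>s. H s t) has_vector_derivative Hx x t) (at x)"
      and dt: "((\<lambda>s. E x s) has_vector_derivative Et x t) (at t)" "((\<lambda>s. H x s) has_vector_derivative Ht x t) (at t)"
      and eq: "complex_of_real (\<epsilon> x) * Et x t = \<i> * Hx x t" "\<i> * Ex x t = - complex_of_real \<mu> * Ht x t"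
      using d DI[OF st] unfolding x_def by auto
    show "((\<lambda>r. ((kE * g s) *\<^sub>R E (x_inv s) r, (kH * (1 / g s)) *\<^sub>R (\<i> * H (x_inv s) r))) has_vector_derivative
       ((kE * g s) *\<^sub>R Et (x_inv s) t, (kH * (1 / g s)) *\<^sub>R (\<i> * Ht (x_inv s) t))) (at t)"
      unfolding x_def[symmetric]
      by (intro has_vector_derivative_Pair bounded_linear.has_vector_derivative[OF bounded_linear_scaleR_right]
          bounded_linear.has_vector_derivative[OF bounded_linear_mult_right] dt)
    define \<gamma> \<gamma>' where "\<gamma> = g s" and "\<gamma>' = \<kappa>' x * c x"
    have \<gamma>: "\<gamma> = \<kappa> x" "\<gamma> > 0" using \<kappa>_pos[OF x(2)] by (simp_all add: \<gamma>_def g_eq x_def)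
    have qs: "q s = \<gamma>' / \<gamma>" by (simp add: q_def \<gamma>_def \<gamma>'_def x_def)
    have xd: "(x_inv has_vector_derivative c x) (at s)"
      using deriv_x_inv[OF s] by (simp add: x_def has_real_derivative_iff_has_vector_derivative)
    have dE: "((\<lambda>s. E (x_inv s) t) has_vector_derivative c x *\<^sub>R Ex x t) (at s)"
      using vector_diff_chain_at[OF xd dx(1)[unfolded x_def]] by (simp add: o_def x_def)
    have dH: "((\<lambda>s. \<i> * H (x_inv s) t) has_vector_derivative \<i> * (c x *\<^sub>R Hx x t)) (at s)"
      by (rule bounded_linear.has_vector_derivative[OF bounded_linear_mult_right])
         (use vector_diff_chain_at[OF xd dx(2)[unfolded x_def]] in \<open>simp add: o_def x_def\<close>)
    have dg: "(g has_real_derivative \<gamma>') (at s)"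
      using deriv_f[OF s] by (simp add: \<gamma>'_def x_def)
    have dg1: "((\<lambda>s. kE * g s) has_real_derivative kE * \<gamma>') (at s)"
      by (rule DERIV_cmult[OF dg])
    have dg2: "((\<lambda>s. kH * (1 / g s)) has_real_derivative kH * (- \<gamma>' / \<gamma>\<^sup>2)) (at s)"
      using \<gamma>(2) unfolding \<gamma>_def
      by (intro DERIV_cmult) (auto intro!: derivative_eq_intros dg simp: power2_eq_square)
    have "((\<lambda>r. ((kE * g r) *\<^sub>R E (x_inv r) t, (kH * (1 / g r)) *\<^sub>R (\<i> * H (x_inv r) t))) has_vector_derivative
       ((kE * \<gamma>) *\<^sub>R (c x *\<^sub>R Ex x t) + (kE * \<gamma>') *\<^sub>R E x t,
        (kH * (1 / \<gamma>)) *\<^sub>R (\<i> * (c x *\<^sub>R Hx x t)) + (kH * (- \<gamma>' / \<gamma>\<^sup>2)) *\<^sub>R (\<i> * H x t))) (at s)"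
      unfolding \<gamma>_def x_def
      by (intro has_vector_derivative_Pair has_vector_derivative_scaleR dE[unfolded x_def] dH[unfolded x_def]
          dg1[unfolded x_def] dg2[unfolded x_def \<gamma>_def])
    moreover have "(kE * \<gamma>) *\<^sub>R (c x *\<^sub>R Ex x t) = (kH * (1 / \<gamma>)) *\<^sub>R (\<i> * Ht x t)"
    proof -
      have "Ex x t = - \<i> * (\<i> * Ex x t)" by simp
      also have "\<dots> = \<mu> *\<^sub>R (\<i> * Ht x t)" unfolding eq(2) by (simp add: scaleR_conv_of_real)
      finally have "(kE * \<gamma>) *\<^sub>R (c x *\<^sub>R Ex x t) = (kE * \<gamma> * (c x * \<mu>)) *\<^sub>R (\<i> * Ht x t)" by simp
      also have "kE * \<gamma> * (c x * \<mu>) = kH * (1 / \<gamma>)"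
        using \<mu>_relation[OF x(2)] \<gamma> by (simp add: field_simps power2_eq_square)
      finally show ?thesis .
    qed
    moreover have "(kH * (1 / \<gamma>)) *\<^sub>R (\<i> * (c x *\<^sub>R Hx x t)) = (kE * \<gamma>) *\<^sub>R Et x t"
    proof -
      have "(kH * (1 / \<gamma>)) *\<^sub>R (\<i> * (c x *\<^sub>R Hx x t)) = (kH * (1 / \<gamma>) * c x) *\<^sub>R (\<i> * Hx x t)" by simp
      also have "\<dots> = (kH * (1 / \<gamma>) * c x * \<epsilon> x) *\<^sub>R Et x t"
        unfolding eq(1)[symmetric] by (simp add: scaleR_conv_of_real)
      also have "kH * (1 / \<gamma>) * c x * \<epsilon> x = kE * \<gamma>"
        using \<epsilon>_relation[OF x(2)] \<gamma> by (simp add: field_simps power2_eq_square)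
      finally show ?thesis .
    qed
    moreover have "\<xi>_slope s ((kE * \<gamma>) *\<^sub>R E x t, (kH * (1 / \<gamma>)) *\<^sub>R (\<i> * H x t))
        ((kE * \<gamma>) *\<^sub>R Et x t, (kH * (1 / \<gamma>)) *\<^sub>R (\<i> * Ht x t)) =
       ((kH * (1 / \<gamma>)) *\<^sub>R (\<i> * Ht x t) + (kE * \<gamma>') *\<^sub>R E x t,
        (kE * \<gamma>) *\<^sub>R Et x t + (kH * (- \<gamma>' / \<gamma>\<^sup>2)) *\<^sub>R (\<i> * H x t))"
      unfolding \<xi>_slope_def qs using \<gamma>(2) by (simp add: power2_eq_square mult_ac)
    ultimately show "((\<lambda>r. ((kE * g r) *\<^sub>R E (x_inv r) t, (kH * (1 / g r)) *\<^sub>R (\<i> * H (x_inv r) t))) has_vector_derivative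
       \<xi>_slope s ((kE * g s) *\<^sub>R E (x_inv s) t, (kH * (1 / g s)) *\<^sub>R (\<i> * H (x_inv s) t))
        ((kE * g s) *\<^sub>R Et (x_inv s) t, (kH * (1 / g s)) *\<^sub>R (\<i> * Ht (x_inv s) t))) (at s)"
      unfolding \<gamma>_def x_def by simp
  qed
qed

text \<open>The substitution is undone by dividing by the weights; it serves existence, the other
  direction serving the formula.\<close>

lemma vekua_imp_maxwell:
  assumes sol: "vekua_solution_on \<Xi> g \<alpha> \<beta> (W0_of \<epsilon> \<mu> E0 H0) W"
  shows "maxwell_solution \<epsilon> \<mu> \<alpha> \<beta> E0 H0
     (\<lambda>x t. (1 / (kE * \<kappa> x)) *\<^sub>R fst (W (xi x) t)) (\<lambda>x t. (\<kappa> x / kH) *\<^sub>R (- \<i> * snd (W (xi x) t)))"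
proof -
  let ?D = "maxwell_domain \<epsilon> \<mu> \<alpha> \<beta>" and ?DI = "maxwell_domain_int \<epsilon> \<mu> \<alpha> \<beta>"
  obtain Wt where W: "continuous_on (tri \<Xi> \<alpha> \<beta>) (\<lambda>z. W (fst z) (snd z))" "\<forall>t\<in>{\<alpha>..\<beta>}. W 0 t = W0_of \<epsilon> \<mu> E0 H0 t"
    "continuous_on (tri_int \<Xi> \<alpha> \<beta>) (\<lambda>z. Wt (fst z) (snd z))"
    "\<And>\<xi> t. (\<xi>, t) \<in> tri_int \<Xi> \<alpha> \<beta> \<Longrightarrow>
           ((\<lambda>s. W s t) has_vector_derivative \<xi>_slope \<xi> (W \<xi> t) (Wt \<xi> t)) (at \<xi>)"
    "\<And>\<xi> t. (\<xi>, t) \<in> tri_int \<Xi> \<alpha> \<beta> \<Longrightarrow> ((\<lambda>s. W \<xi> s) has_vector_derivative Wt \<xi> t) (at t)"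
    using sol by (rule solutionE) simp
  have sub: "?D \<subseteq> {0..} \<times> UNIV" "?DI \<subseteq> {0..} \<times> UNIV"
    by (auto simp: maxwell_domain_def maxwell_domain_int_def)
  have DI: "(xi x, t) \<in> tri_int \<Xi> \<alpha> \<beta>" if "(x, t) \<in> ?DI" for x t
    using that by (simp add: mem_maxwell_domain_int)
  have cW: "continuous_on ?D (\<lambda>z. W (xi (fst z)) (snd z))"
    by (rule continuous_on_map_fst[OF W(1) cont_xi sub(1)]) (simp add: mem_maxwell_domain)
  have cWt: "continuous_on ?DI (\<lambda>z. Wt (xi (fst z)) (snd z))"
    by (rule continuous_on_map_fst[OF W(3) cont_xi sub(2)]) (rule DI)
  note cc = continuous_on_fst_map[OF cont_\<kappa> sub(1)] continuous_on_fst_map[OF cont_\<kappa> sub(2)] continuous_on_fst_map[OF cont_c sub(2)]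
  have nz: "(x, t) \<in> ?D \<Longrightarrow> \<kappa> x \<noteq> 0" "(x, t) \<in> ?DI \<Longrightarrow> \<kappa> x \<noteq> 0" "(x, t) \<in> ?DI \<Longrightarrow> c x \<noteq> 0" for x t
    using \<kappa>_pos[of x] c_pos[of x] sub by auto
  have ex4: "P a b c d \<Longrightarrow> \<exists>a b c d. P a b c d"
    for P :: "(real \<Rightarrow> real \<Rightarrow> complex) \<Rightarrow> (real \<Rightarrow> real \<Rightarrow> complex) \<Rightarrow> (real \<Rightarrow> real \<Rightarrow> complex) \<Rightarrow> (real \<Rightarrow> real \<Rightarrow> complex) \<Rightarrow> bool"
      and a b c d
    by blast
  \<comment> \<open>The \<xi>-derivative of W has a term with \<open>q\<close>, which cancels
    against the derivative of the weight; what remains is the t-derivative of the opposite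
    component, divided by c for the change of variable.\<close>
  let ?Ex = "\<lambda>x t. (1 / (kE * \<kappa> x * c x)) *\<^sub>R snd (Wt (xi x) t)"
  let ?Et = "\<lambda>x t. (1 / (kE * \<kappa> x)) *\<^sub>R fst (Wt (xi x) t)"
  let ?Hx = "\<lambda>x t. (\<kappa> x / (kH * c x)) *\<^sub>R (- \<i> * fst (Wt (xi x) t))"
  let ?Ht = "\<lambda>x t. (\<kappa> x / kH) *\<^sub>R (- \<i> * snd (Wt (xi x) t))"
  show ?thesis
    unfolding maxwell_solution_def case_prod_beta
  proof (intro conjI ex4[of _ ?Ex ?Et ?Hx ?Ht] allI impI ballI)
    show "continuous_on ?D (\<lambda>z. (1 / (kE * \<kappa> (fst z))) *\<^sub>R fst (W (xi (fst z)) (snd z)))"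
      "continuous_on ?D (\<lambda>z. (\<kappa> (fst z) / kH) *\<^sub>R (- \<i> * snd (W (xi (fst z)) (snd z))))"
      "continuous_on ?DI (\<lambda>z. ?Ex (fst z) (snd z))" "continuous_on ?DI (\<lambda>z. ?Et (fst z) (snd z))"
      "continuous_on ?DI (\<lambda>z. ?Hx (fst z) (snd z))" "continuous_on ?DI (\<lambda>z. ?Ht (fst z) (snd z))"
      using kE_pos kH_pos by (auto intro!: continuous_intros cW cWt cc dest: nz)
    fix t assume t: "t \<in> {\<alpha>..\<beta>}"
    have k0: "\<kappa> 0 = 1" using g_xi[of 0] f_zero by (simp add: xi_0)
    show "(1 / (kE * \<kappa> 0)) *\<^sub>R fst (W (xi 0) t) = E0 t" "(\<kappa> 0 / kH) *\<^sub>R (- \<i> * snd (W (xi 0) t)) = H0 t"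
      using W(2) t kE_pos kH_pos by (simp_all add: k0 xi_0 W0_of_eq)
  next
    fix x t assume xt: "(x, t) \<in> ?DI"
    have x: "0 < x" "0 \<le> x" using xt by (auto simp: mem_maxwell_domain_int)
    define w wt where "w = W (xi x) t" and "wt = Wt (xi x) t"
    have k: "\<kappa> x > 0" "c x > 0" using \<kappa>_pos[OF x(2)] c_pos[OF x(2)] by auto
    note pos = k kE_pos kH_pos
    have t': "((\<lambda>s. W (xi x) s) has_vector_derivative wt) (at t)"
      unfolding wt_def by (rule W(5)[OF DI[OF xt]])
    show "((\<lambda>s. (1 / (kE * \<kappa> x)) *\<^sub>R fst (W (xi x) s)) has_vector_derivative ?Et x t) (at t)"
      "((\<lambda>s. (\<kappa> x / kH) *\<^sub>R (- \<i> * snd (W (xi x) s))) has_vector_derivative ?Ht x t) (at t)"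
      unfolding wt_def[symmetric]
      by (intro bounded_linear.has_vector_derivative[OF bounded_linear_scaleR_right]
          bounded_linear.has_vector_derivative[OF bounded_linear_mult_right]
          bounded_linear.has_vector_derivative[OF bounded_linear_fst]
          bounded_linear.has_vector_derivative[OF bounded_linear_snd] t')+
    have q: "q (xi x) = \<kappa>' x * c x / \<kappa> x"
      using x by (simp add: q_def x_inv_xi g_xi)
    have "(xi has_vector_derivative inverse (c x)) (at x)"
      using deriv_xi[OF x(1)] by (simp add: has_real_derivative_iff_has_vector_derivative)
    from vector_diff_chain_at[OF this W(4)[OF DI[OF xt]]]
    have dW: "((\<lambda>x. W (xi x) t) has_vector_derivative inverse (c x) *\<^sub>R \<xi>_slope (xi x) w wt) (at x)"
      by (simp add: o_def w_def wt_def)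
    have d1: "((\<lambda>x. 1 / (kE * \<kappa> x)) has_real_derivative - \<kappa>' x / (kE * (\<kappa> x)\<^sup>2)) (at x)"
      using pos by (auto intro!: derivative_eq_intros deriv_\<kappa>[OF x(1)] simp: power2_eq_square)
    have d2: "((\<lambda>x. \<kappa> x / kH) has_real_derivative \<kappa>' x / kH) (at x)"
      by (rule DERIV_cdivide[OF deriv_\<kappa>[OF x(1)]])
    have "((\<lambda>x. (1 / (kE * \<kappa> x)) *\<^sub>R fst (W (xi x) t)) has_vector_derivative
       (1 / (kE * \<kappa> x)) *\<^sub>R fst (inverse (c x) *\<^sub>R \<xi>_slope (xi x) w wt) + (- \<kappa>' x / (kE * (\<kappa> x)\<^sup>2)) *\<^sub>R fst (W (xi x) t)) (at x)"
      by (intro has_vector_derivative_scaleR d1 bounded_linear.has_vector_derivative[OF bounded_linear_fst] dW)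
    moreover have "(1 / (kE * \<kappa> x)) *\<^sub>R fst (inverse (c x) *\<^sub>R \<xi>_slope (xi x) w wt) + (- \<kappa>' x / (kE * (\<kappa> x)\<^sup>2)) *\<^sub>R fst (W (xi x) t) = ?Ex x t"
      unfolding w_def[symmetric] wt_def[symmetric] \<xi>_slope_def q using pos
      by (simp add: scaleR_add_right power2_eq_square field_simps)
    ultimately show "((\<lambda>x. (1 / (kE * \<kappa> x)) *\<^sub>R fst (W (xi x) t)) has_vector_derivative ?Ex x t) (at x)" by simp
    have "((\<lambda>x. (\<kappa> x / kH) *\<^sub>R (- \<i> * snd (W (xi x) t))) has_vector_derivative
       (\<kappa> x / kH) *\<^sub>R (- \<i> * snd (inverse (c x) *\<^sub>R \<xi>_slope (xi x) w wt)) + (\<kappa>' x / kH) *\<^sub>R (- \<i> * snd (W (xi x) t))) (at x)"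
      by (intro has_vector_derivative_scaleR d2 bounded_linear.has_vector_derivative[OF bounded_linear_snd]
          bounded_linear.has_vector_derivative[OF bounded_linear_mult_right] dW)
    moreover have "(\<kappa> x / kH) *\<^sub>R (- \<i> * snd (inverse (c x) *\<^sub>R \<xi>_slope (xi x) w wt)) + (\<kappa>' x / kH) *\<^sub>R (- \<i> * snd (W (xi x) t)) = ?Hx x t"
      unfolding w_def[symmetric] wt_def[symmetric] \<xi>_slope_def q using pos
      by (simp add: scaleR_diff_right right_diff_distrib field_simps)
    ultimately show "((\<lambda>x. (\<kappa> x / kH) *\<^sub>R (- \<i> * snd (W (xi x) t))) has_vector_derivative ?Hx x t) (at x)" by simp
    have "complex_of_real (\<epsilon> x) * ?Et x t = (\<epsilon> x / (kE * \<kappa> x)) *\<^sub>R fst wt"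
      by (simp add: wt_def scaleR_conv_of_real)
    also have "\<epsilon> x / (kE * \<kappa> x) = \<kappa> x / (kH * c x)"
      using \<epsilon>_relation[OF x(2)] pos by (simp add: field_simps power2_eq_square)
    also have "(\<kappa> x / (kH * c x)) *\<^sub>R fst wt = \<i> * ?Hx x t"
      by (simp add: wt_def)
    finally show "complex_of_real (\<epsilon> x) * ?Et x t = \<i> * ?Hx x t" .
    have "- complex_of_real \<mu> * ?Ht x t = (\<mu> * \<kappa> x / kH) *\<^sub>R (\<i> * snd wt)"
      by (simp add: wt_def scaleR_conv_of_real)
    also have "\<mu> * \<kappa> x / kH = 1 / (kE * \<kappa> x * c x)"
      using \<mu>_relation[OF x(2)] pos by (simp add: field_simps power2_eq_square)
    also have "(1 / (kE * \<kappa> x * c x)) *\<^sub>R (\<i> * snd wt) = \<i> * ?Ex x t"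
      by (simp add: wt_def)
    finally show "\<i> * ?Ex x t = - complex_of_real \<mu> * ?Ht x t" by simp
  qed
qed

lemma C1_W0_of:
  assumes "C1_on T E0" "C1_on T H0"
  shows "C1_on T (W0_of \<epsilon> \<mu> E0 H0)"
proof -
  obtain e' where e': "continuous_on T e'" "\<And>x. x \<in> T \<Longrightarrow> (E0 has_vector_derivative e' x) (at x within T)"
    using assms(1) unfolding C1_on_def by blast
  obtain h' where h': "continuous_on T h'" "\<And>x. x \<in> T \<Longrightarrow> (H0 has_vector_derivative h' x) (at x within T)"
    using assms(2) unfolding C1_on_def by blast
  show ?thesis
    unfolding C1_on_def W0_of_eq[abs_def]
    by (intro exI[of _ "\<lambda>x. (kE *\<^sub>R e' x, kH *\<^sub>R (\<i> * h' x))"] conjI ballI continuous_intros e' h'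
        has_vector_derivative_Pair bounded_linear.has_vector_derivative[OF bounded_linear_scaleR_right]
        bounded_linear.has_vector_derivative[OF bounded_linear_mult_right])
qed

text \<open>Any Maxwell solution becomes a Vekua solution, whose value is the series; the weights at
  x are then divided out.\<close>

lemma maxwell_formula:
  assumes "C1_on {\<alpha>..\<beta>} E0" "C1_on {\<alpha>..\<beta>} H0"
    and sol: "maxwell_solution \<epsilon> \<mu> \<alpha> \<beta> E0 H0 E H"
    and xt: "(x, t) \<in> maxwell_domain \<epsilon> \<mu> \<alpha> \<beta>" "0 < x"
  shows "E x t = complex_of_real (1 / sqrt (c x * \<epsilon> x)) * bc_R (vekua_formula1 g (W0_of \<epsilon> \<mu> E0 H0) (xi x) t)"
    and "H x t = - (\<i> / complex_of_real (sqrt (c x * \<mu>))) * bc_I (vekua_formula1 g (W0_of \<epsilon> \<mu> E0 H0) (xi x) t)"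
proof -
  have x: "0 \<le> x" "(xi x, t) \<in> tri \<Xi> \<alpha> \<beta>" using xt by (auto simp: mem_maxwell_domain)
  have F: "vekua_formula1 g (W0_of \<epsilon> \<mu> E0 H0) (xi x) t = ((kE * \<kappa> x) *\<^sub>R E x t, (kH / \<kappa> x) *\<^sub>R (\<i> * H x t))"
    using solution_formula[OF C1_W0_of[OF assms(1,2)] maxwell_imp_vekua[OF sol] x(2) xi_pos[OF xt(2)]]
    by (simp add: x_inv_xi[OF x(1)] g_xi[OF x(1)])
  show "E x t = complex_of_real (1 / sqrt (c x * \<epsilon> x)) * bc_R (vekua_formula1 g (W0_of \<epsilon> \<mu> E0 H0) (xi x) t)"
    unfolding F bc_R_def sqrt_c_\<epsilon>[OF x(1)] using kE_pos \<kappa>_pos[OF x(1)] by (simp add: scaleR_conv_of_real)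
  show "H x t = - (\<i> / complex_of_real (sqrt (c x * \<mu>))) * bc_I (vekua_formula1 g (W0_of \<epsilon> \<mu> E0 H0) (xi x) t)"
    unfolding F bc_I_def sqrt_c_\<mu>[OF x(1)] using kH_pos \<kappa>_pos[OF x(1)] by (simp add: scaleR_conv_of_real)
qed

end

text \<open>Uniqueness takes the form that every solution equals the explicit expression off the
  initial line, on which its values are prescribed by the notion of solution. Summability
  accompanies the Vekua formulas because \<open>suminf\<close> denotes a value even for a divergent
  series.\<close>

theorem theorem1:
  shows
  "(\<forall>(f :: real \<Rightarrow> real) (W0 :: real \<Rightarrow> bicomplex) (\<alpha> :: real) (\<beta> :: real).
      C1_on {0..} f \<and> (\<forall>\<xi>\<ge>0. f \<xi> \<noteq> 0) \<and> f 0 = 1 \<and> \<alpha> < \<beta> \<and> C1_on {\<alpha>..\<beta>} W0 \<longrightarrow>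
        (\<exists>W. vekua_solution f \<alpha> \<beta> W0 W) \<and>
        (\<forall>W. vekua_solution f \<alpha> \<beta> W0 W \<longrightarrow>
           (\<forall>\<xi> t. 0 < \<xi> \<and> \<alpha> \<le> t - \<xi> \<and> t + \<xi> \<le> \<beta> \<longrightarrow>
              summable (termA1 f W0 \<xi> t) \<and> summable (termB1 f W0 \<xi> t) \<and>
              summable (termA2 f W0 \<xi> t) \<and> summable (termB2 f W0 \<xi> t) \<and>
              W \<xi> t = vekua_formula1 f W0 \<xi> t \<and>
              W \<xi> t = vekua_formula2 f W0 \<xi> t)))
   \<and>
   (\<forall>(\<epsilon> :: real \<Rightarrow> real) (\<mu> :: real) (E0 :: real \<Rightarrow> complex) (H0 :: real \<Rightarrow> complex) (\<alpha> :: real) (\<beta> :: real).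
      C1_on {0..} \<epsilon> \<and> (\<forall>x\<ge>0. \<epsilon> x > 0) \<and> \<mu> > 0 \<and> \<alpha> < \<beta> \<and>
      C1_on {\<alpha>..\<beta>} E0 \<and> C1_on {\<alpha>..\<beta>} H0 \<longrightarrow>
        (\<exists>E H. maxwell_solution \<epsilon> \<mu> \<alpha> \<beta> E0 H0 E H) \<and>
        (\<forall>E H. maxwell_solution \<epsilon> \<mu> \<alpha> \<beta> E0 H0 E H \<longrightarrow>
           (\<forall>x t. (x, t) \<in> maxwell_domain \<epsilon> \<mu> \<alpha> \<beta> \<and> 0 < x \<longrightarrow>
              E x t = complex_of_real (1 / sqrt (c_of \<epsilon> \<mu> x * \<epsilon> x)) *
                        bc_R (vekua_formula1 (f_of \<epsilon> \<mu>) (W0_of \<epsilon> \<mu> E0 H0) (xi_of \<epsilon> \<mu> x) t) \<and>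
              H x t = - (\<i> / complex_of_real (sqrt (c_of \<epsilon> \<mu> x * \<mu>))) *
                        bc_I (vekua_formula1 (f_of \<epsilon> \<mu>) (W0_of \<epsilon> \<mu> E0 H0) (xi_of \<epsilon> \<mu> x) t))))"
proof (intro conjI allI impI)
  fix f :: "real \<Rightarrow> real" and W0 :: "real \<Rightarrow> bicomplex" and \<alpha> \<beta> :: real
  assume a: "C1_on {0..} f \<and> (\<forall>\<xi>\<ge>0. f \<xi> \<noteq> 0) \<and> f 0 = 1 \<and> \<alpha> < \<beta> \<and> C1_on {\<alpha>..\<beta>} W0"
  then obtain f' where f': "continuous_on {0..} f'" "\<And>x. 0 \<le> x \<Longrightarrow> (f has_real_derivative f' x) (at x within {0..})"
    unfolding C1_on_def by (auto simp: has_real_derivative_iff_has_vector_derivative)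
  interpret half_open_interval "{0..}" by (rule half_open_interval_nonneg)
  \<comment> \<open>The derivative given within {0..} is two-sided at positive points, since the
    positive half-line is open.\<close>
  interpret vekua_coefficient "{0..}" f f'
  proof
    show "continuous_on {0..} f" using f'(2) by (intro DERIV_continuous_on) auto
    show "(f has_real_derivative f' \<xi>) (at \<xi>)" if "0 < \<xi>" for \<xi>
    proof -
      have "(f has_real_derivative f' \<xi>) (at \<xi> within {0<..})"
        by (rule has_field_derivative_subset[OF f'(2)]) (use that in auto)
      then show ?thesis using that at_within_open[of \<xi> "{0<..}"] by simp
    qed
  qed (use a f'(1) in auto)
  have W0: "C1_on {\<alpha>..\<beta>} W0" using a by simp
  show "\<exists>W. vekua_solution f \<alpha> \<beta> W0 W"
    unfolding vekua_solution_iff by (rule solution_exists[OF W0])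
  fix W \<xi> t
  assume "vekua_solution f \<alpha> \<beta> W0 W" and pt: "0 < \<xi> \<and> \<alpha> \<le> t - \<xi> \<and> t + \<xi> \<le> \<beta>"
  then have sol: "vekua_solution_on {0..} f \<alpha> \<beta> W0 W" by (simp add: vekua_solution_iff)
  have "(\<xi>, t) \<in> tri {0..} \<alpha> \<beta>" "0 < \<xi>" using pt by (auto simp: mem_tri)
  note F = solution_formula[OF W0 sol this]
  show "summable (termA1 f W0 \<xi> t)" "summable (termB1 f W0 \<xi> t)" "summable (termA2 f W0 \<xi> t)"
    "summable (termB2 f W0 \<xi> t)" "W \<xi> t = vekua_formula1 f W0 \<xi> t" "W \<xi> t = vekua_formula2 f W0 \<xi> t"
    using F by blast+
next
  fix \<epsilon> :: "real \<Rightarrow> real" and \<mu> :: real and E0 H0 :: "real \<Rightarrow> complex" and \<alpha> \<beta> :: real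
  assume a: "C1_on {0..} \<epsilon> \<and> (\<forall>x\<ge>0. \<epsilon> x > 0) \<and> \<mu> > 0 \<and> \<alpha> < \<beta> \<and> C1_on {\<alpha>..\<beta>} E0 \<and> C1_on {\<alpha>..\<beta>} H0"
  then obtain \<epsilon>' where \<epsilon>': "continuous_on {0..} \<epsilon>'" "\<And>x. 0 \<le> x \<Longrightarrow> (\<epsilon> has_real_derivative \<epsilon>' x) (at x within {0..})"
    unfolding C1_on_def by (auto simp: has_real_derivative_iff_has_vector_derivative)
  interpret maxwell_medium \<epsilon> \<epsilon>' \<mu>
    by unfold_locales (use a \<epsilon>' in auto)
  have E0: "C1_on {\<alpha>..\<beta>} E0" and H0: "C1_on {\<alpha>..\<beta>} H0" using a by auto
  obtain W where "vekua_solution_on \<Xi> g \<alpha> \<beta> (W0_of \<epsilon> \<mu> E0 H0) W"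
    using solution_exists[OF C1_W0_of[OF E0 H0]] by blast
  from vekua_imp_maxwell[OF this]
  show "\<exists>E H. maxwell_solution \<epsilon> \<mu> \<alpha> \<beta> E0 H0 E H" by blast
  fix E H x t
  assume "maxwell_solution \<epsilon> \<mu> \<alpha> \<beta> E0 H0 E H" and "(x, t) \<in> maxwell_domain \<epsilon> \<mu> \<alpha> \<beta> \<and> 0 < x"
  then show "E x t = complex_of_real (1 / sqrt (c x * \<epsilon> x)) * bc_R (vekua_formula1 g (W0_of \<epsilon> \<mu> E0 H0) (xi x) t)"
    "H x t = - (\<i> / complex_of_real (sqrt (c x * \<mu>))) * bc_I (vekua_formula1 g (W0_of \<epsilon> \<mu> E0 H0) (xi x) t)"
    using maxwell_formula[OF E0 H0] by auto
qed

end
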